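(* Let $\Pi$ be an infinite-dimensional irreducible smooth $R$-representation of $G$ such that $\Pi|_H$ is reducible, where $H=ZK_0G'$; then $\Pi|_H=\Pi^+\oplus\Pi^-$ with $\Pi^+$ the component having a nonzero Whittaker model with respect to $u\mapsto\psi_0(u_{1,2})$, where $\psi_0$ is a character of $F$ nontrivial on $O_F$ and trivial on $P_F$. Let $a_\Pi$ be the integer with $\Pi\simeq a_\Pi\cdot1+\operatorname{ind}_B^G1$ on $I_j$ for large $j$. Then for all sufficiently large $m$: $\dim_R(\Pi^+)^{K'_j}=a_\Pi/2+q^{2m+1}$ for $j\in\{2m+1,2m+2\}$ and $\dim_R(\Pi^-)^{K'_j}=a_\Pi/2+q^{2m}$ for $j\in\{2m,2m+1\}$. Consequently, for $\pi\in L(\Pi)$ and large $j$, $\dim_R\pi^{K'_j}=|L(\Pi)|^{-1}(a_\Pi+2q^j)$ if either $j$ is odd and $\pi\subset\Pi^+|_{G'}$ or $j$ is even and $\pi\subset\Pi^-|_{G'}$, and $\dim_R\pi^{K'_j}=|L(\Pi)|^{-1}(a_\Pi+2q^{j-1})$ otherwise.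
   Context: $F$ is a non-archimedean local field with ring of integers $O_F$, uniformizer $p_F$, maximal ideal $P_F$, residue field with $q$ elements of characteristic $p$; $R$ algebraically closed, $\operatorname{char}_R\neq p$; $G=GL_2(F)$ with centre $Z$, $G'=SL_2(F)$, $B$ upper triangular Borel, $U$ its unipotent radical, $K_0=GL_2(O_F)$, $K_{j+1}=1+p_F^jM_2(P_F)$, $K'_j=K_j\cap G'$; $I_j$ are the congruence subgroups of the Iwahori subgroup. A Whittaker model with respect to a character $\theta$ of $U$ means nonzero $\theta$-coinvariants. $L(\Pi)$ is the set of isomorphism classes of irreducible constituents of $\Pi|_{G'}$; when $\Pi|_H$ is reducible it has exactly two components. *)

theory Defs
  imports Complex_Main "HOL-Library.Function_Algebras" "HOL-Computational_Algebra.Polynomial"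
begin

text \<open>F is a field type 'f with a valuation v (values on nonzero elements; v 0 is irrelevant).
  q is the cardinality of the residue field.\<close>

definition vpow :: "('f::field \<Rightarrow> int) \<Rightarrow> int \<Rightarrow> 'f set" where
  "vpow v n = {x. x = 0 \<or> v x \<ge> n}"

definition nonarch_local_field :: "('f::field \<Rightarrow> int) \<Rightarrow> nat \<Rightarrow> bool" where
  "nonarch_local_field v q \<longleftrightarrow>
     (\<forall>x y. x \<noteq> 0 \<longrightarrow> y \<noteq> 0 \<longrightarrow> v (x * y) = v x + v y) \<and>
     (\<forall>x y. x \<noteq> 0 \<longrightarrow> y \<noteq> 0 \<longrightarrow> x + y \<noteq> 0 \<longrightarrow> v (x + y) \<ge> min (v x) (v y)) \<and>
     (\<forall>n. \<exists>x. x \<noteq> 0 \<and> v x = n) \<and>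
     (\<forall>s::nat \<Rightarrow> 'f. (\<forall>N. \<exists>M. \<forall>m\<ge>M. \<forall>n\<ge>M. s m - s n \<in> vpow v N) \<longrightarrow>
        (\<exists>L. \<forall>N. \<exists>M. \<forall>n\<ge>M. s n - L \<in> vpow v N)) \<and>
     finite (vpow v 0 // {(x, y). x \<in> vpow v 0 \<and> y \<in> vpow v 0 \<and> x - y \<in> vpow v 1}) \<and>
     card (vpow v 0 // {(x, y). x \<in> vpow v 0 \<and> y \<in> vpow v 0 \<and> x - y \<in> vpow v 1}) = q"

definition alg_closed :: "'r::field itself \<Rightarrow> bool" where
  "alg_closed _ \<longleftrightarrow> (\<forall>p :: 'r poly. degree p > 0 \<longrightarrow> (\<exists>x. poly p x = 0))"

type_synonym 'f mat2 = "'f \<times> 'f \<times> 'f \<times> 'f"   (* (a,b,c,d) = [[a,b],[c,d]] *)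

fun mmul :: "'f::comm_ring_1 mat2 \<Rightarrow> 'f mat2 \<Rightarrow> 'f mat2" where
  "mmul (a, b, c, d) (e, f, g, h) = (a*e + b*g, a*f + b*h, c*e + d*g, c*f + d*h)"

fun mdet :: "'f::comm_ring_1 mat2 \<Rightarrow> 'f" where
  "mdet (a, b, c, d) = a*d - b*c"

definition mone :: "'f::comm_ring_1 mat2" where "mone = (1, 0, 0, 1)"

definition GL2 :: "'f::field mat2 set" where "GL2 = {g. mdet g \<noteq> 0}"
definition SL2 :: "'f::field mat2 set" where "SL2 = {g. mdet g = 1}"
definition centre :: "'f::field mat2 set" where "centre = {(a, 0, 0, a) | a. a \<noteq> 0}"
definition Borel :: "'f::field mat2 set" where "Borel = {(a, b, 0, d) | a b d. a \<noteq> 0 \<and> d \<noteq> 0}"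
definition Unip :: "'f::field mat2 set" where "Unip = {(1, x, 0, 1) | x. True}"

definition K0 :: "('f::field \<Rightarrow> int) \<Rightarrow> 'f mat2 set" where
  "K0 v = {(a, b, c, d). a \<in> vpow v 0 \<and> b \<in> vpow v 0 \<and> c \<in> vpow v 0 \<and> d \<in> vpow v 0 \<and>
            a*d - b*c \<noteq> 0 \<and> v (a*d - b*c) = 0}"

definition Kc :: "('f::field \<Rightarrow> int) \<Rightarrow> nat \<Rightarrow> 'f mat2 set" where
  "Kc v j = (if j = 0 then K0 v else
     {(a, b, c, d). a - 1 \<in> vpow v (int j) \<and> b \<in> vpow v (int j) \<and> c \<in> vpow v (int j) \<and>
        d - 1 \<in> vpow v (int j)} \<inter> GL2)"

definition Kc' :: "('f::field \<Rightarrow> int) \<Rightarrow> nat \<Rightarrow> 'f mat2 set" where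
  "Kc' v j = Kc v j \<inter> SL2"

text \<open>Congruence subgroups of the Iwahori subgroup (standard Iwahori filtration), n \<ge> 1.\<close>
definition Iw :: "('f::field \<Rightarrow> int) \<Rightarrow> nat \<Rightarrow> 'f mat2 set" where
  "Iw v n = {(a, b, c, d). a - 1 \<in> vpow v (int ((n + 1) div 2)) \<and> d - 1 \<in> vpow v (int ((n + 1) div 2)) \<and>
              b \<in> vpow v (int (n div 2)) \<and> c \<in> vpow v (int (n div 2) + 1)} \<inter> GL2"

definition Hgrp :: "('f::field \<Rightarrow> int) \<Rightarrow> 'f mat2 set" where
  "Hgrp v = {mmul (mmul z k) s | z k s. z \<in> centre \<and> k \<in> K0 v \<and> s \<in> SL2}"

definition subsp :: "('r::field \<Rightarrow> 'v::ab_group_add \<Rightarrow> 'v) \<Rightarrow> 'v set \<Rightarrow> bool" where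
  "subsp sc S \<longleftrightarrow> 0 \<in> S \<and> (\<forall>x\<in>S. \<forall>y\<in>S. x + y \<in> S) \<and> (\<forall>c. \<forall>x\<in>S. sc c x \<in> S)"

definition vspace :: "('r::field \<Rightarrow> 'v::ab_group_add \<Rightarrow> 'v) \<Rightarrow> 'v set \<Rightarrow> bool" where
  "vspace sc V \<longleftrightarrow> subsp sc V \<and>
     (\<forall>a. \<forall>x\<in>V. \<forall>y\<in>V. sc a (x + y) = sc a x + sc a y) \<and>
     (\<forall>a b. \<forall>x\<in>V. sc (a + b) x = sc a x + sc b x) \<and>
     (\<forall>a b. \<forall>x\<in>V. sc (a * b) x = sc a (sc b x)) \<and> (\<forall>x\<in>V. sc 1 x = x)"

definition rspan :: "('r::field \<Rightarrow> 'v::ab_group_add \<Rightarrow> 'v) \<Rightarrow> 'v set \<Rightarrow> 'v set" where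
  "rspan sc X = \<Inter> {S. subsp sc S \<and> X \<subseteq> S}"

definition indep_mod :: "('r::field \<Rightarrow> 'v::ab_group_add \<Rightarrow> 'v) \<Rightarrow> 'v set \<Rightarrow> nat \<Rightarrow> (nat \<Rightarrow> 'v) \<Rightarrow> bool" where
  "indep_mod sc B n x \<longleftrightarrow> (\<forall>c. (\<Sum>i<n. sc (c i) (x i)) \<in> B \<longrightarrow> (\<forall>i<n. c i = 0))"

text \<open>X (a subspace containing B) has image of dimension exactly n in the quotient by B.\<close>
definition has_qdim :: "('r::field \<Rightarrow> 'v::ab_group_add \<Rightarrow> 'v) \<Rightarrow> 'v set \<Rightarrow> 'v set \<Rightarrow> nat \<Rightarrow> bool" where
  "has_qdim sc B X n \<longleftrightarrow>
     (\<exists>x. (\<forall>i<n. x i \<in> X) \<and> indep_mod sc B n x) \<and>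
     \<not> (\<exists>x. (\<forall>i<Suc n. x i \<in> X) \<and> indep_mod sc B (Suc n) x)"

definition has_dim :: "('r::field \<Rightarrow> 'v::ab_group_add \<Rightarrow> 'v) \<Rightarrow> 'v set \<Rightarrow> nat \<Rightarrow> bool" where
  "has_dim sc X n \<longleftrightarrow> has_qdim sc {0} X n"

definition infinite_dim :: "('r::field \<Rightarrow> 'v::ab_group_add \<Rightarrow> 'v) \<Rightarrow> 'v set \<Rightarrow> bool" where
  "infinite_dim sc X \<longleftrightarrow> (\<forall>n. \<exists>x. (\<forall>i<n. x i \<in> X) \<and> indep_mod sc {0} n x)"

definition invariant :: "('g \<Rightarrow> 'v \<Rightarrow> 'v) \<Rightarrow> 'g set \<Rightarrow> 'v set \<Rightarrow> bool" where
  "invariant \<rho> S W \<longleftrightarrow> (\<forall>g\<in>S. \<forall>w\<in>W. \<rho> g w \<in> W)"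

definition fixed :: "('g \<Rightarrow> 'v \<Rightarrow> 'v) \<Rightarrow> 'g set \<Rightarrow> 'v set \<Rightarrow> 'v set" where
  "fixed \<rho> K W = {w \<in> W. \<forall>k\<in>K. \<rho> k w = w}"

text \<open>Preimage in A of the K-fixed vectors of the subquotient A/B.\<close>
definition qfixed :: "('g \<Rightarrow> 'v::ab_group_add \<Rightarrow> 'v) \<Rightarrow> 'g set \<Rightarrow> 'v set \<Rightarrow> 'v set \<Rightarrow> 'v set" where
  "qfixed \<rho> K A B = {a \<in> A. \<forall>k\<in>K. \<rho> k a - a \<in> B}"

definition smooth_rep :: "('f::field \<Rightarrow> int) \<Rightarrow> ('r::field \<Rightarrow> 'v::ab_group_add \<Rightarrow> 'v) \<Rightarrow> 'v set \<Rightarrow> ('f mat2 \<Rightarrow> 'v \<Rightarrow> 'v) \<Rightarrow> bool" where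
  "smooth_rep v sc V \<rho> \<longleftrightarrow> vspace sc V \<and> invariant \<rho> GL2 V \<and>
     (\<forall>g\<in>GL2. \<forall>x\<in>V. \<forall>y\<in>V. \<rho> g (x + y) = \<rho> g x + \<rho> g y) \<and>
     (\<forall>g\<in>GL2. \<forall>c. \<forall>x\<in>V. \<rho> g (sc c x) = sc c (\<rho> g x)) \<and>
     (\<forall>x\<in>V. \<rho> mone x = x) \<and>
     (\<forall>g\<in>GL2. \<forall>h\<in>GL2. \<forall>x\<in>V. \<rho> (mmul g h) x = \<rho> g (\<rho> h x)) \<and>
     (\<forall>x\<in>V. \<exists>j\<ge>1. \<forall>k\<in>Kc v j. \<rho> k x = x)"

definition irred_on :: "('r::field \<Rightarrow> 'v::ab_group_add \<Rightarrow> 'v) \<Rightarrow> ('g \<Rightarrow> 'v \<Rightarrow> 'v) \<Rightarrow> 'g set \<Rightarrow> 'v set \<Rightarrow> bool" where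
  "irred_on sc \<rho> S W \<longleftrightarrow> subsp sc W \<and> invariant \<rho> S W \<and> W \<noteq> {0} \<and>
     (\<forall>W'. subsp sc W' \<and> W' \<subseteq> W \<and> invariant \<rho> S W' \<longrightarrow> W' = {0} \<or> W' = W)"

definition rep_iso :: "('r::field \<Rightarrow> 'v::ab_group_add \<Rightarrow> 'v) \<Rightarrow> 'v set \<Rightarrow> ('g \<Rightarrow> 'v \<Rightarrow> 'v) \<Rightarrow>
     ('r \<Rightarrow> 'w::ab_group_add \<Rightarrow> 'w) \<Rightarrow> 'w set \<Rightarrow> ('g \<Rightarrow> 'w \<Rightarrow> 'w) \<Rightarrow> 'g set \<Rightarrow> bool" where
  "rep_iso sc1 W1 \<rho>1 sc2 W2 \<rho>2 S \<longleftrightarrow> (\<exists>f. bij_betw f W1 W2 \<and>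
     (\<forall>x\<in>W1. \<forall>y\<in>W1. f (x + y) = f x + f y) \<and> (\<forall>c. \<forall>x\<in>W1. f (sc1 c x) = sc2 c (f x)) \<and>
     (\<forall>g\<in>S. \<forall>x\<in>W1. f (\<rho>1 g x) = \<rho>2 g (f x)))"

definition iso_triv_plus :: "('r::field \<Rightarrow> 'v::ab_group_add \<Rightarrow> 'v) \<Rightarrow> 'v set \<Rightarrow> ('g \<Rightarrow> 'v \<Rightarrow> 'v) \<Rightarrow> nat \<Rightarrow>
     ('r \<Rightarrow> 'w::ab_group_add \<Rightarrow> 'w) \<Rightarrow> 'w set \<Rightarrow> ('g \<Rightarrow> 'w \<Rightarrow> 'w) \<Rightarrow> 'g set \<Rightarrow> bool" where
  "iso_triv_plus sc1 W1 \<rho>1 n sc2 W2 \<rho>2 S \<longleftrightarrow> (\<exists>T X.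
     subsp sc1 T \<and> subsp sc1 X \<and> T \<subseteq> W1 \<and> X \<subseteq> W1 \<and> invariant \<rho>1 S X \<and>
     fixed \<rho>1 S T = T \<and> has_dim sc1 T n \<and> T \<inter> X = {0} \<and> {t + x | t x. t \<in> T \<and> x \<in> X} = W1 \<and>
     rep_iso sc1 X \<rho>1 sc2 W2 \<rho>2 S)"

text \<open>The smooth induced representation ind_B^G 1 (= Ind_B^G 1, as B\G is compact),
  realised on functions GL_2(F) \<rightarrow> R, extended by 0 outside GL_2(F).\<close>
definition ind_sp :: "('f::field \<Rightarrow> int) \<Rightarrow> ('f mat2 \<Rightarrow> 'r::field) set" where
  "ind_sp v = {f. (\<forall>g. g \<notin> GL2 \<longrightarrow> f g = 0) \<and> (\<forall>b\<in>Borel. \<forall>g\<in>GL2. f (mmul b g) = f g) \<and>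
       (\<exists>j\<ge>1. \<forall>k\<in>Kc v j. \<forall>g\<in>GL2. f (mmul g k) = f g)}"

definition ind_act :: "'f::field mat2 \<Rightarrow> ('f mat2 \<Rightarrow> 'r::field) \<Rightarrow> ('f mat2 \<Rightarrow> 'r)" where
  "ind_act g f = (\<lambda>x. if x \<in> GL2 then f (mmul x g) else 0)"

definition fsc :: "'r::field \<Rightarrow> ('a \<Rightarrow> 'r) \<Rightarrow> ('a \<Rightarrow> 'r)" where
  "fsc c f = (\<lambda>x. c * f x)"

text \<open>"Pi \<simeq> a.1 + ind_B^G 1 on S" for an integer a (identity of virtual representations).\<close>
definition virt_eq_on :: "('r::field \<Rightarrow> 'v::ab_group_add \<Rightarrow> 'v) \<Rightarrow> 'v set \<Rightarrow> ('f::field mat2 \<Rightarrow> 'v \<Rightarrow> 'v) \<Rightarrow>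
     ('f \<Rightarrow> int) \<Rightarrow> int \<Rightarrow> 'f mat2 set \<Rightarrow> bool" where
  "virt_eq_on sc V \<rho> v a S \<longleftrightarrow>
     (if a \<ge> 0 then iso_triv_plus sc V \<rho> (nat a) fsc (ind_sp v) ind_act S
      else iso_triv_plus fsc (ind_sp v) ind_act (nat (- a)) sc V \<rho> S)"

text \<open>Nonzero Whittaker model: the (U,theta)-coinvariants of W are nonzero.\<close>
definition whittaker :: "('r::field \<Rightarrow> 'v::ab_group_add \<Rightarrow> 'v) \<Rightarrow> ('f::field mat2 \<Rightarrow> 'v \<Rightarrow> 'v) \<Rightarrow>
     ('f \<Rightarrow> 'r) \<Rightarrow> 'v set \<Rightarrow> bool" where
  "whittaker sc \<rho> \<psi> W \<longleftrightarrow>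
     rspan sc {\<rho> (1, x, 0, 1) w - sc (\<psi> x) w | x w. w \<in> W} \<noteq> W"

definition irr_subquot :: "('r::field \<Rightarrow> 'v::ab_group_add \<Rightarrow> 'v) \<Rightarrow> ('g \<Rightarrow> 'v \<Rightarrow> 'v) \<Rightarrow> 'g set \<Rightarrow> 'v set \<Rightarrow> ('v set \<times> 'v set) set" where
  "irr_subquot sc \<rho> S W = {(A, B). subsp sc A \<and> subsp sc B \<and> B \<subset> A \<and> A \<subseteq> W \<and>
      invariant \<rho> S A \<and> invariant \<rho> S B \<and>
      (\<forall>C. subsp sc C \<and> invariant \<rho> S C \<and> B \<subseteq> C \<and> C \<subseteq> A \<longrightarrow> C = B \<or> C = A)}"

text \<open>Isomorphism of subquotients A/B and A'/B' as S-representations, via a map f : A \<rightarrow> A'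
  inducing an S-equivariant linear bijection A/B \<rightarrow> A'/B'.\<close>
definition sq_iso :: "('r::field \<Rightarrow> 'v::ab_group_add \<Rightarrow> 'v) \<Rightarrow> ('g \<Rightarrow> 'v \<Rightarrow> 'v) \<Rightarrow> 'g set \<Rightarrow>
     ('v set \<times> 'v set) \<Rightarrow> ('v set \<times> 'v set) \<Rightarrow> bool" where
  "sq_iso sc \<rho> S P P' \<longleftrightarrow> (case P of (A, B) \<Rightarrow> case P' of (A', B') \<Rightarrow> (\<exists>f.
     (\<forall>a\<in>A. f a \<in> A') \<and> (\<forall>a\<in>A. f a \<in> B' \<longleftrightarrow> a \<in> B) \<and> (\<forall>a'\<in>A'. \<exists>a\<in>A. f a - a' \<in> B') \<and>
     (\<forall>x\<in>A. \<forall>y\<in>A. f (x + y) - (f x + f y) \<in> B') \<and> (\<forall>c. \<forall>x\<in>A. f (sc c x) - sc c (f x) \<in> B') \<and>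
     (\<forall>g\<in>S. \<forall>x\<in>A. f (\<rho> g x) - \<rho> g (f x) \<in> B')))"

definition Lset :: "('r::field \<Rightarrow> 'v::ab_group_add \<Rightarrow> 'v) \<Rightarrow> ('g \<Rightarrow> 'v \<Rightarrow> 'v) \<Rightarrow> 'g set \<Rightarrow> 'v set \<Rightarrow> ('v set \<times> 'v set) set set" where
  "Lset sc \<rho> S W = irr_subquot sc \<rho> S W //
     {(P, P'). P \<in> irr_subquot sc \<rho> S W \<and> P' \<in> irr_subquot sc \<rho> S W \<and> sq_iso sc \<rho> S P P'}"

definition occurs_in :: "('r::field \<Rightarrow> 'v::ab_group_add \<Rightarrow> 'v) \<Rightarrow> ('g \<Rightarrow> 'v \<Rightarrow> 'v) \<Rightarrow> 'g set \<Rightarrow>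
     ('v set \<times> 'v set) \<Rightarrow> 'v set \<Rightarrow> bool" where
  "occurs_in sc \<rho> S P W' \<longleftrightarrow> (\<exists>A'. irred_on sc \<rho> S A' \<and> A' \<subseteq> W' \<and> sq_iso sc \<rho> S P (A', {0}))"

end

theory Submission
  imports Defs
begin

text \<open>All dimensions are read off from the induced representation. The \<open>n\<close>-th Iwahori subgroup \<open>J n\<close>
  of \<open>SL2\<close> has \<open>2 * q ^ (n div 2)\<close> orbits on the projective line, and the matrix with rows \<open>(0, 1)\<close>
  and \<open>(pi, 0)\<close> normalises \<open>J n\<close> and maps \<open>\<Pi>+\<close> onto a complement of itself, so that each half has
  \<open>a/2 + q ^ (n div 2)\<close> dimensions of \<open>J n\<close>-fixed vectors.

  Now \<open>J (2 * j) \<subseteq> K'_j \<subseteq> J (2 * j - 1)\<close>, and if one of these inclusions changes the fixed vectors of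
  a half, then some vector in it is transformed under the upper unipotent group at level \<open>i = j\<close> or
  \<open>i = j - 1\<close> by a nontrivial character of \<open>P^i / P^(i+1)\<close>. Fourier analysis on larger and larger
  compact subgroups of \<open>U\<close>, followed by a diagonal conjugation with determinant of valuation \<open>-i\<close>,
  turns it into an eigenvector for \<open>\<psi>\<close> of arbitrarily deep level. Such eigenvectors span at most a
  line, as one sees in the induced representation, and \<open>\<Pi>+\<close> contains them by its Whittaker
  model; so the parity of \<open>i\<close> decides in which half this can happen.

  The same uniqueness shows that disjoint \<open>SL2\<close>-subrepresentations share no Whittaker character,
  hence that the restriction to \<open>SL2\<close> is semisimple and multiplicity free. The group \<open>H\<close> permutes
  the constituents of each half transitively, preserving the dimensions of \<open>K'_j\<close>-fixed vectors.\<close>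

section \<open>Linear algebra on a carrier\<close>

text \<open>Parity enters through \<open>dg t 1\<close>, whose determinant t has valuation -i for a
  change at level i, while H consists of the matrices with determinant of even valuation. For even i
  the deep eigenvector stays in the half it came from; a change of \<Pi>+ at an odd level becomes,
  after one odd translation, a change at an even level in a subspace that meets \<Pi>+ in 0. Since
  \<Pi>+ already holds the deep eigenvectors, \<Pi>- cannot change at even levels nor \<Pi>+ at odd
  ones. So for each j and each half one of the two inclusions preserves the fixed vectors, and which
  one it is decides between q^j and q^(j-1).

  The characteristic of R is only known to differ from p. Every averaging is therefore a finite sum
  over a quotient of q-power order, and the invertible order is carried along as a factor.\<close>

lemma homogeneous_system_nontrivial_solution:
  fixes a :: "'i \<Rightarrow> 'j \<Rightarrow> 'r::field"
  assumes "finite J" "finite I" "card J < card I"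
  shows "\<exists>c. (\<exists>i\<in>I. c i \<noteq> 0) \<and> (\<forall>j\<in>J. (\<Sum>i\<in>I. c i * a i j) = 0)"
  using assms
proof (induction J arbitrary: I a rule: finite_induct)
  case empty
  then obtain i where "i \<in> I" by fastforce
  then show ?case by (intro exI[of _ "\<lambda>_. 1"]) auto
next
  case (insert j J)
  show ?case
  proof (cases "\<forall>i\<in>I. a i j = 0")
    case True
    obtain c where "\<exists>i\<in>I. c i \<noteq> 0" "\<forall>k\<in>J. (\<Sum>i\<in>I. c i * a i k) = 0"
      using insert.IH[of I a] insert.prems insert.hyps by auto
    with True show ?thesis by (intro exI[of _ c]) auto
  next
    case False
    \<comment> \<open>Pivot: equation j is solved for the unknown p, and \<open>b\<close> is the
      system left after eliminating it.\<close>
    then obtain p where p: "p \<in> I" "a p j \<noteq> 0" by auto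
    define b where "b i k = a i k - a i j / a p j * a p k" for i k
    have "card J < card (I - {p})" using insert.prems insert.hyps p by auto
    then obtain c where c: "\<exists>i\<in>I-{p}. c i \<noteq> 0" "\<forall>k\<in>J. (\<Sum>i\<in>I-{p}. c i * b i k) = 0"
      using insert.IH[of "I-{p}" b] insert.prems by auto
    define e where "e = - (\<Sum>i\<in>I-{p}. c i * a i j) / a p j"
    define d where "d = c(p := e)"
    have split: "(\<Sum>i\<in>I. d i * a i k) = e * a p k + (\<Sum>i\<in>I-{p}. c i * a i k)" for k
      using insert.prems p(1) by (subst sum.remove[of I p]) (auto simp: d_def intro!: sum.cong)
    have "(\<Sum>i\<in>I. d i * a i k) = 0" if "k \<in> J" for k
    proof -
      have "0 = (\<Sum>i\<in>I-{p}. c i * a i k - c i * a i j * (a p k / a p j))"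
        using c(2) that by (simp add: b_def algebra_simps)
      also have "\<dots> = (\<Sum>i\<in>I-{p}. c i * a i k) - (\<Sum>i\<in>I-{p}. c i * a i j) * (a p k / a p j)"
        by (simp add: sum_subtractf sum_distrib_right sum_divide_distrib)
      finally show ?thesis unfolding split e_def by (simp add: field_simps)
    qed
    moreover have "(\<Sum>i\<in>I. d i * a i j) = 0" unfolding split e_def using p by simp
    moreover have "\<exists>i\<in>I. d i \<noteq> 0" using c(1) by (auto simp: d_def)
    ultimately show ?thesis by auto
  qed
qed

lemma subspD:
  assumes "subsp sc S"
  shows "0 \<in> S" "x \<in> S \<Longrightarrow> y \<in> S \<Longrightarrow> x + y \<in> S" "x \<in> S \<Longrightarrow> sc c x \<in> S"
  using assms by (auto simp: subsp_def)

lemma subsp_sum: "subsp sc S \<Longrightarrow> (\<And>i. i \<in> I \<Longrightarrow> f i \<in> S) \<Longrightarrow> sum f I \<in> S"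
  by (induction I rule: infinite_finite_induct) (auto simp: subsp_def)

lemma subsp_sum_list: "subsp sc S \<Longrightarrow> set xs \<subseteq> S \<Longrightarrow> sum_list xs \<in> S"
  by (induction xs) (auto simp: subsp_def)

definition ssum :: "'v::ab_group_add set \<Rightarrow> 'v set \<Rightarrow> 'v set" where
  "ssum A B = {x + y | x y. x \<in> A \<and> y \<in> B}"

lemma ssumI: "x \<in> A \<Longrightarrow> y \<in> B \<Longrightarrow> x + y \<in> ssum A B"
  by (auto simp: ssum_def)

lemma ssumE: assumes "z \<in> ssum A B" obtains x y where "x \<in> A" "y \<in> B" "z = x + y"
  using assms by (auto simp: ssum_def)

definition spanned :: "('r::field \<Rightarrow> 'v::ab_group_add \<Rightarrow> 'v) \<Rightarrow> nat \<Rightarrow> (nat \<Rightarrow> 'v) \<Rightarrow> 'v set" where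
  "spanned sc n x = {\<Sum>i<n. sc (c i) (x i) | c. True}"

section \<open>Dimension through independent families\<close>

locale vs =
  fixes sc :: "'r::field \<Rightarrow> 'v::ab_group_add \<Rightarrow> 'v" and V :: "'v set"
  assumes vspace: "vspace sc V"
begin

abbreviation sub :: "'v set \<Rightarrow> bool" where "sub S \<equiv> subsp sc S \<and> S \<subseteq> V"

lemma subV: "sub V" using vspace by (auto simp: vspace_def)

lemma
  shows V0 [simp]: "0 \<in> V" and V_add [simp]: "x \<in> V \<Longrightarrow> y \<in> V \<Longrightarrow> x + y \<in> V"
    and V_sc [simp]: "x \<in> V \<Longrightarrow> sc c x \<in> V"
  using subV by (auto simp: subsp_def)

lemma sc_add: "x \<in> V \<Longrightarrow> y \<in> V \<Longrightarrow> sc a (x + y) = sc a x + sc a y"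
  and add_sc: "x \<in> V \<Longrightarrow> sc (a + b) x = sc a x + sc b x"
  and sc_sc: "x \<in> V \<Longrightarrow> sc a (sc b x) = sc (a * b) x"
  and sc_one [simp]: "x \<in> V \<Longrightarrow> sc 1 x = x"
  using vspace by (auto simp: vspace_def)

lemma sc_0 [simp]: "x \<in> V \<Longrightarrow> sc 0 x = 0"
  using add_sc[of x 0 0] by simp

lemma sc_0_right [simp]: "sc c 0 = 0"
  using sc_add[of 0 0 c] by simp

lemma sc_minus: "x \<in> V \<Longrightarrow> sc (- c) x = - sc c x"
  using add_sc[of x c "-c"] by (simp add: add_eq_0_iff)

lemma sub_minus: "sub S \<Longrightarrow> x \<in> S \<Longrightarrow> - x \<in> S"
  using sc_minus[of x 1] by (metis sc_one subsetD subspD(3))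

lemma sub_diff: "sub S \<Longrightarrow> x \<in> S \<Longrightarrow> y \<in> S \<Longrightarrow> x - y \<in> S"
  by (metis sub_minus subspD(2) diff_conv_add_uminus)

lemma V_minus [simp]: "x \<in> V \<Longrightarrow> - x \<in> V" using sub_minus[OF subV] .
lemma V_diff [simp]: "x \<in> V \<Longrightarrow> y \<in> V \<Longrightarrow> x - y \<in> V" using sub_diff[OF subV] .

lemma sc_minus_right: "x \<in> V \<Longrightarrow> sc c (- x) = - sc c x"
  using sc_add[of x "-x" c] by (simp add: add_eq_0_iff)

lemma sc_diff: "x \<in> V \<Longrightarrow> y \<in> V \<Longrightarrow> sc c (x - y) = sc c x - sc c y"
  using sc_add[of x "-y" c] by (simp add: sc_minus_right)

lemma diff_sc: "x \<in> V \<Longrightarrow> sc (a - b) x = sc a x - sc b x"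
  using add_sc[of x a "-b"] by (simp add: sc_minus)

lemma V_sum [simp]: "(\<And>i. i \<in> I \<Longrightarrow> f i \<in> V) \<Longrightarrow> sum f I \<in> V"
  using subsp_sum[of sc V] subV by auto

lemma sc_sum: "(\<And>i. i \<in> I \<Longrightarrow> f i \<in> V) \<Longrightarrow> sc c (sum f I) = (\<Sum>i\<in>I. sc c (f i))"
  by (induction I rule: infinite_finite_induct) (auto simp: sc_add)

lemma sum_sc: "x \<in> V \<Longrightarrow> sc (sum f I) x = (\<Sum>i\<in>I. sc (f i) x)"
  by (induction I rule: infinite_finite_induct) (auto simp: add_sc)

lemma sc_cancel: "x \<in> V \<Longrightarrow> c \<noteq> 0 \<Longrightarrow> sc c x = 0 \<longleftrightarrow> x = 0"
  by (metis sc_0_right sc_one sc_sc left_inverse)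

lemma sub_scD: "sub S \<Longrightarrow> x \<in> V \<Longrightarrow> c \<noteq> 0 \<Longrightarrow> sc c x \<in> S \<Longrightarrow> x \<in> S"
  by (metis sc_one sc_sc left_inverse subspD(3))

lemma sub_zero: "sub {0}" by (auto simp: subsp_def)

lemma sub_ssum: assumes "sub A" "sub B" shows "sub (ssum A B)"
proof -
  have AB: "\<And>x. x \<in> A \<Longrightarrow> x \<in> V" "\<And>x. x \<in> B \<Longrightarrow> x \<in> V" using assms by auto
  note D = subspD[OF conjunct1[OF assms(1)]] subspD[OF conjunct1[OF assms(2)]]
  have "0 \<in> ssum A B" using ssumI[of 0 A 0 B] D by simp
  moreover have "x + y \<in> ssum A B" if xy: "x \<in> ssum A B" "y \<in> ssum A B" for x y
  proof -
    obtain a b where x: "a \<in> A" "b \<in> B" "x = a + b" using xy(1) by (rule ssumE)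
    obtain a' b' where y: "a' \<in> A" "b' \<in> B" "y = a' + b'" using xy(2) by (rule ssumE)
    have "x + y = (a + a') + (b + b')" by (simp add: x y algebra_simps)
    moreover have "a + a' \<in> A" "b + b' \<in> B" using x y D by auto
    ultimately show ?thesis by (simp add: ssumI)
  qed
  moreover have "sc c x \<in> ssum A B" if "x \<in> ssum A B" for x c
    using that by (auto elim!: ssumE simp: sc_add AB intro!: ssumI D)
  moreover have "ssum A B \<subseteq> V" using AB by (auto elim!: ssumE)
  ultimately show ?thesis by (auto simp: subsp_def)
qed

lemma sub_Int: "sub A \<Longrightarrow> sub B \<Longrightarrow> sub (A \<inter> B)"
  by (auto simp: subsp_def)

lemma indep_mod_mono:
  assumes "indep_mod sc B n x" "m \<le> n" "\<And>i. i < n \<Longrightarrow> x i \<in> V"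
  shows "indep_mod sc B m x"
  unfolding indep_mod_def
proof (intro allI impI)
  fix c i assume c: "(\<Sum>i<m. sc (c i) (x i)) \<in> B" and i: "i < m"
  define d where "d i = (if i < m then c i else 0)" for i
  have "(\<Sum>i<n. sc (d i) (x i)) = (\<Sum>i<m. sc (c i) (x i))"
    using assms by (intro sum.mono_neutral_cong_right) (auto simp: d_def)
  with c assms(1) have "\<forall>i<n. d i = 0" unfolding indep_mod_def by auto
  with i assms(2) show "c i = 0" unfolding d_def by (metis less_le_trans)
qed

lemma has_qdim_le:
  assumes "has_qdim sc B X n" "X \<subseteq> V" "\<forall>i<m. x i \<in> X" "indep_mod sc B m x"
  shows "m \<le> n"
proof (rule ccontr)
  assume "\<not> m \<le> n"
  then have "indep_mod sc B (Suc n) x" "\<forall>i<Suc n. x i \<in> X"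
    using indep_mod_mono[OF assms(4), of "Suc n"] assms by auto
  with assms(1) show False unfolding has_qdim_def by blast
qed

lemma has_qdim_unique:
  assumes "has_qdim sc B X n" "has_qdim sc B X m" "X \<subseteq> V" shows "n = m"
proof (rule antisym)
  show "n \<le> m" using assms(1) has_qdim_le[OF assms(2,3)] unfolding has_qdim_def[of sc B X n] by blast
  show "m \<le> n" using assms(2) has_qdim_le[OF assms(1,3)] unfolding has_qdim_def[of sc B X m] by blast
qed

lemma has_dim_unique: "has_dim sc X n \<Longrightarrow> has_dim sc X m \<Longrightarrow> X \<subseteq> V \<Longrightarrow> n = m"
  unfolding has_dim_def using has_qdim_unique by blast

text \<open>An independent family of maximal length spans: adjoining y creates a relation, and
  independence of the old family forces the coefficient of y in it to be nonzero, so the relation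
  can be solved for y.\<close>

lemma has_dim_obtain_basis:
  assumes "has_dim sc X n" "sub X"
  obtains x where "\<forall>i<n. x i \<in> X" "indep_mod sc {0} n x" "X = spanned sc n x"
proof -
  obtain x where x: "\<forall>i<n. x i \<in> X" "indep_mod sc {0} n x"
    using assms(1) unfolding has_dim_def has_qdim_def by blast
  have "y \<in> spanned sc n x" if y: "y \<in> X" for y
  proof -
    define z where "z = x(n := y)"
    have zX: "\<forall>i<Suc n. z i \<in> X" using x y by (auto simp: z_def less_Suc_eq)
    then have "\<not> indep_mod sc {0} (Suc n) z"
      using assms(1) unfolding has_dim_def has_qdim_def by blast
    then obtain c k where c: "(\<Sum>i<Suc n. sc (c i) (z i)) = 0" "k < Suc n" "c k \<noteq> 0"
      unfolding indep_mod_def by auto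
    have *: "(\<Sum>i<Suc n. sc (c i) (z i)) = (\<Sum>i<n. sc (c i) (x i)) + sc (c n) y"
      by (simp add: z_def)
    have xV: "\<And>i. i < n \<Longrightarrow> x i \<in> V" using x assms by auto
    have yV: "y \<in> V" using y assms by auto
    have cn: "c n \<noteq> 0"
    proof
      assume "c n = 0"
      then have "(\<Sum>i<n. sc (c i) (x i)) = 0" using c(1) * yV by simp
      then have "\<forall>i<n. c i = 0" using x(2) unfolding indep_mod_def by auto
      then show False using \<open>c n = 0\<close> c(2,3) by (auto simp: less_Suc_eq)
    qed
    have "sc (c n) y = - (\<Sum>i<n. sc (c i) (x i))" using c(1) * by (simp add: add_eq_0_iff)
    moreover have "(\<Sum>i<n. sc (c i) (x i)) \<in> V" using xV by (intro V_sum V_sc) simp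
    ultimately have "sc (- inverse (c n)) (\<Sum>i<n. sc (c i) (x i)) = sc (inverse (c n)) (sc (c n) y)"
      by (simp only: sc_minus sc_minus_right)
    also have "\<dots> = y" using cn yV by (simp add: sc_sc)
    finally have "y = (\<Sum>i<n. sc (- inverse (c n)) (sc (c i) (x i)))"
      using xV by (subst (asm) sc_sum) auto
    also have "\<dots> = (\<Sum>i<n. sc (- inverse (c n) * c i) (x i))"
      using xV by (intro sum.cong refl sc_sc) simp
    finally have "y = (\<Sum>i<n. sc (- inverse (c n) * c i) (x i))" .
    then show ?thesis unfolding spanned_def by (intro CollectI exI conjI TrueI)
  qed
  moreover have "spanned sc n x \<subseteq> X"
  proof
    fix y assume "y \<in> spanned sc n x"
    then obtain c where "y = (\<Sum>i<n. sc (c i) (x i))" by (auto simp: spanned_def)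
    moreover have "subsp sc X" using assms(2) by simp
    ultimately show "y \<in> X" using x(1) subsp_sum[of sc X "{..<n}"] subspD(3)[of sc X] by simp
  qed
  ultimately show ?thesis using that x by blast
qed

text \<open>The exchange bound: expressing n + 1 vectors through n spanning ones gives n linear
  equations in n + 1 unknowns, whose nontrivial solution is a dependence.\<close>

lemma has_dim_if_basis:
  assumes x: "\<forall>i<n. x i \<in> V" "indep_mod sc {0} n x"
  shows "has_dim sc (spanned sc n x) n"
  unfolding has_dim_def has_qdim_def
proof (intro conjI notI)
  have "x i \<in> spanned sc n x" if "i < n" for i
  proof -
    have "(\<Sum>k<n. sc (if k = i then 1 else 0) (x k)) = (\<Sum>k<n. if k = i then x k else 0)"
      using x by (intro sum.cong) auto
    also have "\<dots> = x i" using that by simp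
    finally have "x i = (\<Sum>k<n. sc (if k = i then 1 else 0) (x k))" by simp
    then show ?thesis unfolding spanned_def by (intro CollectI exI conjI TrueI)
  qed
  with x show "\<exists>x'. (\<forall>i<n. x' i \<in> spanned sc n x) \<and> indep_mod sc {0} n x'" by blast
next
  assume "\<exists>y. (\<forall>i<Suc n. y i \<in> spanned sc n x) \<and> indep_mod sc {0} (Suc n) y"
  then obtain y where y: "\<forall>i<Suc n. y i \<in> spanned sc n x" "indep_mod sc {0} (Suc n) y" by blast
  have "\<forall>i. \<exists>c. i < Suc n \<longrightarrow> y i = (\<Sum>k<n. sc (c k) (x k))"
    using y(1) unfolding spanned_def by auto
  then obtain a where a: "\<And>i. i < Suc n \<Longrightarrow> y i = (\<Sum>k<n. sc (a i k) (x k))" by metis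
  obtain c where c: "\<exists>i\<in>{..<Suc n}. c i \<noteq> 0"
      "\<forall>k\<in>{..<n}. (\<Sum>i\<in>{..<Suc n}. c i * a i k) = 0"
    using homogeneous_system_nontrivial_solution[of "{..<n}" "{..<Suc n}" a] by auto
  have "(\<Sum>i<Suc n. sc (c i) (y i)) = (\<Sum>i<Suc n. \<Sum>k<n. sc (c i * a i k) (x k))"
  proof (intro sum.cong refl)
    fix i assume "i \<in> {..<Suc n}"
    then have "sc (c i) (y i) = sc (c i) (\<Sum>k<n. sc (a i k) (x k))" by (simp add: a)
    also have "\<dots> = (\<Sum>k<n. sc (c i) (sc (a i k) (x k)))" using x(1) by (intro sc_sum) simp
    also have "\<dots> = (\<Sum>k<n. sc (c i * a i k) (x k))" using x(1) by (intro sum.cong refl sc_sc) simp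
    finally show "sc (c i) (y i) = (\<Sum>k<n. sc (c i * a i k) (x k))" .
  qed
  also have "\<dots> = (\<Sum>k<n. sc (\<Sum>i<Suc n. c i * a i k) (x k))"
    using x(1) by (subst sum.swap) (intro sum.cong refl, simp only: sum_sc lessThan_iff)
  also have "\<dots> = 0" using c(2) x(1) by (intro sum.neutral) (auto simp del: sum.lessThan_Suc)
  finally have "\<forall>i<Suc n. c i = 0" using y(2) unfolding indep_mod_def by (simp del: sum.lessThan_Suc)
  with c(1) show False by auto
qed

lemma has_dim_ssum:
  assumes "has_dim sc X n" "has_dim sc Y m" "sub X" "sub Y" "X \<inter> Y = {0}"
  shows "has_dim sc (ssum X Y) (n + m)"
proof -
  obtain x where x: "\<forall>i<n. x i \<in> X" "indep_mod sc {0} n x" "X = spanned sc n x"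
    using has_dim_obtain_basis assms(1,3) by blast
  obtain y where y: "\<forall>i<m. y i \<in> Y" "indep_mod sc {0} m y" "Y = spanned sc m y"
    using has_dim_obtain_basis assms(2,4) by blast
  define z where "z i = (if i < n then x i else y (i - n))" for i
  have zV: "\<forall>i<n+m. z i \<in> V" using x(1) y(1) assms by (auto simp: z_def)
  have split: "(\<Sum>i<n+m. sc (c i) (z i)) = (\<Sum>i<n. sc (c i) (x i)) + (\<Sum>i<m. sc (c (n + i)) (y i))" for c
  proof -
    have "(\<Sum>i<n+m. sc (c i) (z i)) = (\<Sum>i<n. sc (c i) (z i)) + (\<Sum>i\<in>{n..<n+m}. sc (c i) (z i))"
      by (subst sum.union_disjoint[symmetric]) (auto intro!: sum.cong)
    also have "(\<Sum>i\<in>{n..<n+m}. sc (c i) (z i)) = (\<Sum>i<m. sc (c (n + i)) (z (n + i)))"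
      by (rule sum.reindex_bij_witness[of _ "\<lambda>i. n + i" "\<lambda>i. i - n"]) auto
    finally show ?thesis by (simp add: z_def)
  qed
  have "indep_mod sc {0} (n + m) z"
    unfolding indep_mod_def
  proof (intro allI impI)
    fix c i assume "(\<Sum>i<n+m. sc (c i) (z i)) \<in> {0}" and i: "i < n + m"
    then have s: "(\<Sum>i<n. sc (c i) (x i)) + (\<Sum>i<m. sc (c (n + i)) (y i)) = 0" using split by auto
    have X: "(\<Sum>i<n. sc (c i) (x i)) \<in> X" using x(3) unfolding spanned_def by blast
    have Y: "(\<Sum>i<m. sc (c (n + i)) (y i)) \<in> Y"
      unfolding y(3) spanned_def by (intro CollectI exI[of _ "\<lambda>i. c (n + i)"] conjI refl TrueI)
    have "(\<Sum>i<n. sc (c i) (x i)) = - (\<Sum>i<m. sc (c (n + i)) (y i))"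
      using s by (simp add: eq_neg_iff_add_eq_0)
    then have "(\<Sum>i<n. sc (c i) (x i)) \<in> X \<inter> Y" using X sub_minus[OF assms(4) Y] by auto
    then have 0: "(\<Sum>i<n. sc (c i) (x i)) = 0" "(\<Sum>i<m. sc (c (n + i)) (y i)) = 0"
      using s assms(5) by auto
    have "\<forall>i<n. c i = 0" using 0 x(2) by (auto simp: indep_mod_def)
    moreover have "\<forall>i<m. c (n + i) = 0" using 0 y(2) unfolding indep_mod_def
      by (elim allE[of _ "\<lambda>i. c (n + i)"]) auto
    ultimately show "c i = 0" using i by (metis add_diff_inverse_nat nat_add_left_cancel_less)
  qed
  from has_dim_if_basis[OF zV this] have "has_dim sc (spanned sc (n + m) z) (n + m)" .
  moreover have "spanned sc (n + m) z = ssum X Y"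
  proof (intro equalityI subsetI)
    fix w assume "w \<in> spanned sc (n + m) z"
    then obtain c where w: "w = (\<Sum>i<n. sc (c i) (x i)) + (\<Sum>i<m. sc (c (n + i)) (y i))"
      using split unfolding spanned_def by auto
    show "w \<in> ssum X Y" unfolding w x(3) y(3) spanned_def
      by (intro ssumI CollectI exI[of _ c] exI[of _ "\<lambda>i. c (n + i)"] conjI refl TrueI)
  next
    fix w assume "w \<in> ssum X Y"
    then obtain c d where w: "w = (\<Sum>i<n. sc (c i) (x i)) + (\<Sum>i<m. sc (d i) (y i))"
      unfolding x(3) y(3) spanned_def by (auto elim!: ssumE)
    define e where "e i = (if i < n then c i else d (i - n))" for i
    have "w = (\<Sum>i<n+m. sc (e i) (z i))" unfolding split w by (simp add: e_def)
    then show "w \<in> spanned sc (n + m) z" unfolding spanned_def by blast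
  qed
  ultimately show ?thesis by simp
qed

lemma has_dim_subspace:
  assumes "has_dim sc Y n" "sub Y" "X \<subseteq> Y"
  obtains k where "k \<le> n" "has_dim sc X k"
proof -
  define Q where "Q k \<longleftrightarrow> (\<exists>x. (\<forall>i<k. x i \<in> X) \<and> indep_mod sc {0} k x)" for k
  have "Q 0" by (auto simp: Q_def indep_mod_def)
  have le: "k \<le> n" if "Q k" for k
    using that has_qdim_le[of "{0}" Y n] assms unfolding Q_def has_dim_def by blast
  define k where "k = Max {k. Q k}"
  have fin: "finite {k. Q k}" using le by (meson finite_nat_set_iff_bounded_le mem_Collect_eq)
  have "Q k" using Max_in[OF fin] \<open>Q 0\<close> unfolding k_def by auto
  moreover have "\<not> Q (Suc k)" using Max_ge[OF fin, of "Suc k"] unfolding k_def by auto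
  ultimately have "has_dim sc X k" unfolding has_dim_def has_qdim_def Q_def by blast
  then show ?thesis using that le[OF \<open>Q k\<close>] by blast
qed

lemma has_dim_subspace_eq:
  assumes "has_dim sc Y n" "has_dim sc X n" "sub Y" "sub X" "X \<subseteq> Y"
  shows "X = Y"
proof
  obtain x where x: "\<forall>i<n. x i \<in> X" "indep_mod sc {0} n x" "X = spanned sc n x"
    using has_dim_obtain_basis assms(2,4) by blast
  show "Y \<subseteq> X"
  proof
    fix y assume y: "y \<in> Y"
    show "y \<in> X"
    proof (rule ccontr)
      assume n: "y \<notin> X"
      define z where "z = x(n := y)"
      have zX: "\<forall>i<Suc n. z i \<in> Y" using x y assms by (auto simp: z_def less_Suc_eq)
      have "indep_mod sc {0} (Suc n) z"
        unfolding indep_mod_def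
      proof (intro allI impI)
        fix c i assume "(\<Sum>i<Suc n. sc (c i) (z i)) \<in> {0}" and i: "i < Suc n"
        then have *: "(\<Sum>i<n. sc (c i) (x i)) + sc (c n) y = 0" by (simp add: z_def)
        have X: "(\<Sum>i<n. sc (c i) (x i)) \<in> X" using x(3) unfolding spanned_def by blast
        have yV: "y \<in> V" using y assms by auto
        have "sc (c n) y = - (\<Sum>i<n. sc (c i) (x i))" using * by (simp add: add_eq_0_iff)
        then have "sc (c n) y \<in> X" using sub_minus[OF assms(4) X] by simp
        then have "c n = 0" using sub_scD[OF assms(4) yV] n by blast
        then have "(\<Sum>i<n. sc (c i) (x i)) = 0" using * yV by simp
        then show "c i = 0" using x(2) \<open>c n = 0\<close> i unfolding indep_mod_def
          by (auto simp: less_Suc_eq)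
      qed
      then show False using assms(1) zX unfolding has_dim_def has_qdim_def by blast
    qed
  qed
qed (use assms in auto)

end

section \<open>Transport of dimension along linear maps\<close>

text \<open>Families independent modulo the kernel \<open>B\<close> go to independent families, and
  independent families lift by choosing preimages. This replaces dimensions in a subquotient by
  dimensions of an honest subspace.\<close>

lemma has_qdim_transfer:
  assumes "vs sc1 V1" "subsp sc1 X" "X \<subseteq> V1"
    and add: "\<And>x y. x \<in> X \<Longrightarrow> y \<in> X \<Longrightarrow> f (x + y) = f x + f y"
    and sc: "\<And>x c. x \<in> X \<Longrightarrow> f (sc1 c x) = sc2 c (f x)"
    and ker: "\<And>x. x \<in> X \<Longrightarrow> f x = 0 \<longleftrightarrow> x \<in> B"
    and onto: "f ` X = Y"
  shows "has_qdim sc1 B X n \<longleftrightarrow> has_dim sc2 Y n"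
proof -
  interpret vs sc1 V1 by fact
  have f0: "f 0 = 0" using add[of 0 0] subspD(1)[OF assms(2)] by simp
  have fsum: "f (\<Sum>i\<in>I. g i) = (\<Sum>i\<in>I. f (g i))" if "\<And>i. i \<in> I \<Longrightarrow> g i \<in> X" for g and I :: "nat set"
    using that
  proof (induction I rule: infinite_finite_induct)
    case (insert i I)
    have "sum g I \<in> X" by (rule subsp_sum[OF assms(2)]) (simp add: insert.prems)
    then show ?case using insert by (simp add: add)
  qed (use f0 in auto)
  have lin: "indep_mod sc1 B k x \<longleftrightarrow> indep_mod sc2 {0} k (\<lambda>i. f (x i))" if "\<forall>i<k. x i \<in> X" for k x
  proof -
    have "(\<Sum>i<k. sc1 (c i) (x i)) \<in> B \<longleftrightarrow> (\<Sum>i<k. sc2 (c i) (f (x i))) = 0" for c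
    proof -
      have "f (\<Sum>i<k. sc1 (c i) (x i)) = (\<Sum>i<k. sc2 (c i) (f (x i)))"
        using that subspD(3)[OF assms(2)] by (subst fsum) (auto simp: sc)
      moreover have "(\<Sum>i<k. sc1 (c i) (x i)) \<in> X"
        using that by (intro subsp_sum[OF assms(2)] subspD(3)[OF assms(2)]) auto
      ultimately show ?thesis using ker by metis
    qed
    then show ?thesis unfolding indep_mod_def by simp
  qed
  have ex: "(\<exists>x. (\<forall>i<k. x i \<in> X) \<and> indep_mod sc1 B k x) \<longleftrightarrow> (\<exists>y. (\<forall>i<k. y i \<in> Y) \<and> indep_mod sc2 {0} k y)"
    (is "?l \<longleftrightarrow> ?r") for k
  proof
    assume ?l then show ?r using lin onto by (metis imageI)
  next
    assume ?r
    then obtain y where y: "\<forall>i<k. y i \<in> Y" "indep_mod sc2 {0} k y" by blast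
    have "\<exists>x. i < k \<longrightarrow> x \<in> X \<and> f x = y i" for i using y(1) onto by (metis imageE)
    then obtain x where x: "\<And>i. i < k \<Longrightarrow> x i \<in> X \<and> f (x i) = y i" by metis
    have "indep_mod sc2 {0} k (\<lambda>i. f (x i))" using y(2) x unfolding indep_mod_def by auto
    then show ?l using lin x by blast
  qed
  show ?thesis unfolding has_dim_def has_qdim_def ex by simp
qed

lemma has_dim_transfer:
  assumes "vs sc1 V1" "subsp sc1 X" "X \<subseteq> V1"
    and "\<And>x y. x \<in> X \<Longrightarrow> y \<in> X \<Longrightarrow> f (x + y) = f x + f y"
    and "\<And>x c. x \<in> X \<Longrightarrow> f (sc1 c x) = sc2 c (f x)"
    and bij: "bij_betw f X Y"
  shows "has_dim sc1 X n \<longleftrightarrow> has_dim sc2 Y n"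
proof -
  have "0 \<in> X" by (rule subspD(1)[OF assms(2)])
  moreover have "f 0 = 0" using assms(4)[of 0 0] \<open>0 \<in> X\<close> by simp
  ultimately have "f x = 0 \<longleftrightarrow> x \<in> {0}" if "x \<in> X" for x
    using bij that unfolding bij_betw_def inj_on_def by auto
  then show ?thesis unfolding has_dim_def[of sc1] using bij
    by (intro has_qdim_transfer[OF assms(1-5)]) (auto simp: bij_betw_def)
qed

section \<open>Arithmetic of the valued field\<close>

locale local_field =
  fixes v :: "'f::field \<Rightarrow> int" and q :: nat
  assumes nonarch: "nonarch_local_field v q"
begin

abbreviation P :: "int \<Rightarrow> 'f set" where "P \<equiv> vpow v"

lemma v_mult: "x \<noteq> 0 \<Longrightarrow> y \<noteq> 0 \<Longrightarrow> v (x * y) = v x + v y"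
  using nonarch by (auto simp: nonarch_local_field_def)

lemma v_one [simp]: "v 1 = 0"
  using v_mult[of 1 1] by simp

lemma v_minus_one: "v (-1) = 0"
  using v_mult[of "-1" "-1"] by simp

lemma v_minus [simp]: "v (- x) = v x"
proof (cases "x = 0")
  case False
  then show ?thesis using v_mult[of "-1" x] v_minus_one by simp
qed simp

lemma v_inverse: "x \<noteq> 0 \<Longrightarrow> v (inverse x) = - v x"
  using v_mult[of x "inverse x"] by simp

lemma v_divide: "x \<noteq> 0 \<Longrightarrow> y \<noteq> 0 \<Longrightarrow> v (x / y) = v x - v y"
  using v_mult[of x "inverse y"] v_inverse[of y] by (simp add: divide_inverse)

lemma P0 [simp]: "0 \<in> P n" by (simp add: vpow_def)

lemma P_add: "x \<in> P n \<Longrightarrow> y \<in> P n \<Longrightarrow> x + y \<in> P n"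
proof (cases "x = 0 \<or> y = 0 \<or> x + y = 0")
  case False
  assume "x \<in> P n" "y \<in> P n"
  moreover have "v (x + y) \<ge> min (v x) (v y)"
    using nonarch False by (auto simp: nonarch_local_field_def)
  ultimately show ?thesis using False by (auto simp: vpow_def)
qed (auto simp: vpow_def)

lemma P_minus_iff [simp]: "- x \<in> P n \<longleftrightarrow> x \<in> P n" by (auto simp: vpow_def)

lemma P_diff: "x \<in> P n \<Longrightarrow> y \<in> P n \<Longrightarrow> x - y \<in> P n"
  using P_add[of x n "-y"] by simp

lemma P_diff_commute: "x - y \<in> P n \<Longrightarrow> y - x \<in> P n"
  using P_minus_iff[of "x - y"] by simp

lemma P_mono: "x \<in> P n \<Longrightarrow> m \<le> n \<Longrightarrow> x \<in> P m" by (auto simp: vpow_def)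

lemma P_mult: "x \<in> P n \<Longrightarrow> y \<in> P m \<Longrightarrow> x * y \<in> P (n + m)"
  by (cases "x = 0"; cases "y = 0") (auto simp: vpow_def v_mult)

lemma P_mult_le: "x \<in> P n \<Longrightarrow> y \<in> P m \<Longrightarrow> k \<le> n + m \<Longrightarrow> x * y \<in> P k"
  using P_mult P_mono by blast

lemma P_v: "x \<noteq> 0 \<Longrightarrow> x \<in> P n \<longleftrightarrow> n \<le> v x" by (simp add: vpow_def)

lemma P_mult_iff: "t \<noteq> 0 \<Longrightarrow> t * x \<in> P n \<longleftrightarrow> x \<in> P (n - v t)"
  by (cases "x = 0") (auto simp: vpow_def v_mult)

lemma P_divide_iff: "t \<noteq> 0 \<Longrightarrow> x / t \<in> P n \<longleftrightarrow> x \<in> P (n + v t)"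
  by (cases "x = 0") (auto simp: vpow_def v_divide)

lemma one_unit:
  assumes "x - 1 \<in> P n" "n \<ge> 1"
  shows "x \<noteq> 0" "v x = 0" "x \<in> P 0"
proof -
  have x1: "x - 1 \<in> P 1" using assms P_mono by blast
  show x0: "x \<noteq> 0"
  proof
    assume "x = 0"
    then show False using x1 P_minus_iff[of 1 1] by (simp add: vpow_def)
  qed
  have "1 \<in> P 0" by (simp add: vpow_def)
  then show xP: "x \<in> P 0" using P_add[of "x - 1" 0 1] P_mono[OF x1, of 0] by simp
  have "\<not> x \<in> P 1"
  proof
    assume "x \<in> P 1"
    then have "1 \<in> P 1" using P_diff[OF _ x1, of x] by simp
    then show False by (simp add: vpow_def)
  qed
  then show "v x = 0" using x0 xP by (simp add: vpow_def)
qed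

lemma one_unit_mult:
  assumes "x - 1 \<in> P n" "y - 1 \<in> P n" "n \<ge> 0" shows "x * y - 1 \<in> P n"
proof -
  have e: "x * y - 1 = (x - 1) * (y - 1) + ((x - 1) + (y - 1))" by (simp add: algebra_simps)
  show ?thesis unfolding e using assms by (intro P_add P_mult_le[of _ n _ n]) auto
qed

lemma one_unit_inverse:
  assumes "x - 1 \<in> P n" "n \<ge> 1" shows "inverse x - 1 \<in> P n"
proof -
  note u = one_unit[OF assms]
  have "inverse x - 1 = - (x - 1) / x" using u by (simp add: field_simps)
  then show ?thesis using u assms P_divide_iff[of x "- (x - 1)" n] by (simp del: minus_diff_eq)
qed

lemma one_unit_divide:
  assumes "x - 1 \<in> P n" "y - 1 \<in> P n" "n \<ge> 1" shows "x / y - 1 \<in> P n"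
  using one_unit_mult[OF assms(1) one_unit_inverse[OF assms(2,3)]] assms(3) by (simp add: divide_inverse)

section \<open>Representatives modulo powers of the maximal ideal\<close>

definition pw :: "int \<Rightarrow> 'f" where "pw n = (SOME x. x \<noteq> 0 \<and> v x = n)"

lemma pw [simp]: "pw n \<noteq> 0" "v (pw n) = n"
proof -
  have "\<exists>x. x \<noteq> 0 \<and> v x = n" using nonarch by (auto simp: nonarch_local_field_def)
  from someI_ex[OF this] show "pw n \<noteq> 0" "v (pw n) = n" unfolding pw_def by auto
qed

lemma pw_P [simp]: "pw n \<in> P n" by (simp add: P_v)

definition reps :: "int \<Rightarrow> int \<Rightarrow> 'f set \<Rightarrow> bool" where
  "reps n m R \<longleftrightarrow> finite R \<and> R \<subseteq> P n \<and> (\<forall>x\<in>P n. \<exists>!r. r \<in> R \<and> x - r \<in> P m)"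

lemma reps_residue: "\<exists>S. reps 0 1 S \<and> card S = q"
proof -
  define E where "E = {(x, y). x \<in> P 0 \<and> y \<in> P 0 \<and> x - y \<in> P 1}"
  have fin: "finite (P 0 // E)" and card: "card (P 0 // E) = q"
    using nonarch by (auto simp: nonarch_local_field_def E_def)
  have E: "equiv (P 0) E"
  proof (rule equivI)
    show "sym E" by (auto simp: E_def sym_def intro: P_diff_commute)
    have "x - z \<in> P 1" if "x - y \<in> P 1" "y - z \<in> P 1" for x y z using P_add[OF that] by simp
    then show "trans E" by (auto simp: E_def trans_def)
  qed (auto simp: E_def refl_on_def)
  define f where "f C = (SOME x. x \<in> C)" for C :: "'f set"
  have f: "f C \<in> C" if "C \<in> P 0 // E" for C
    using in_quotient_imp_non_empty[OF E that] unfolding f_def by (simp add: some_in_eq)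
  have fP: "f C \<in> P 0" if "C \<in> P 0 // E" for C
    using f[OF that] in_quotient_imp_subset[OF E that] by auto
  have inj: "inj_on f (P 0 // E)"
    using f quotient_disj[OF E] unfolding inj_on_def by (metis disjoint_iff)
  have "reps 0 1 (f ` (P 0 // E))" unfolding reps_def
  proof (intro conjI ballI)
    fix x assume x: "x \<in> P 0"
    let ?C = "E `` {x}"
    have C: "?C \<in> P 0 // E" using x by (rule quotientI)
    show "\<exists>!r. r \<in> f ` (P 0 // E) \<and> x - r \<in> P 1"
    proof (rule ex1I[of _ "f ?C"])
      show "f ?C \<in> f ` (P 0 // E) \<and> x - f ?C \<in> P 1" using C f[OF C] by (auto simp: E_def)
      fix r assume r: "r \<in> f ` (P 0 // E) \<and> x - r \<in> P 1"
      then obtain D where D: "D \<in> P 0 // E" "r = f D" by auto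
      have "r \<in> ?C" using r D fP[OF D(1)] x by (auto simp: E_def)
      then have "D = ?C" using quotient_disj[OF E D(1) C] f[OF D(1)] D by auto
      then show "r = f ?C" using D by simp
    qed
  qed (use fin fP in auto)
  moreover have "card (f ` (P 0 // E)) = q" using card card_image[OF inj] by simp
  ultimately show ?thesis by blast
qed

text \<open>Digit expansion: a representative modulo P^(h+1) is one modulo P^h plus
  \<open>pw h\<close> times a residue digit, so every step multiplies the number by
  \<open>q\<close>.\<close>

lemma reps_exist: "\<exists>R. reps n (n + int k) R \<and> card R = q ^ k"
proof (induction k)
  case 0
  have "reps n n {0}" by (auto simp: reps_def)
  then show ?case by (intro exI[of _ "{0}"]) auto
next
  case (Suc k)
  then obtain R where R: "reps n (n + int k) R" "card R = q ^ k" by blast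
  obtain S where S: "reps 0 1 S" "card S = q" using reps_residue by blast
  define h where "h = n + int k"
  define g where "g = (\<lambda>(r, s). r + pw h * s)"
  have gP: "pw h * s \<in> P h" if "s \<in> P 0" for s using P_mult[OF pw_P that, of h] by simp
  have RP: "R \<subseteq> P n" "\<And>x. x \<in> P n \<Longrightarrow> \<exists>!r. r \<in> R \<and> x - r \<in> P h" "finite R"
    and SP: "S \<subseteq> P 0" "\<And>x. x \<in> P 0 \<Longrightarrow> \<exists>!r. r \<in> S \<and> x - r \<in> P 1" "finite S"
    using R S by (auto simp: reps_def h_def)
  have uniq: "r = r' \<and> s = s'"
    if "r \<in> R" "s \<in> S" "r' \<in> R" "s' \<in> S" and d: "(r + pw h * s) - (r' + pw h * s') \<in> P (h + 1)"
    for r s r' s'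
  proof -
    have "r - r' = ((r + pw h * s) - (r' + pw h * s')) + (pw h * s' - pw h * s)" by (simp add: algebra_simps)
    moreover have "pw h * s' - pw h * s \<in> P h" using gP that SP(1) by (intro P_diff) auto
    ultimately have "r - r' \<in> P h" using P_mono[OF d, of h] P_add by force
    then have "r = r'" using RP(2)[of r] that RP(1) by (metis P0 diff_self subsetD)
    then have "pw h * (s - s') \<in> P (h + 1)" using d by (simp add: algebra_simps)
    then have "s - s' \<in> P 1" by (simp add: P_mult_iff)
    then have "s = s'" using SP(2)[of s] that SP(1) by (metis P0 diff_self subsetD)
    then show ?thesis using \<open>r = r'\<close> by simp
  qed
  have inj: "inj_on g (R \<times> S)"
    unfolding inj_on_def g_def using uniq by force
  have "reps n (h + 1) (g ` (R \<times> S))" unfolding reps_def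
  proof (intro conjI ballI)
    show "g ` (R \<times> S) \<subseteq> P n"
    proof
      fix x assume "x \<in> g ` (R \<times> S)"
      then obtain r s where rs: "r \<in> R" "s \<in> S" "x = r + pw h * s" by (auto simp: g_def)
      then show "x \<in> P n" using RP(1) SP(1) gP[of s] P_mono[of "pw h * s" h n] P_add[of r n]
        by (auto simp: h_def)
    qed
    fix x assume x: "x \<in> P n"
    obtain r where r: "r \<in> R" "x - r \<in> P h" using RP(2)[OF x] by auto
    have "(x - r) / pw h \<in> P 0" using r by (simp add: P_divide_iff)
    then obtain s where s: "s \<in> S" "(x - r) / pw h - s \<in> P 1" using SP(2) by blast
    have "pw h * ((x - r) / pw h - s) \<in> P (h + 1)" using s by (simp add: P_mult_iff)
    moreover have "pw h * ((x - r) / pw h - s) = x - (r + pw h * s)" by (simp add: field_simps)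
    ultimately have *: "x - (r + pw h * s) \<in> P (h + 1)" by simp
    show "\<exists>!y. y \<in> g ` (R \<times> S) \<and> x - y \<in> P (h + 1)"
    proof (rule ex1I[of _ "r + pw h * s"])
      show "r + pw h * s \<in> g ` (R \<times> S) \<and> x - (r + pw h * s) \<in> P (h + 1)"
        using r s * by (auto simp: g_def intro!: image_eqI[of _ _ "(r, s)"])
      fix y assume y: "y \<in> g ` (R \<times> S) \<and> x - y \<in> P (h + 1)"
      then obtain r' s' where y': "r' \<in> R" "s' \<in> S" "y = r' + pw h * s'" by (auto simp: g_def)
      have "(r' + pw h * s') - (r + pw h * s) = (x - (r + pw h * s)) - (x - y)" by (simp add: y')
      then have "(r' + pw h * s') - (r + pw h * s) \<in> P (h + 1)" using * y by (metis P_diff)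
      then show "y = r + pw h * s" using uniq[OF y'(1,2) r(1) s(1)] y' by auto
    qed
  qed (use RP SP in auto)
  moreover have "card (g ` (R \<times> S)) = q ^ Suc k"
    using R S inj by (simp add: card_image card_cartesian_product)
  ultimately show ?case by (intro exI[of _ "g ` (R \<times> S)"]) (simp add: h_def algebra_simps)
qed

text \<open>Representatives of \<open>P n / P m\<close>; meaningful for \<open>n \<le> m\<close> only.\<close>
definition Rp :: "int \<Rightarrow> int \<Rightarrow> 'f set" where
  "Rp n m = (SOME R. reps n m R \<and> card R = q ^ nat (m - n))"

lemma Rp: assumes "n \<le> m" shows "reps n m (Rp n m)" "card (Rp n m) = q ^ nat (m - n)"
  using someI_ex[OF reps_exist[of n "nat (m - n)"]] assms unfolding Rp_def by auto

lemma RpD: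
  assumes "n \<le> m"
  shows "finite (Rp n m)" "r \<in> Rp n m \<Longrightarrow> r \<in> P n"
    "x \<in> P n \<Longrightarrow> \<exists>r\<in>Rp n m. x - r \<in> P m"
    "r \<in> Rp n m \<Longrightarrow> r' \<in> Rp n m \<Longrightarrow> r - r' \<in> P m \<Longrightarrow> r = r'"
proof -
  note R = Rp(1)[OF assms, unfolded reps_def]
  show "finite (Rp n m)" "r \<in> Rp n m \<Longrightarrow> r \<in> P n" "x \<in> P n \<Longrightarrow> \<exists>r\<in>Rp n m. x - r \<in> P m"
    using R by blast+
  show "r \<in> Rp n m \<Longrightarrow> r' \<in> Rp n m \<Longrightarrow> r - r' \<in> P m \<Longrightarrow> r = r'"
    using R by (metis P0 diff_self subsetD)
qed

text \<open>Finite substitute for the invariance of Haar measure. The map \<open>h\<close> is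
  injective on the finite quotient P^n / P^m, hence permutes it, and \<open>f\<close> depends on the
  class only.\<close>

lemma sum_Rp_reindex:
  fixes f :: "'f \<Rightarrow> 'w::comm_monoid_add"
  assumes "n \<le> m"
    and per: "\<And>x y. x \<in> P n \<Longrightarrow> y \<in> P n \<Longrightarrow> x - y \<in> P m \<Longrightarrow> f x = f y"
    and h: "\<And>x. x \<in> P n \<Longrightarrow> h x \<in> P n"
    and inj: "\<And>x y. x \<in> P n \<Longrightarrow> y \<in> P n \<Longrightarrow> h x - h y \<in> P m \<Longrightarrow> x - y \<in> P m"
  shows "(\<Sum>x\<in>Rp n m. f (h x)) = (\<Sum>x\<in>Rp n m. f x)"
proof -
  note R = RpD[OF assms(1)]
  \<comment> \<open>\<open>\<theta>\<close> is the permutation that \<open>h\<close> induces on the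
    chosen representatives.\<close>
  have "\<forall>x. \<exists>r. x \<in> Rp n m \<longrightarrow> r \<in> Rp n m \<and> h x - r \<in> P m" using R(2,3) h by blast
  then obtain \<theta> where \<theta>: "\<And>x. x \<in> Rp n m \<Longrightarrow> \<theta> x \<in> Rp n m \<and> h x - \<theta> x \<in> P m" by metis
  have inj\<theta>: "inj_on \<theta> (Rp n m)"
  proof (rule inj_onI)
    fix x y assume xy: "x \<in> Rp n m" "y \<in> Rp n m" "\<theta> x = \<theta> y"
    have "h x - h y = (h x - \<theta> x) - (h y - \<theta> y)" using xy by simp
    then have "h x - h y \<in> P m" using \<theta> xy by (metis P_diff)
    then show "x = y" using inj[of x y] R xy by blast
  qed
  have "\<theta> ` Rp n m = Rp n m"
    using \<theta> by (intro endo_inj_surj[OF R(1) _ inj\<theta>]) auto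
  then have "(\<Sum>x\<in>Rp n m. f x) = (\<Sum>x\<in>Rp n m. f (\<theta> x))"
    using sum.reindex[OF inj\<theta>, of f] by (simp add: o_def)
  also have "\<dots> = (\<Sum>x\<in>Rp n m. f (h x))"
    using \<theta> R(2) h by (intro sum.cong refl per[symmetric]) auto
  finally show ?thesis by simp
qed

lemma sum_Rp_shift:
  fixes f :: "'f \<Rightarrow> 'w::comm_monoid_add"
  assumes "n \<le> m" "y \<in> P n"
    and "\<And>x y. x \<in> P n \<Longrightarrow> y \<in> P n \<Longrightarrow> x - y \<in> P m \<Longrightarrow> f x = f y"
  shows "(\<Sum>x\<in>Rp n m. f (y + x)) = (\<Sum>x\<in>Rp n m. f x)"
proof (rule sum_Rp_reindex[OF assms(1)])
  show "x \<in> P n \<Longrightarrow> z \<in> P n \<Longrightarrow> x - z \<in> P m \<Longrightarrow> f x = f z" for x z by (rule assms(3))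
  show "x \<in> P n \<Longrightarrow> y + x \<in> P n" for x using assms(2) by (rule P_add)
qed simp

lemma sum_Rp_scale:
  fixes f :: "'f \<Rightarrow> 'w::comm_monoid_add"
  assumes "n \<le> m" "y \<noteq> 0" "v y = 0"
    and "\<And>x y. x \<in> P n \<Longrightarrow> y \<in> P n \<Longrightarrow> x - y \<in> P m \<Longrightarrow> f x = f y"
  shows "(\<Sum>x\<in>Rp n m. f (y * x)) = (\<Sum>x\<in>Rp n m. f x)"
proof (rule sum_Rp_reindex[OF assms(1)])
  fix x z assume "y * x - y * z \<in> P m"
  then have "y * (x - z) \<in> P m" by (simp add: algebra_simps)
  then show "x - z \<in> P m" using assms(2,3) by (simp add: P_mult_iff)
next
  show "x \<in> P n \<Longrightarrow> z \<in> P n \<Longrightarrow> x - z \<in> P m \<Longrightarrow> f x = f z" for x z by (rule assms(4))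
  show "x \<in> P n \<Longrightarrow> y * x \<in> P n" for x using assms(2,3) by (simp add: P_mult_iff)
qed

end

section \<open>Orthogonality of additive characters\<close>

locale char_field = local_field v q for v :: "'f::field \<Rightarrow> int" and q +
  fixes \<psi> :: "'f \<Rightarrow> 'r::field"
  assumes q_unit: "(of_nat q :: 'r) \<noteq> 0"
    and psi_add: "\<psi> (x + y) = \<psi> x * \<psi> y" and psi_0 [simp]: "\<psi> 0 = 1"
    and psi_P1: "x \<in> vpow v 1 \<Longrightarrow> \<psi> x = 1" and psi_nontriv: "\<exists>x\<in>vpow v 0. \<psi> x \<noteq> 1"
begin

lemma psi_minus: "\<psi> (- x) * \<psi> x = 1" "\<psi> x * \<psi> (- x) = 1"
  using psi_add[of "-x" x] psi_add[of x "-x"] by auto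

lemma psi_nonzero [simp]: "\<psi> x \<noteq> 0" using psi_minus(2)[of x] by auto

lemma psi_cong: "x - y \<in> P 1 \<Longrightarrow> \<psi> x = \<psi> y"
  using psi_add[of "x - y" y] psi_P1 by simp

text \<open>Together with \<open>psi_P_triv\<close> this says that P^(1-n) is the annihilator of P^n
  under the pairing \<psi>(t x). All shifts by 1 below come from \<psi> being trivial on P^1 and not
  on P^0.\<close>

lemma psi_P_nontriv: assumes "t \<noteq> 0" "n \<le> - v t" shows "\<exists>x\<in>P n. \<psi> (t * x) \<noteq> 1"
proof -
  obtain x where x: "x \<in> P 0" "\<psi> x \<noteq> 1" using psi_nontriv by blast
  have "x / t \<in> P n" using x assms P_mono[OF x(1), of "n + v t"] by (simp add: P_divide_iff)
  then show ?thesis using x assms(1) by (intro bexI[of _ "x / t"]) auto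
qed

lemma psi_P_triv: assumes "t \<in> P (1 - n)" "x \<in> P n" shows "\<psi> (t * x) = 1"
  using psi_P1 P_mult[OF assms] by simp

text \<open>Off the annihilator some y has \<psi>(t y) different from 1; translating the sum by y
  multiplies it by this value, so it vanishes.\<close>

lemma sum_psi:
  assumes "n \<le> m" "t \<in> P (1 - m)"
  shows "(\<Sum>x\<in>Rp n m. \<psi> (t * x)) = (if t \<in> P (1 - n) then of_nat (q ^ nat (m - n)) else 0)"
proof (cases "t \<in> P (1 - n)")
  case True
  then have "(\<Sum>x\<in>Rp n m. \<psi> (t * x)) = (\<Sum>x\<in>Rp n m. 1)"
    using psi_P_triv RpD(2)[OF assms(1)] by (intro sum.cong) auto
  then show ?thesis using True Rp(2)[OF assms(1)] by simp
next
  case False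
  then have t0: "t \<noteq> 0" by auto
  then obtain y where y: "y \<in> P n" "\<psi> (t * y) \<noteq> 1" using psi_P_nontriv[OF t0, of n] False by (auto simp: P_v)
  have per: "\<psi> (t * x) = \<psi> (t * z)" if "x - z \<in> P m" for x z
    using psi_P_triv[OF assms(2) that] psi_add[of "t * (x - z)" "t * z"] by (simp add: algebra_simps)
  have "(\<Sum>x\<in>Rp n m. \<psi> (t * x)) = (\<Sum>x\<in>Rp n m. \<psi> (t * (y + x)))"
    using per y(1) by (intro sum_Rp_shift[OF assms(1), symmetric]) auto
  also have "\<dots> = \<psi> (t * y) * (\<Sum>x\<in>Rp n m. \<psi> (t * x))"
    by (simp add: ring_distribs psi_add sum_distrib_left)
  finally have "(1 - \<psi> (t * y)) * (\<Sum>x\<in>Rp n m. \<psi> (t * x)) = 0" by (simp add: algebra_simps)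
  then show ?thesis using y False by simp
qed

end

section \<open>Smooth representations and Fourier averages over the unipotent group\<close>

abbreviation uu :: "'f::field \<Rightarrow> 'f mat2" where "uu x \<equiv> (1, x, 0, 1)"
abbreviation ll :: "'f::field \<Rightarrow> 'f mat2" where "ll x \<equiv> (1, 0, x, 1)"
abbreviation dg :: "'f::field \<Rightarrow> 'f \<Rightarrow> 'f mat2" where "dg a d \<equiv> (a, 0, 0, d)"

fun minv :: "'f::field mat2 \<Rightarrow> 'f mat2" where
  "minv (a, b, c, d) = (d / (a*d - b*c), - b / (a*d - b*c), - c / (a*d - b*c), a / (a*d - b*c))"

lemma mdet_mmul: "mdet (mmul g h) = mdet g * mdet h"
  by (cases g; cases h) (simp add: algebra_simps)

lemma mmul_assoc: "mmul (mmul g h) k = mmul g (mmul h k)"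
  by (cases g; cases h; cases k) (simp add: algebra_simps)

lemma mmul_mone [simp]: "mmul mone g = g" "mmul g mone = g"
  by (cases g; simp add: mone_def)+

lemma mmul_minv [simp]: "g \<in> GL2 \<Longrightarrow> mmul g (minv g) = mone" "g \<in> GL2 \<Longrightarrow> mmul (minv g) g = mone"
proof -
  assume g: "g \<in> GL2"
  obtain a b c d where abcd: "g = (a, b, c, d)" by (cases g)
  define D where "D = a * d - b * c"
  have D: "D \<noteq> 0" using g by (simp add: abcd GL2_def D_def)
  have i: "minv g = (d / D, - b / D, - c / D, a / D)" by (simp add: abcd D_def)
  have *: "(a * d - b * c) / D = 1" using D by (simp add: D_def)
  show "mmul g (minv g) = mone" "mmul (minv g) g = mone" unfolding i
    using * by (simp_all add: abcd mone_def diff_divide_distrib mult.commute)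
qed

lemma GL2_mmul [simp]: "g \<in> GL2 \<Longrightarrow> h \<in> GL2 \<Longrightarrow> mmul g h \<in> GL2"
  by (simp add: GL2_def mdet_mmul)

lemma mdet_mone [simp]: "mdet mone = 1" by (simp add: mone_def)

lemma GL2_mone [simp]: "mone \<in> GL2" by (simp add: GL2_def)

lemma mdet_minv: "g \<in> GL2 \<Longrightarrow> mdet (minv g) = inverse (mdet g)"
  using mdet_mmul[of g "minv g"] by (simp add: GL2_def field_simps)

lemma GL2_minv [simp]: "g \<in> GL2 \<Longrightarrow> minv g \<in> GL2"
  using mdet_minv[of g] by (simp add: GL2_def)

lemma SL2_GL2 [simp]: "g \<in> SL2 \<Longrightarrow> g \<in> GL2" by (simp add: SL2_def GL2_def)

lemma SL2_mmul [simp]: "g \<in> SL2 \<Longrightarrow> h \<in> SL2 \<Longrightarrow> mmul g h \<in> SL2"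
  by (simp add: SL2_def mdet_mmul)

lemma SL2_minv [simp]: "g \<in> SL2 \<Longrightarrow> minv g \<in> SL2"
  using mdet_minv[of g] by (simp add: SL2_def GL2_def)

lemma SL2_conj [simp]: "g \<in> GL2 \<Longrightarrow> s \<in> SL2 \<Longrightarrow> mmul (mmul (minv g) s) g \<in> SL2"
  by (simp add: SL2_def mdet_mmul mdet_minv GL2_def)

lemma uu_GL2 [simp]: "uu x \<in> GL2" and ll_GL2 [simp]: "ll x \<in> GL2"
  and dg_GL2 [simp]: "a \<noteq> 0 \<Longrightarrow> d \<noteq> 0 \<Longrightarrow> dg a d \<in> GL2"
  and uu_SL2 [simp]: "uu x \<in> SL2" and ll_SL2 [simp]: "ll x \<in> SL2"
  by (auto simp: GL2_def SL2_def)

section \<open>Smooth vectors and their unipotent averages\<close>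

locale gl2rep = char_field v q \<psi> + vs sc V
  for v :: "'f::field \<Rightarrow> int" and q and \<psi> :: "'f \<Rightarrow> 'r::field"
    and sc :: "'r \<Rightarrow> 'v::ab_group_add \<Rightarrow> 'v" and V :: "'v set" +
  fixes \<rho> :: "'f mat2 \<Rightarrow> 'v \<Rightarrow> 'v"
  assumes smooth: "smooth_rep v sc V \<rho>"
begin

lemma
  shows rho_V [simp]: "g \<in> GL2 \<Longrightarrow> x \<in> V \<Longrightarrow> \<rho> g x \<in> V"
    and rho_add: "g \<in> GL2 \<Longrightarrow> x \<in> V \<Longrightarrow> y \<in> V \<Longrightarrow> \<rho> g (x + y) = \<rho> g x + \<rho> g y"
    and rho_sc: "g \<in> GL2 \<Longrightarrow> x \<in> V \<Longrightarrow> \<rho> g (sc c x) = sc c (\<rho> g x)"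
    and rho_mone [simp]: "x \<in> V \<Longrightarrow> \<rho> mone x = x"
    and rho_rho: "g \<in> GL2 \<Longrightarrow> h \<in> GL2 \<Longrightarrow> x \<in> V \<Longrightarrow> \<rho> g (\<rho> h x) = \<rho> (mmul g h) x"
    and smooth_ex: "x \<in> V \<Longrightarrow> \<exists>j\<ge>1. \<forall>k\<in>Kc v j. \<rho> k x = x"
  using smooth by (auto simp: smooth_rep_def invariant_def)

lemma rho_0 [simp]: "g \<in> GL2 \<Longrightarrow> \<rho> g 0 = 0"
  using rho_add[of g 0 0] by simp

lemma rho_minus: "g \<in> GL2 \<Longrightarrow> x \<in> V \<Longrightarrow> \<rho> g (- x) = - \<rho> g x"
  using rho_add[of g x "-x"] by (simp add: add_eq_0_iff)

lemma rho_diff: "g \<in> GL2 \<Longrightarrow> x \<in> V \<Longrightarrow> y \<in> V \<Longrightarrow> \<rho> g (x - y) = \<rho> g x - \<rho> g y"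
  using rho_add[of g x "-y"] by (simp add: rho_minus)

lemma rho_sum: "g \<in> GL2 \<Longrightarrow> (\<And>i. i \<in> I \<Longrightarrow> f i \<in> V) \<Longrightarrow> \<rho> g (sum f I) = (\<Sum>i\<in>I. \<rho> g (f i))"
  by (induction I rule: infinite_finite_induct) (auto simp: rho_add)

lemma rho_inv [simp]:
  "g \<in> GL2 \<Longrightarrow> x \<in> V \<Longrightarrow> \<rho> (minv g) (\<rho> g x) = x"
  "g \<in> GL2 \<Longrightarrow> x \<in> V \<Longrightarrow> \<rho> g (\<rho> (minv g) x) = x"
  by (simp_all add: rho_rho)

lemma rho_eq_0: "g \<in> GL2 \<Longrightarrow> x \<in> V \<Longrightarrow> \<rho> g x = 0 \<longleftrightarrow> x = 0"
  by (metis rho_0 rho_inv(1) GL2_minv)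

definition Ufix :: "int \<Rightarrow> 'v \<Rightarrow> bool" where "Ufix n w \<longleftrightarrow> (\<forall>x\<in>P n. \<rho> (uu x) w = w)"
definition Kfix :: "int \<Rightarrow> 'v \<Rightarrow> bool" where
  "Kfix n w \<longleftrightarrow> (\<forall>a b c d. a - 1 \<in> P n \<longrightarrow> b \<in> P n \<longrightarrow> c \<in> P n \<longrightarrow> d - 1 \<in> P n \<longrightarrow> \<rho> (a, b, c, d) w = w)"

lemma K_GL2: "a - 1 \<in> P n \<Longrightarrow> b \<in> P k \<Longrightarrow> c \<in> P l \<Longrightarrow> d - 1 \<in> P n \<Longrightarrow> n \<ge> 1 \<Longrightarrow> k + l \<ge> 1 \<Longrightarrow>
   a * d - b * c \<noteq> 0 \<and> v (a * d - b * c) = 0"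
proof -
  assume as: "a - 1 \<in> P n" "b \<in> P k" "c \<in> P l" "d - 1 \<in> P n" "n \<ge> 1" "k + l \<ge> 1"
  have "a * d - 1 \<in> P 1" using one_unit_mult[of a n d] as P_mono[of _ n 1] by simp
  moreover have "b * c \<in> P 1" using as by (intro P_mult_le) auto
  ultimately have "(a * d - 1) - b * c \<in> P 1" by (rule P_diff)
  then have "(a * d - b * c) - 1 \<in> P 1" by (simp add: algebra_simps)
  then show ?thesis using one_unit[of "a * d - b * c" 1] by simp
qed

lemma Kfix_ex: assumes "x \<in> V" obtains i where "i \<ge> 1" "Kfix i x"
proof -
  obtain j where j: "j \<ge> 1" "\<forall>k\<in>Kc v j. \<rho> k x = x" using smooth_ex[OF assms] by blast
  have "Kfix (int j) x" unfolding Kfix_def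
    using j K_GL2[of _ "int j" _ "int j" _ "int j"] by (auto simp: Kc_def GL2_def)
  then show ?thesis using that[of "int j"] j by simp
qed

lemma Kfix_mono: "Kfix i x \<Longrightarrow> i \<le> j \<Longrightarrow> Kfix j x"
  unfolding Kfix_def using P_mono by meson

lemma Kfix_Ufix: "Kfix i x \<Longrightarrow> Ufix i x"
  unfolding Kfix_def Ufix_def by auto

lemma Ufix_mono: "Ufix i x \<Longrightarrow> i \<le> j \<Longrightarrow> Ufix j x"
  unfolding Ufix_def using P_mono by meson

text \<open>Unnormalised projection of \<open>w\<close> to the vectors on which P^(-n), viewed in U,
  acts by \<psi>(t x). The choice of representatives is immaterial when \<open>w\<close> is fixed by
  the upper unipotents from P^i and t lies in P^(1-i).\<close>

definition avg :: "int \<Rightarrow> int \<Rightarrow> 'f \<Rightarrow> 'v \<Rightarrow> 'v" where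
  "avg n i t w = (\<Sum>x\<in>Rp (-n) i. sc (\<psi> (- (t * x))) (\<rho> (uu x) w))"

lemma avg_V [simp]: "w \<in> V \<Longrightarrow> avg n i t w \<in> V"
  unfolding avg_def by (intro V_sum V_sc rho_V) auto

lemma avg_add: "w \<in> V \<Longrightarrow> w' \<in> V \<Longrightarrow> avg n i t (w + w') = avg n i t w + avg n i t w'"
  by (simp add: avg_def rho_add sc_add sum.distrib)

lemma avg_0 [simp]: "avg n i t 0 = 0"
  by (simp add: avg_def)

lemma avg_in:
  assumes "sub W" "\<And>x w. w \<in> W \<Longrightarrow> \<rho> (uu x) w \<in> W" "w \<in> W"
  shows "avg n i t w \<in> W"
proof -
  have "subsp sc W" using assms(1) by simp
  then show ?thesis unfolding avg_def using assms(2,3) by (intro subsp_sum[of sc W] subspD(3)[of sc W])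
qed

lemma avg_summand_cong:
  assumes "w \<in> V" "Ufix i w" "t \<in> P (1 - i)" "x - y \<in> P i"
  shows "sc (\<psi> (- (t * x))) (\<rho> (uu x) w) = sc (\<psi> (- (t * y))) (\<rho> (uu y) w)"
proof -
  have "\<psi> (- (t * x)) = \<psi> (- (t * y))"
  proof (rule psi_cong)
    have "- (t * (x - y)) \<in> P 1" using P_mult[OF assms(3,4)] by simp
    then show "- (t * x) - - (t * y) \<in> P 1" by (simp add: algebra_simps)
  qed
  moreover have "\<rho> (uu x) w = \<rho> (uu y) (\<rho> (uu (x - y)) w)"
    using assms(1) by (simp add: rho_rho)
  ultimately show ?thesis using assms(2,4) by (simp add: Ufix_def)
qed

lemma avg_eigen:
  assumes "w \<in> V" "Ufix i w" "t \<in> P (1 - i)" "- n \<le> i" "y \<in> P (- n)"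
  shows "\<rho> (uu y) (avg n i t w) = sc (\<psi> (t * y)) (avg n i t w)"
proof -
  define F where "F x = sc (\<psi> (- (t * x))) (\<rho> (uu x) w)" for x
  have "\<rho> (uu y) (avg n i t w) = (\<Sum>x\<in>Rp (-n) i. sc (\<psi> (- (t * x))) (\<rho> (uu y) (\<rho> (uu x) w)))"
    unfolding avg_def using assms(1) by (subst rho_sum) (auto simp: rho_sc)
  also have "\<dots> = (\<Sum>x\<in>Rp (-n) i. sc (\<psi> (t * y)) (F (y + x)))"
    using assms(1) unfolding F_def
    by (intro sum.cong refl)
      (simp add: rho_rho sc_sc psi_add[symmetric] algebra_simps)
  also have "\<dots> = sc (\<psi> (t * y)) (\<Sum>x\<in>Rp (-n) i. F (y + x))"
    using assms(1) unfolding F_def by (intro sc_sum[symmetric]) auto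
  also have "(\<Sum>x\<in>Rp (-n) i. F (y + x)) = (\<Sum>x\<in>Rp (-n) i. F x)"
    using assms avg_summand_cong unfolding F_def by (intro sum_Rp_shift) auto
  finally show ?thesis by (simp add: avg_def F_def)
qed

text \<open>The index t runs through the dual group of P^(-n) / P^i. Orthogonality removes every x
  except the representative of 0.\<close>

lemma fourier_inversion:
  assumes "w \<in> V" "Ufix i w" "- n \<le> i"
  shows "(\<Sum>t\<in>Rp (1 - i) (1 + n). avg n i t w) = sc (of_nat (q ^ nat (n + i))) w"
proof -
  have le: "1 - i \<le> 1 + n" using assms by simp
  \<comment> \<open>The class of 0 has a representative \<open>r\<close> that may differ from 0; it
    still acts trivially on \<open>w\<close>.\<close>
  obtain r where r: "r \<in> Rp (-n) i" "- r \<in> P i" using RpD(3)[OF assms(3), of 0] by auto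
  then have rP: "r \<in> P i" by simp
  have inner: "(\<Sum>t\<in>Rp (1-i) (1+n). \<psi> (- (t * x))) = (if x = r then of_nat (q ^ nat (n + i)) else 0)"
    if x: "x \<in> Rp (-n) i" for x
  proof -
    have "(\<Sum>t\<in>Rp (1-i) (1+n). \<psi> (- (t * x))) = (\<Sum>t\<in>Rp (1-i) (1+n). \<psi> ((- x) * t))"
      by (simp add: mult.commute)
    also have "\<dots> = (if - x \<in> P (1 - (1 - i)) then of_nat (q ^ nat (1 + n - (1 - i))) else 0)"
      using RpD(2)[OF assms(3) x] by (intro sum_psi[OF le]) simp
    also have "- x \<in> P (1 - (1 - i)) \<longleftrightarrow> x = r"
      using RpD(4)[OF assms(3) x r(1)] P_diff[of x i r] rP by auto
    finally show ?thesis by (simp add: add.commute)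
  qed
  have "(\<Sum>t\<in>Rp (1-i) (1+n). avg n i t w)
      = (\<Sum>x\<in>Rp (-n) i. \<Sum>t\<in>Rp (1-i) (1+n). sc (\<psi> (- (t * x))) (\<rho> (uu x) w))"
    unfolding avg_def by (rule sum.swap)
  also have "\<dots> = (\<Sum>x\<in>Rp (-n) i. sc (\<Sum>t\<in>Rp (1-i) (1+n). \<psi> (- (t * x))) (\<rho> (uu x) w))"
    using assms(1) by (intro sum.cong refl sum_sc[symmetric]) auto
  also have "\<dots> = (\<Sum>x\<in>Rp (-n) i. if x = r then sc (of_nat (q ^ nat (n + i))) (\<rho> (uu x) w) else 0)"
    using assms(1) inner by (intro sum.cong refl) auto
  also have "\<dots> = sc (of_nat (q ^ nat (n + i))) (\<rho> (uu r) w)"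
    using r RpD(1)[OF assms(3)] by simp
  finally show ?thesis using rP assms(2) by (simp add: Ufix_def)
qed

lemma q_power_nonzero: "(of_nat (q ^ k) :: 'r) \<noteq> 0"
  using q_unit by simp

text \<open>By inversion \<open>w\<close> is a combination of its averages. Those with t outside
  P^(1-m) vanish, because \<psi>(t x) is nontrivial on P^m, which fixes \<open>w\<close>; those with
  t in P^(1-n0) are fixed by P^n0. If all remaining ones vanished as well, \<open>w\<close> would be
  fixed by P^n0.\<close>

lemma nonzero_avg_exists:
  assumes w: "w \<in> V" "Ufix m w" "\<not> Ufix n0 w" and n: "- n \<le> n0" "m \<le> i"
  shows "\<exists>t. t \<noteq> 0 \<and> 1 - m \<le> v t \<and> v t \<le> - n0 \<and> avg n i t w \<noteq> 0"
proof (rule ccontr)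
  assume no: "\<nexists>t. t \<noteq> 0 \<and> 1 - m \<le> v t \<and> v t \<le> - n0 \<and> avg n i t w \<noteq> 0"
  have Ui: "Ufix i w" using Ufix_mono w n by blast
  have n0m: "n0 < m" using w(2,3) Ufix_mono[of m w n0] by (meson not_le)
  have ni: "- n \<le> i" using n n0m by simp
  let ?T = "Rp (1-i) (1+n)"
  have vanish: "avg n i t w = 0" if t: "t \<in> ?T" "t \<notin> P (1 - n0)" for t
  proof (cases "t \<in> P (1 - m)")
    case True
    moreover have "t \<noteq> 0" using t by auto
    moreover have "v t \<le> - n0" using t(2) \<open>t \<noteq> 0\<close> by (simp add: P_v)
    ultimately show ?thesis using no by (auto simp: P_v)
  next
    case False
    then have t0: "t \<noteq> 0" by auto
    have tP: "t \<in> P (1 - i)" using RpD(2)[OF _ t(1)] ni by simp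
    obtain y where y: "y \<in> P m" "\<psi> (t * y) \<noteq> 1" using psi_P_nontriv[OF t0, of m] False t0 by (auto simp: P_v)
    have "y \<in> P (- n)" using P_mono[OF y(1)] n n0m by simp
    then have e: "\<rho> (uu y) (avg n i t w) = sc (\<psi> (t * y)) (avg n i t w)"
      using avg_eigen[OF w(1) Ui tP ni] by blast
    have "\<rho> (uu y) (avg n i t w) = avg n i t (\<rho> (uu y) w)"
      unfolding avg_def using w(1) by (simp add: rho_sum rho_sc rho_rho add.commute)
    also have "\<rho> (uu y) w = w" using w(2) y by (simp add: Ufix_def)
    finally have "sc (\<psi> (t * y)) (avg n i t w) - sc 1 (avg n i t w) = 0" using e w(1) by simp
    then have "sc (\<psi> (t * y) - 1) (avg n i t w) = 0" using w(1) by (simp add: diff_sc)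
    then show ?thesis using sc_cancel[of "avg n i t w"] y w(1) by simp
  qed
  have "Ufix n0 (sc (of_nat (q ^ nat (n + i))) w)"
    unfolding Ufix_def
  proof
    fix y assume y: "y \<in> P n0"
    have fix1: "\<rho> (uu y) (avg n i t w) = avg n i t w" if t: "t \<in> ?T" for t
    proof (cases "t \<in> P (1 - n0)")
      case True
      have "y \<in> P (- n)" using P_mono[OF y] n by simp
      then have "\<rho> (uu y) (avg n i t w) = sc (\<psi> (t * y)) (avg n i t w)"
        using avg_eigen[OF w(1) Ui _ ni] RpD(2)[OF _ t] ni by simp
      then show ?thesis using psi_P_triv[OF True y] w(1) by simp
    next
      case False
      then show ?thesis using vanish t by simp
    qed
    have "\<rho> (uu y) (\<Sum>t\<in>?T. avg n i t w) = (\<Sum>t\<in>?T. avg n i t w)"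
      using w(1) fix1 by (simp add: rho_sum)
    then show "\<rho> (uu y) (sc (of_nat (q ^ nat (n + i))) w) = sc (of_nat (q ^ nat (n + i))) w"
      using fourier_inversion[OF w(1) Ui ni] by simp
  qed
  then have "Ufix n0 w"
  proof -
    assume U: "Ufix n0 (sc (of_nat (q ^ nat (n + i))) w)"
    show "Ufix n0 w" unfolding Ufix_def
    proof
      fix y assume "y \<in> P n0"
      then have "sc (of_nat (q ^ nat (n + i))) (\<rho> (uu y) w - w) = 0"
        using U w(1) by (simp add: Ufix_def rho_sc sc_diff del: of_nat_power)
      then show "\<rho> (uu y) w = w" using sc_cancel[of "\<rho> (uu y) w - w"] q_power_nonzero w(1) by force
    qed
  qed
  then show False using w by simp
qed

text \<open>The group occurring here is the conjugate of \<open>Iw v (2 * n + 1)\<close> by a diagonal matrix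
  \<open>(t, 1)\<close> with \<open>v t = - 2 * n\<close>, which makes the character independent of \<open>n\<close>.\<close>
definition eigv :: "int \<Rightarrow> 'v \<Rightarrow> bool" where
  "eigv n y \<longleftrightarrow> y \<in> V \<and> (\<forall>a b c d. a - 1 \<in> P (n + 1) \<longrightarrow> d - 1 \<in> P (n + 1) \<longrightarrow> b \<in> P (- n) \<longrightarrow>
     c \<in> P (3 * n + 1) \<longrightarrow> \<rho> (a, b, c, d) y = sc (\<psi> b) y)"

text \<open>The average transforms correctly under the three factors of the Iwahori factorisation,
  and conjugation by \<open>dg t 1\<close> turns the character \<psi>(t x) into \<psi>(b). The bound
  \<open>n + 1 - 2 * v t \<ge> i\<close> is what puts x^2 c into P^i in the lower unipotent
  part.\<close>

lemma eigv_avg: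
  assumes w: "w \<in> V" "Kfix i w" and t: "t \<noteq> 0" "t \<in> P (1 - i)"
    and n: "i \<ge> 1" "n \<ge> 0" "n - v t \<ge> 0" "n - v t + 1 \<ge> i" "n + 1 - 2 * v t \<ge> i" "- n \<le> i"
  shows "eigv (n - v t) (\<rho> (dg t 1) (avg n i t w))"
proof -
  define e where "e = v t"
  define n' where "n' = n - e"
  define y where "y = avg n i t w"
  have yV: "y \<in> V" using w by (simp add: y_def)
  have Ui: "Ufix i w" using w Kfix_Ufix by blast
  have Uy: "\<rho> (uu x) y = sc (\<psi> (t * x)) y" if "x \<in> P (-n)" for x
    unfolding y_def using avg_eigen[OF w(1) Ui t(2) n(6) that] .
  \<comment> \<open>A diagonal matrix close to 1 rescales x by the unit s = a/d. This permutes
    P^(-n) / P^i and leaves \<psi>(t x) alone, since t x (s - 1) lies in P^1.\<close>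
  have Ty: "\<rho> (dg a d) y = y" if a: "a - 1 \<in> P (n' + 1)" and d: "d - 1 \<in> P (n' + 1)" for a d
  proof -
    have n1: "n' + 1 \<ge> 1" "n' + 1 \<ge> i" using n by (auto simp: n'_def e_def)
    note ua = one_unit[OF a n1(1)] and ud = one_unit[OF d n1(1)]
    define s where "s = a / d"
    have s: "s - 1 \<in> P (n' + 1)" using one_unit_divide[OF a d n1(1)] by (simp add: s_def)
    note us = one_unit[OF s n1(1)]
    define F where "F x = sc (\<psi> (- (t * x))) (\<rho> (uu x) w)" for x
    have "\<rho> (dg a d) w = w" using w(2) P_mono[OF a n1(2)] P_mono[OF d n1(2)] by (simp add: Kfix_def)
    then have step: "\<rho> (dg a d) (\<rho> (uu x) w) = \<rho> (uu (s * x)) w" for x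
    proof -
      assume dw: "\<rho> (dg a d) w = w"
      have "\<rho> (dg a d) (\<rho> (uu x) w) = \<rho> (uu (s * x)) (\<rho> (dg a d) w)"
        using w(1) ua ud by (simp add: rho_rho s_def)
      with dw show ?thesis by simp
    qed
    have "\<rho> (dg a d) y = (\<Sum>x\<in>Rp (-n) i. sc (\<psi> (- (t * x))) (\<rho> (uu (s * x)) w))"
      unfolding y_def avg_def using w(1) ua ud step by (subst rho_sum) (auto simp: rho_sc)
    also have "\<dots> = (\<Sum>x\<in>Rp (-n) i. F (s * x))"
    proof (intro sum.cong refl)
      fix x assume x: "x \<in> Rp (-n) i"
      have "t * x \<in> P (e + (- n))" using RpD(2)[OF n(6) x] t by (intro P_mult) (simp_all add: e_def P_v)
      then have "t * x * (s - 1) \<in> P 1" using s by (rule P_mult_le) (simp add: n'_def)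
      then have "\<psi> (- (t * x)) = \<psi> (- (t * (s * x)))" by (intro psi_cong) (simp add: algebra_simps)
      then show "sc (\<psi> (- (t * x))) (\<rho> (uu (s * x)) w) = F (s * x)" by (simp add: F_def)
    qed
    also have "\<dots> = (\<Sum>x\<in>Rp (-n) i. F x)"
      using us avg_summand_cong[OF w(1) Ui t(2)] unfolding F_def by (intro sum_Rp_scale[OF n(6)]) auto
    finally show ?thesis by (simp add: y_def avg_def F_def)
  qed
  have Ly: "\<rho> (ll c) y = y" if c: "c \<in> P (3 * n' + 1 + e)" for c
  proof -
    have "\<rho> (ll c) (\<rho> (uu x) w) = \<rho> (uu x) w" if x: "x \<in> Rp (-n) i" for x
    proof -
      have xP: "x \<in> P (-n)" using RpD(2)[OF n(6) x] .
      have xc: "x * c \<in> P i" by (rule P_mult_le[OF xP c]) (use n in \<open>simp add: n'_def e_def\<close>)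
      have xxc: "x * (x * c) \<in> P i"
        by (rule P_mult_le[OF xP P_mult[OF xP c]]) (use n in \<open>simp add: n'_def e_def\<close>)
      have c': "c \<in> P i" by (rule P_mono[OF c]) (use n in \<open>simp add: n'_def e_def\<close>)
      \<comment> \<open>This matrix is \<open>ll c\<close> conjugated by \<open>uu x\<close>, and
        the bounds above place it in the group fixing \<open>w\<close>.\<close>
      have "\<rho> (1 - x * c, - (x * (x * c)), c, 1 + x * c) w = w"
        using w(2) xc xxc c' by (auto simp: Kfix_def)
      moreover have "(1 - x * c, - (x * (x * c)), c, 1 + x * c) \<in> GL2"
        by (simp add: GL2_def algebra_simps)
      ultimately have "\<rho> (uu x) w = \<rho> (mmul (uu x) (1 - x * c, - (x * (x * c)), c, 1 + x * c)) w"
        using w(1) by (metis rho_rho uu_GL2)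
      also have "mmul (uu x) (1 - x * c, - (x * (x * c)), c, 1 + x * c) = mmul (ll c) (uu x)"
        by (simp add: algebra_simps)
      finally show ?thesis unfolding rho_rho[OF ll_GL2 uu_GL2 w(1)] by (rule sym)
    qed
    then show ?thesis unfolding y_def avg_def using w(1) by (subst rho_sum) (auto simp: rho_sc)
  qed
  have "\<rho> (a, b, c, d) (\<rho> (dg t 1) y) = sc (\<psi> b) (\<rho> (dg t 1) y)"
    if a: "a - 1 \<in> P (n' + 1)" and d: "d - 1 \<in> P (n' + 1)" and b: "b \<in> P (- n')" and c: "c \<in> P (3 * n' + 1)"
    for a b c d
  proof -
    have n1: "n' + 1 \<ge> 1" using n by (auto simp: n'_def e_def)
    note ua = one_unit[OF a n1] and ud = one_unit[OF d n1]
    have bc: "b * c \<in> P (n' + 1)" by (rule P_mult_le[OF b c]) (use n1 in simp)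
    have bcd: "b * c / d \<in> P (n' + 1)" using bc ud by (simp add: P_divide_iff)
    \<comment> \<open>Factorisation of (a, b, c, d) into upper unipotent, diagonal and lower
      unipotent parts; \<open>x\<close> and \<open>z\<close> are the unipotent coordinates after
      moving \<open>dg t 1\<close> to the left.\<close>
    define a' where "a' = a - b * c / d"
    have "(a - 1) - b * c / d \<in> P (n' + 1)" using a bcd by (rule P_diff)
    then have a': "a' - 1 \<in> P (n' + 1)" by (simp add: a'_def algebra_simps)
    note ua' = one_unit[OF a' n1]
    define x where "x = b / (t * d)"
    define z where "z = c * t / d"
    have v1: "v (t * d) = e" using t ud by (simp add: v_mult e_def)
    have x: "x \<in> P (- n)" unfolding x_def using b t ud v1 by (simp add: P_divide_iff n'_def)
    have "t \<in> P e" using t by (simp add: P_v e_def)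
    then have z: "z \<in> P (3 * n' + 1 + e)" unfolding z_def using P_mult[OF c] ud by (simp add: P_divide_iff)
    have g: "(a, b, c, d) \<in> GL2"
    proof -
      have "a * d - b * c = a' * d" using ud by (simp add: a'_def field_simps)
      then show ?thesis using ua' ud by (simp add: GL2_def)
    qed
    have "mmul (a, b, c, d) (dg t 1) = mmul (dg t 1) (mmul (uu x) (mmul (dg a' d) (ll z)))"
      using t ud by (simp add: x_def z_def a'_def field_simps)
    then have "\<rho> (a, b, c, d) (\<rho> (dg t 1) y) = \<rho> (dg t 1) (\<rho> (uu x) (\<rho> (dg a' d) (\<rho> (ll z) y)))"
      using g t ua' ud yV by (simp only: rho_rho dg_GL2 GL2_mmul uu_GL2 ll_GL2 one_neq_zero not_False_eq_True rho_V)
    also have "\<dots> = sc (\<psi> (t * x)) (\<rho> (dg t 1) y)"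
      using Ly[OF z] Ty[OF a' d] Uy[OF x] t yV by (simp add: rho_sc)
    also have "\<psi> (t * x) = \<psi> b"
    proof (rule psi_cong)
      have "t * x - b = b * (1 - d) / d" using t ud by (simp add: x_def field_simps)
      moreover have "b * (1 - d) \<in> P 1"
        by (rule P_mult_le[OF b P_diff_commute[OF d]]) simp
      ultimately show "t * x - b \<in> P 1" using ud by (simp add: P_divide_iff)
    qed
    finally show ?thesis .
  qed
  then show ?thesis unfolding eigv_def y_def[symmetric] e_def[symmetric] n'_def[symmetric]
    using yV t by simp
qed

end

section \<open>The induced representation on the Iwahori filtration\<close>

text \<open>Shared by V and the induced representation: either one may be the larger side of the
  virtual identity, depending on the sign of \<open>a\<close>.\<close>

definition linear_on where
  "linear_on sc W \<rho> S \<longleftrightarrow> vs sc W \<and>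
     (\<forall>g\<in>S. (\<forall>x\<in>W. \<forall>y\<in>W. \<rho> g (x + y) = \<rho> g x + \<rho> g y) \<and> (\<forall>c. \<forall>x\<in>W. \<rho> g (sc c x) = sc c (\<rho> g x)))"

lemma subsp_fixed:
  assumes "linear_on sc W \<rho> S" "subsp sc X" "X \<subseteq> W" "J \<subseteq> S"
  shows "subsp sc (fixed \<rho> J X)"
proof -
  interpret vs sc W using assms by (simp add: linear_on_def)
  have add: "\<rho> g (x + y) = \<rho> g x + \<rho> g y" if "g \<in> J" "x \<in> X" "y \<in> X" for g x y
    using assms that unfolding linear_on_def by blast
  have scl: "\<rho> g (sc c x) = sc c (\<rho> g x)" if "g \<in> J" "x \<in> X" for g x c
    using assms that unfolding linear_on_def by blast
  have 0: "0 \<in> X" using assms(2) subspD by blast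
  have "\<rho> g 0 = 0" if "g \<in> J" for g using scl[OF that 0, of 0] scl add[OF that 0 0] by simp
  then show ?thesis using subspD[OF assms(2)] unfolding subsp_def fixed_def by (auto simp: add scl)
qed

text \<open>\<open>J\<close> acts trivially on the complement \<open>T\<close>, so the
  \<open>J\<close>-fixed vectors of \<open>W1\<close> are \<open>T\<close> plus those of
  \<open>X\<close>. The second form serves negative \<open>a\<close>, where V is the smaller side
  and finiteness of its fixed vectors has to be derived.\<close>

lemma iso_triv_plus_fixed:
  assumes lin: "linear_on sc1 W1 \<rho>1 S" and iso: "iso_triv_plus sc1 W1 \<rho>1 n sc2 W2 \<rho>2 S" and J: "J \<subseteq> S"
  shows "has_dim sc2 (fixed \<rho>2 J W2) d \<Longrightarrow> has_dim sc1 (fixed \<rho>1 J W1) (n + d)"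
    and "has_dim sc1 (fixed \<rho>1 J W1) D \<Longrightarrow> \<exists>d. has_dim sc2 (fixed \<rho>2 J W2) d \<and> D = n + d"
proof -
  interpret vs sc1 W1 using lin by (simp add: linear_on_def)
  obtain T X where TX': "subsp sc1 T \<and> subsp sc1 X \<and> T \<subseteq> W1 \<and> X \<subseteq> W1 \<and> invariant \<rho>1 S X \<and>
     fixed \<rho>1 S T = T \<and> has_dim sc1 T n \<and> T \<inter> X = {0} \<and> {t + x | t x. t \<in> T \<and> x \<in> X} = W1 \<and>
     rep_iso sc1 X \<rho>1 sc2 W2 \<rho>2 S"
    using iso unfolding iso_triv_plus_def by (elim exE) (rule that)
  then have T: "subsp sc1 T" "T \<subseteq> W1" "fixed \<rho>1 S T = T" "has_dim sc1 T n"
    and X: "subsp sc1 X" "X \<subseteq> W1" "invariant \<rho>1 S X"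
    and TX: "T \<inter> X = {0}" "{t + x | t x. t \<in> T \<and> x \<in> X} = W1" and r: "rep_iso sc1 X \<rho>1 sc2 W2 \<rho>2 S"
    by simp_all
  from r obtain f where f': "bij_betw f X W2 \<and>
     (\<forall>x\<in>X. \<forall>y\<in>X. f (x + y) = f x + f y) \<and> (\<forall>c. \<forall>x\<in>X. f (sc1 c x) = sc2 c (f x)) \<and>
     (\<forall>g\<in>S. \<forall>x\<in>X. f (\<rho>1 g x) = \<rho>2 g (f x))"
    unfolding rep_iso_def by (elim exE) (rule that)
  then have f: "bij_betw f X W2" "\<forall>x\<in>X. \<forall>y\<in>X. f (x + y) = f x + f y" "\<forall>c. \<forall>x\<in>X. f (sc1 c x) = sc2 c (f x)"
      "\<forall>g\<in>S. \<forall>x\<in>X. f (\<rho>1 g x) = \<rho>2 g (f x)"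
    by simp_all
  have add: "\<rho>1 g (x + y) = \<rho>1 g x + \<rho>1 g y" if "g \<in> J" "x \<in> W1" "y \<in> W1" for g x y
    using lin J that unfolding linear_on_def by blast
  have Tfix: "\<rho>1 g t = t" if "g \<in> J" "t \<in> T" for g t using T(3) J that by (auto simp: fixed_def)
  have sub: "sub (fixed \<rho>1 J X)" using subsp_fixed[OF lin X(1,2) J] X(2) by (auto simp: fixed_def)
  have sum: "fixed \<rho>1 J W1 = ssum T (fixed \<rho>1 J X)"
  proof (intro equalityI subsetI)
    fix w assume w: "w \<in> fixed \<rho>1 J W1"
    then have "w \<in> {t + x | t x. t \<in> T \<and> x \<in> X}" using TX by (simp add: fixed_def)
    then obtain t x where tx: "t \<in> T" "x \<in> X" "w = t + x" by blast
    have "\<rho>1 k x = x" if k: "k \<in> J" for k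
    proof -
      have "\<rho>1 k w = t + \<rho>1 k x" using add[OF k] Tfix[OF k tx(1)] tx T(2) X(2) by (simp add: subset_iff)
      then show ?thesis using w k tx by (simp add: fixed_def)
    qed
    then show "w \<in> ssum T (fixed \<rho>1 J X)" using tx by (auto simp: fixed_def intro: ssumI)
  next
    fix w assume "w \<in> ssum T (fixed \<rho>1 J X)"
    then obtain t x where tx: "t \<in> T" "x \<in> fixed \<rho>1 J X" "w = t + x" by (rule ssumE)
    then show "w \<in> fixed \<rho>1 J W1" using add Tfix T(2) X(2) by (auto simp: fixed_def subset_iff)
  qed
  have int: "T \<inter> fixed \<rho>1 J X = {0}" using TX(1) subspD(1)[OF conjunct1[OF sub]] by (auto simp: fixed_def)
  have bij: "bij_betw f (fixed \<rho>1 J X) (fixed \<rho>2 J W2)"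
  proof (rule bij_betw_subset[OF f(1)])
    show "fixed \<rho>1 J X \<subseteq> X" by (auto simp: fixed_def)
    show "f ` fixed \<rho>1 J X = fixed \<rho>2 J W2"
    proof (intro equalityI subsetI)
      fix y assume "y \<in> f ` fixed \<rho>1 J X"
      then obtain x where x: "x \<in> X" "\<forall>k\<in>J. \<rho>1 k x = x" "y = f x" by (auto simp: fixed_def)
      then have "\<rho>2 k y = y" if "k \<in> J" for k using f(4) J that by force
      then show "y \<in> fixed \<rho>2 J W2" using x f(1) by (auto simp: fixed_def bij_betw_def)
    next
      fix y assume y: "y \<in> fixed \<rho>2 J W2"
      then obtain x where x: "x \<in> X" "y = f x" using f(1) by (auto simp: fixed_def bij_betw_def)
      have "\<rho>1 k x = x" if k: "k \<in> J" for k
      proof -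
        have "f (\<rho>1 k x) = f x" using f(4) J k x y by (auto simp: fixed_def subset_iff)
        moreover have "\<rho>1 k x \<in> X" using X(3) J k x by (auto simp: invariant_def)
        ultimately show ?thesis using f(1) x by (auto simp: bij_betw_def inj_on_def)
      qed
      then show "y \<in> f ` fixed \<rho>1 J X" using x by (auto simp: fixed_def)
    qed
  qed
  have tr: "has_dim sc1 (fixed \<rho>1 J X) d \<longleftrightarrow> has_dim sc2 (fixed \<rho>2 J W2) d" for d
    using sub f by (intro has_dim_transfer[OF vs_axioms _ _ _ _ bij]) (auto simp: fixed_def)
  show one: "has_dim sc1 (fixed \<rho>1 J W1) (n + d)" if "has_dim sc2 (fixed \<rho>2 J W2) d" for d
    unfolding sum using that tr T sub int by (intro has_dim_ssum) auto
  show "\<exists>d. has_dim sc2 (fixed \<rho>2 J W2) d \<and> D = n + d" if D: "has_dim sc1 (fixed \<rho>1 J W1) D"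
  proof -
    have subW: "sub (fixed \<rho>1 J W1)"
      using subsp_fixed[OF lin conjunct1[OF subV] order_refl J] by (auto simp: fixed_def)
    obtain d where d: "has_dim sc1 (fixed \<rho>1 J X) d"
      using has_dim_subspace[OF D subW, of "fixed \<rho>1 J X"] X(2) by (auto simp: fixed_def)
    then have "has_dim sc2 (fixed \<rho>2 J W2) d" using tr by simp
    then show ?thesis using has_dim_unique[OF D one] subW by blast
  qed
qed

lemma virt_eq_on_fixed:
  fixes v :: "'f::field \<Rightarrow> int" and sc :: "'r::field \<Rightarrow> 'v::ab_group_add \<Rightarrow> 'v"
  assumes V: "linear_on sc V \<rho> S" and I: "linear_on fsc (ind_sp v :: ('f mat2 \<Rightarrow> 'r) set) ind_act S"
    and eq: "virt_eq_on sc V \<rho> v a S" and J: "J \<subseteq> S"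
    and N: "has_dim fsc (fixed ind_act J (ind_sp v :: ('f mat2 \<Rightarrow> 'r) set)) N"
  shows "\<exists>d. has_dim sc (fixed \<rho> J V) d \<and> int d = a + int N"
proof (cases "a \<ge> 0")
  case True
  then have "iso_triv_plus sc V \<rho> (nat a) fsc (ind_sp v) ind_act S" using eq by (simp add: virt_eq_on_def)
  from iso_triv_plus_fixed(1)[OF V this J N] True show ?thesis by (intro exI[of _ "nat a + N"]) simp
next
  case False
  then have "iso_triv_plus fsc (ind_sp v) ind_act (nat (- a)) sc V \<rho> S" using eq by (simp add: virt_eq_on_def)
  from iso_triv_plus_fixed(2)[OF I this J N] False show ?thesis by auto
qed

definition eigenspace where
  "eigenspace sc W \<rho> S \<chi> = {w\<in>W. \<forall>k\<in>S. \<rho> k w = sc (\<chi> k) w}"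

definition dim_le_one where
  "dim_le_one sc E \<longleftrightarrow> (\<forall>x\<in>E. \<forall>y\<in>E. \<exists>c d. (c \<noteq> 0 \<or> d \<noteq> 0) \<and> sc c x + sc d y = 0)"

text \<open>A nontrivial character does not occur in the trivial summand, so the unknown integer in
  the virtual identity has no influence on the eigenspace.\<close>

lemma iso_triv_plus_eigenspace:
  assumes lin: "linear_on sc1 W1 \<rho>1 S" and iso: "iso_triv_plus sc1 W1 \<rho>1 n sc2 W2 \<rho>2 S"
    and k0: "k0 \<in> S" "\<chi> k0 \<noteq> 1"
  shows "dim_le_one sc2 (eigenspace sc2 W2 \<rho>2 S \<chi>) \<longleftrightarrow> dim_le_one sc1 (eigenspace sc1 W1 \<rho>1 S \<chi>)"
proof -
  interpret vs sc1 W1 using lin by (simp add: linear_on_def)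
  obtain T X where TX': "subsp sc1 T \<and> subsp sc1 X \<and> T \<subseteq> W1 \<and> X \<subseteq> W1 \<and> invariant \<rho>1 S X \<and>
     fixed \<rho>1 S T = T \<and> has_dim sc1 T n \<and> T \<inter> X = {0} \<and> {t + x | t x. t \<in> T \<and> x \<in> X} = W1 \<and>
     rep_iso sc1 X \<rho>1 sc2 W2 \<rho>2 S"
    using iso unfolding iso_triv_plus_def by (elim exE) (rule that)
  then have T: "subsp sc1 T" "T \<subseteq> W1" "fixed \<rho>1 S T = T"
    and X: "subsp sc1 X" "X \<subseteq> W1" "invariant \<rho>1 S X"
    and TX: "T \<inter> X = {0}" "{t + x | t x. t \<in> T \<and> x \<in> X} = W1" and r: "rep_iso sc1 X \<rho>1 sc2 W2 \<rho>2 S"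
    by simp_all
  from r obtain f where f': "bij_betw f X W2 \<and>
     (\<forall>x\<in>X. \<forall>y\<in>X. f (x + y) = f x + f y) \<and> (\<forall>c. \<forall>x\<in>X. f (sc1 c x) = sc2 c (f x)) \<and>
     (\<forall>g\<in>S. \<forall>x\<in>X. f (\<rho>1 g x) = \<rho>2 g (f x))"
    unfolding rep_iso_def by (elim exE) (rule that)
  then have f: "bij_betw f X W2" "\<forall>x\<in>X. \<forall>y\<in>X. f (x + y) = f x + f y" "\<forall>c. \<forall>x\<in>X. f (sc1 c x) = sc2 c (f x)"
      "\<forall>g\<in>S. \<forall>x\<in>X. f (\<rho>1 g x) = \<rho>2 g (f x)"
    by simp_all
  let ?E1 = "eigenspace sc1 W1 \<rho>1 S \<chi>" and ?E2 = "eigenspace sc2 W2 \<rho>2 S \<chi>"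
  have X0: "0 \<in> X" by (rule subspD(1)[OF X(1)])
  have f0: "f x = 0 \<longleftrightarrow> x = 0" if "x \<in> X" for x
  proof -
    have "f 0 = 0" using f(2) X0 by (metis add_cancel_left_left)
    then show ?thesis using f(1) that X0 unfolding bij_betw_def inj_on_def by metis
  qed
  have E1X: "?E1 \<subseteq> X"
  proof
    fix w assume w: "w \<in> ?E1"
    then have "w \<in> {t + x | t x. t \<in> T \<and> x \<in> X}" using TX by (simp add: eigenspace_def)
    then obtain t x where tx: "t \<in> T" "x \<in> X" "w = t + x" by blast
    have V: "t \<in> W1" "x \<in> W1" using tx T X by auto
    have "\<rho>1 k0 w = \<rho>1 k0 t + \<rho>1 k0 x" using lin k0 V tx(3) unfolding linear_on_def by blast
    also have "\<rho>1 k0 t = t" using T(3) k0 tx by (auto simp: fixed_def)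
    finally have "t + \<rho>1 k0 x = sc1 (\<chi> k0) t + sc1 (\<chi> k0) x"
      using w k0 V tx(3) by (simp add: eigenspace_def sc_add)
    then have e: "sc1 (\<chi> k0 - 1) t = \<rho>1 k0 x - sc1 (\<chi> k0) x"
      using V by (simp add: diff_sc algebra_simps)
    \<comment> \<open>The defect of the \<open>T\<close>-component lies in both \<open>T\<close> and
      \<open>X\<close>, hence is 0, and \<chi>(k0) differs from 1.\<close>
    have "sc1 (\<chi> k0 - 1) t \<in> T" using subspD(3)[OF T(1) tx(1)] .
    moreover have "\<rho>1 k0 x - sc1 (\<chi> k0) x \<in> X"
      using X k0 tx subspD(3)[OF X(1)] by (intro sub_diff) (auto simp: invariant_def)
    ultimately have "sc1 (\<chi> k0 - 1) t \<in> T \<inter> X" using e by simp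
    then have "sc1 (\<chi> k0 - 1) t = 0" using TX(1) by simp
    then have "t = 0" using sc_cancel[OF V(1), of "\<chi> k0 - 1"] k0 by simp
    then show "w \<in> X" using tx by simp
  qed
  have img: "f ` ?E1 = ?E2"
  proof (intro equalityI subsetI)
    fix y assume "y \<in> f ` ?E1"
    then obtain x where x: "x \<in> X" "\<forall>k\<in>S. \<rho>1 k x = sc1 (\<chi> k) x" "y = f x"
      using E1X by (auto simp: eigenspace_def)
    have "\<rho>2 k y = sc2 (\<chi> k) y" if "k \<in> S" for k using f(3,4) x that by metis
    then show "y \<in> ?E2" using x f(1) by (auto simp: eigenspace_def bij_betw_def)
  next
    fix y assume y: "y \<in> ?E2"
    then obtain x where x: "x \<in> X" "y = f x" using f(1) by (auto simp: eigenspace_def bij_betw_def)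
    have "\<rho>1 k x = sc1 (\<chi> k) x" if k: "k \<in> S" for k
    proof -
      have "f (\<rho>1 k x) = f (sc1 (\<chi> k) x)" using f(3,4) k x y by (auto simp: eigenspace_def)
      moreover have "\<rho>1 k x \<in> X" "sc1 (\<chi> k) x \<in> X" using X(3) k x subspD(3)[OF X(1)] by (auto simp: invariant_def)
      ultimately show ?thesis using f(1) by (auto simp: bij_betw_def inj_on_def)
    qed
    then show "y \<in> f ` ?E1" using x X by (auto simp: eigenspace_def)
  qed
  have "sc1 c x + sc1 d y = 0 \<longleftrightarrow> sc2 c (f x) + sc2 d (f y) = 0" if "x \<in> ?E1" "y \<in> ?E1" for x y c d
  proof -
    have "x \<in> X" "y \<in> X" using that E1X by auto
    moreover from this have "sc1 c x \<in> X" "sc1 d y \<in> X" "sc1 c x + sc1 d y \<in> X"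
      using subspD[OF X(1)] by auto
    ultimately show ?thesis using f0[of "sc1 c x + sc1 d y"] f(2,3) by simp
  qed
  then show ?thesis unfolding dim_le_one_def img[symmetric] by simp
qed

lemma fsc_apply [simp]: "fsc c f x = c * f x" by (simp add: fsc_def)

section \<open>Iwahori orbits on the projective line\<close>

context local_field begin

lemma Kc_mono: "1 \<le> i \<Longrightarrow> i \<le> j \<Longrightarrow> Kc v j \<subseteq> Kc v i"
  by (auto simp: Kc_def intro: P_mono)

lemma vs_ind: "vs fsc (ind_sp v :: ('f mat2 \<Rightarrow> 'r::field) set)"
proof
  have "subsp fsc (ind_sp v :: ('f mat2 \<Rightarrow> 'r::field) set)" unfolding subsp_def
  proof (intro conjI ballI allI)
    show "0 \<in> (ind_sp v :: ('f mat2 \<Rightarrow> 'r::field) set)" by (auto simp: ind_sp_def)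
    fix f g :: "'f mat2 \<Rightarrow> 'r" assume f: "f \<in> ind_sp v" and g: "g \<in> ind_sp v"
    obtain i where i: "i \<ge> 1" "\<forall>k\<in>Kc v i. \<forall>x\<in>GL2. f (mmul x k) = f x" using f unfolding ind_sp_def by blast
    obtain j where j: "j \<ge> 1" "\<forall>k\<in>Kc v j. \<forall>x\<in>GL2. g (mmul x k) = g x" using g unfolding ind_sp_def by blast
    have "\<forall>k\<in>Kc v (max i j). \<forall>x\<in>GL2. (f + g) (mmul x k) = (f + g) x"
    proof (intro ballI)
      fix k x :: "'f mat2" assume "k \<in> Kc v (max i j)" "x \<in> GL2"
      then have "f (mmul x k) = f x" "g (mmul x k) = g x"
        using i j Kc_mono[of i "max i j"] Kc_mono[of j "max i j"] by auto
      then show "(f + g) (mmul x k) = (f + g) x" by simp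
    qed
    moreover have "max i j \<ge> 1" using i by simp
    ultimately have "\<exists>j\<ge>1. \<forall>k\<in>Kc v j. \<forall>x\<in>GL2. (f + g) (mmul x k) = (f + g) x" by blast
    then show "f + g \<in> ind_sp v" using f g unfolding ind_sp_def by simp
  next
    fix c :: 'r and f :: "'f mat2 \<Rightarrow> 'r" assume "f \<in> ind_sp v"
    then show "fsc c f \<in> ind_sp v" unfolding ind_sp_def by fastforce
  qed
  then show "vspace fsc (ind_sp v :: ('f mat2 \<Rightarrow> 'r::field) set)"
    unfolding vspace_def by (auto simp: fun_eq_iff algebra_simps)
qed

lemma linear_on_ind: "linear_on fsc (ind_sp v :: ('f mat2 \<Rightarrow> 'r::field) set) ind_act S"
  unfolding linear_on_def using vs_ind by (auto simp: ind_act_def fun_eq_iff)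

text \<open>The quotient of GL2 by the Borel subgroup is the projective line, a coset being given by
  the bottom row up to a scalar.\<close>

lemma Borel_if_row:
  assumes "(a, b, x, y) \<in> GL2" "(a', b', x', y') \<in> GL2" "x' = l * x" "y' = l * y"
  shows "\<exists>B\<in>Borel. (a', b', x', y') = mmul B (a, b, x, y)"
proof -
  let ?g = "(a, b, x, y)" and ?h = "(a', b', x', y')"
  define B where "B = mmul ?h (minv ?g)"
  have B: "?h = mmul B ?g" using assms by (simp only: B_def mmul_assoc mmul_minv mmul_mone)
  obtain p r s t where prst: "B = (p, r, s, t)" by (cases B)
  have "B \<in> GL2" using assms by (simp only: B_def GL2_mmul GL2_minv)
  moreover have "s = 0"
  proof -
    define D where "D = a * y - b * x"
    \<comment> \<open>Up to the factor 1/D the entry \<open>s\<close> is the determinant formed by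
      the two bottom rows, which are proportional.\<close>
    have "s = x' * (y / D) + y' * (- x / D)" using prst unfolding B_def by (simp add: D_def)
    then show ?thesis using assms(3,4) by (simp add: mult.commute mult.left_commute)
  qed
  ultimately have "B \<in> Borel" using prst by (auto simp: Borel_def GL2_def)
  with B show ?thesis by blast
qed

lemma ind_row_invariant:
  assumes "f \<in> ind_sp v" "(a, b, x, y) \<in> GL2" "(a', b', x', y') \<in> GL2" "x' = l * x" "y' = l * y"
  shows "f (a', b', x', y') = f (a, b, x, y)"
proof -
  obtain B where "B \<in> Borel" "(a', b', x', y') = mmul B (a, b, x, y)" using Borel_if_row[OF assms(2-5)] by blast
  then show ?thesis using assms(1,2) unfolding ind_sp_def by simp
qed

lemma Iw_iff: "(a, b, c, d) \<in> Iw v n \<longleftrightarrow> a - 1 \<in> P (int ((n + 1) div 2)) \<and> d - 1 \<in> P (int ((n + 1) div 2)) \<and>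
   b \<in> P (int (n div 2)) \<and> c \<in> P (int (n div 2) + 1) \<and> (a, b, c, d) \<in> GL2"
  by (auto simp: Iw_def)

text \<open>\<open>Inl z\<close> and \<open>Inr z\<close> stand for the neighbourhoods of \<open>[1:z]\<close> and \<open>[z:1]\<close> in the projective
  line of bottom rows, which are the orbits of the \<open>n\<close>-th Iwahori subgroup (with \<open>k = n div 2\<close>).\<close>
fun near :: "int \<Rightarrow> 'f mat2 \<Rightarrow> 'f + 'f \<Rightarrow> bool" where
  "near k (a, b, x, y) (Inl z) \<longleftrightarrow> x \<noteq> 0 \<and> y / x - z \<in> P k"
| "near k (a, b, x, y) (Inr z) \<longleftrightarrow> y \<noteq> 0 \<and> x / y - z \<in> P (k + 1)"

fun orep :: "'f + 'f \<Rightarrow> 'f mat2" where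
  "orep (Inl z) = (0, -1, 1, z)"
| "orep (Inr z) = (1, 0, z, 1)"

definition orbs :: "int \<Rightarrow> ('f + 'f) set" where "orbs k = Inl ` Rp 0 k \<union> Inr ` Rp 1 (k + 1)"

lemma orep_SL2 [simp]: "orep i \<in> SL2"
  by (cases i) (auto simp: SL2_def)

lemma finite_orbs: "k \<ge> 0 \<Longrightarrow> finite (orbs k)"
  by (simp add: orbs_def RpD(1))

lemma card_orbs: "k \<ge> 0 \<Longrightarrow> card (orbs k) = 2 * q ^ nat k"
  unfolding orbs_def by (subst card_Un_disjoint) (auto simp: RpD(1) card_image Rp(2))

lemma near_ex:
  assumes "g \<in> GL2" "k \<ge> 0"
  shows "\<exists>i\<in>orbs k. near k g i"
proof -
  obtain a b x y where g: "g = (a, b, x, y)" by (cases g)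
  have nz: "x \<noteq> 0 \<or> y \<noteq> 0" using assms by (auto simp: g GL2_def)
  show ?thesis
  proof (cases "x \<noteq> 0 \<and> y / x \<in> P 0")
    case True
    then obtain r where "r \<in> Rp 0 k" "y / x - r \<in> P k" using RpD(3)[of 0 k "y / x"] assms by auto
    then show ?thesis using True by (intro bexI[of _ "Inl r"]) (auto simp: g orbs_def)
  next
    case False
    have y: "y \<noteq> 0" using False nz by auto
    have "x / y \<in> P 1"
    proof (cases "x = 0")
      case x: False
      then have "v y - v x < 0" using False y by (simp add: P_v v_divide)
      then show ?thesis using x y by (simp add: P_v v_divide)
    qed simp
    then obtain r where "r \<in> Rp 1 (k + 1)" "x / y - r \<in> P (k + 1)" using RpD(3)[of 1 "k + 1" "x / y"] assms by auto
    then show ?thesis using y by (intro bexI[of _ "Inr r"]) (auto simp: g orbs_def)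
  qed
qed

lemma near_P:
  assumes "i \<in> orbs k" "near k (a, b, x, y) i" "k \<ge> 0"
  shows "i = Inl z \<Longrightarrow> y / x \<in> P 0" "i = Inr z \<Longrightarrow> x / y \<in> P 1"
proof -
  show "y / x \<in> P 0" if "i = Inl z"
  proof -
    have "z \<in> P 0" "y / x - z \<in> P 0" using assms that RpD(2)[of 0 k z] P_mono[of "y/x - z" k 0] by (auto simp: orbs_def)
    then show ?thesis using P_add[of "y / x - z" 0 z] by simp
  qed
  show "x / y \<in> P 1" if "i = Inr z"
  proof -
    have "z \<in> P 1" "x / y - z \<in> P 1"
      using assms that RpD(2)[of 1 "k + 1" z] P_mono[of "x/y - z" "k + 1" 1] by (auto simp: orbs_def)
    then show ?thesis using P_add[of "x / y - z" 1 z] by simp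
  qed
qed

lemma near_unique:
  assumes "i \<in> orbs k" "near k g i" "j \<in> orbs k" "near k g j" "k \<ge> 0"
  shows "i = j"
proof -
  obtain a b x y where g: "g = (a, b, x, y)" by (cases g)
  have mixed: False if "Inl z \<in> orbs k" "near k g (Inl z)" "Inr w \<in> orbs k" "near k g (Inr w)" for z w
  proof -
    have "y / x \<in> P 0" "x / y \<in> P 1" using near_P that assms(5) by (auto simp: g)
    moreover have "x \<noteq> 0" "y \<noteq> 0" using that by (auto simp: g)
    ultimately show False by (simp add: P_v v_divide)
  qed
  show ?thesis
  proof (cases i; cases j)
    fix z w assume ij: "i = Inl z" "j = Inl w"
    have "(y / x - w) - (y / x - z) \<in> P k" using assms ij by (intro P_diff[of "y/x - w" _ "y/x - z"]) (auto simp: g)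
    then show ?thesis using RpD(4)[of 0 k z w] assms ij by (auto simp: orbs_def)
  next
    fix z w assume ij: "i = Inr z" "j = Inr w"
    have "(x / y - w) - (x / y - z) \<in> P (k + 1)" using assms ij by (intro P_diff[of "x/y - w" _ "x/y - z"]) (auto simp: g)
    then show ?thesis using RpD(4)[of 1 "k + 1" z w] assms ij by (auto simp: orbs_def)
  qed (use assms mixed in auto)
qed

text \<open>In the affine coordinate w the group acts by a fractional linear map whose denominator u
  is a unit congruent to 1. It remains to see that the image differs from w by an element of the
  required power of P.\<close>

lemma near_Iw:
  assumes "i \<in> orbs (int (n div 2))" "near (int (n div 2)) g i" "\<kappa> \<in> Iw v n" "n \<ge> 1"
  shows "near (int (n div 2)) (mmul g \<kappa>) i"
proof -
  define k where "k = int (n div 2)"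
  define l where "l = int ((n + 1) div 2)"
  have k: "k \<ge> 0" and l: "l \<ge> 1" "l \<ge> k" using assms(4) by (auto simp: k_def l_def)
  obtain a0 b0 x y where g: "g = (a0, b0, x, y)" by (cases g)
  obtain a b c d where \<kappa>: "\<kappa> = (a, b, c, d)" by (cases \<kappa>)
  have I: "a - 1 \<in> P l" "d - 1 \<in> P l" "b \<in> P k" "c \<in> P (k + 1)"
    using assms(3) by (auto simp: \<kappa> Iw_iff k_def l_def)
  have ad: "a - d \<in> P l" using P_diff[OF I(1,2)] by simp
  note i = assms(1,2)[folded k_def]
  show ?thesis
  proof (cases i)
    case (Inl z)
    define w where "w = y / x"
    have x: "x \<noteq> 0" and wz: "w - z \<in> P k" using i(2) by (auto simp: Inl g w_def)
    have w: "w \<in> P 0" using near_P(1)[OF i(1) i(2)[unfolded g] k Inl] by (simp add: w_def)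
    have y: "y = w * x" using x by (simp add: w_def)
    define u where "u = a + w * c"
    have "w * c \<in> P 1" by (rule P_mult_le[OF w I(4)]) (use k in simp)
    then have "(a - 1) + w * c \<in> P 1" using P_mono[OF I(1) l(1)] by (intro P_add)
    then have "u - 1 \<in> P 1" by (simp add: u_def algebra_simps)
    note u = one_unit[OF this order_refl]
    \<comment> \<open>This is u times the displacement of w, the numerator of (b + w d)/(a + w c) -
      w.\<close>
    have "b - w * (a - d) - w * (w * c) \<in> P k"
      by (rule P_diff[OF P_diff[OF I(3) P_mult_le[OF w ad]] P_mult_le[OF w P_mult[OF w I(4)]]]) (use k l in auto)
    then have "(b - w * (a - d) - w * (w * c)) / u \<in> P k" using u by (simp add: P_divide_iff)
    moreover have "(b - w * (a - d) - w * (w * c)) / u = (b + w * d) / u - w"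
      using u(1) by (simp add: field_simps) (simp add: u_def algebra_simps)
    ultimately have "(b + w * d) / u - w + (w - z) \<in> P k" using wz P_add by metis
    moreover have "x * a + y * c = x * u" "x * b + y * d = x * (b + w * d)" by (simp_all add: y u_def algebra_simps)
    ultimately show ?thesis using x u by (simp add: g \<kappa> Inl k_def[symmetric])
  next
    case (Inr z)
    define w where "w = x / y"
    have y: "y \<noteq> 0" and wz: "w - z \<in> P (k + 1)" using i(2) by (auto simp: Inr g w_def)
    have w: "w \<in> P 1" using near_P(2)[OF i(1) i(2)[unfolded g] k Inr] by (simp add: w_def)
    have x: "x = w * y" using y by (simp add: w_def)
    define u where "u = w * b + d"
    have "w * b \<in> P 1" by (rule P_mult_le[OF w I(3)]) (use k in simp)
    then have "(d - 1) + w * b \<in> P 1" using P_mono[OF I(2) l(1)] by (intro P_add)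
    then have "u - 1 \<in> P 1" by (simp add: u_def algebra_simps)
    note u = one_unit[OF this order_refl]
    \<comment> \<open>The same numerator in the coordinate around the other point, where w lies in
      P^1.\<close>
    have "c + w * (a - d) - w * (w * b) \<in> P (k + 1)"
      by (rule P_diff[OF P_add[OF I(4) P_mult_le[OF w ad]] P_mult_le[OF w P_mult[OF w I(3)]]]) (use k l in auto)
    then have "(c + w * (a - d) - w * (w * b)) / u \<in> P (k + 1)" using u by (simp add: P_divide_iff)
    moreover have "(c + w * (a - d) - w * (w * b)) / u = (w * a + c) / u - w"
      using u(1) by (simp add: field_simps) (simp add: u_def algebra_simps)
    ultimately have "(w * a + c) / u - w + (w - z) \<in> P (k + 1)" using wz P_add by metis
    moreover have "x * a + y * c = y * (w * a + c)" "x * b + y * d = y * u" by (simp_all add: x u_def algebra_simps)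
    ultimately show ?thesis using y u by (simp add: g \<kappa> Inr k_def[symmetric])
  qed
qed

lemma near_orep: "near k (orep i) i"
  by (cases i) auto

text \<open>Within one neighbourhood the unipotent subgroup of the Iwahori group already acts
  transitively, so each neighbourhood is a single orbit and not merely a stable set.\<close>

lemma near_decomp:
  assumes "near (int (n div 2)) g i" "g \<in> GL2" "n \<ge> 1"
  shows "\<exists>B\<in>Borel. \<exists>\<kappa>\<in>Iw v n \<inter> SL2. g = mmul B (mmul (orep i) \<kappa>)"
proof -
  obtain a b x y where g: "g = (a, b, x, y)" by (cases g)
  show ?thesis
  proof (cases i)
    case (Inl z)
    then have x: "x \<noteq> 0" and w: "y / x - z \<in> P (int (n div 2))" using assms by (auto simp: g)
    have e: "mmul (orep i) (uu (y / x - z)) = (0, -1, 1, y / x)" by (simp add: Inl)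
    have "\<exists>B\<in>Borel. (a, b, x, y) = mmul B (0, -1, 1, y / x)"
      using assms(2) x by (intro Borel_if_row[where l = x]) (auto simp: g GL2_def)
    moreover have "uu (y / x - z) \<in> Iw v n \<inter> SL2" using w by (auto simp: Iw_iff)
    ultimately show ?thesis using e g by metis
  next
    case (Inr z)
    then have y: "y \<noteq> 0" and w: "x / y - z \<in> P (int (n div 2) + 1)" using assms by (auto simp: g)
    have e: "mmul (orep i) (ll (x / y - z)) = (1, 0, x / y, 1)" by (simp add: Inr)
    have "\<exists>B\<in>Borel. (a, b, x, y) = mmul B (1, 0, x / y, 1)"
      using assms(2) y by (intro Borel_if_row[where l = y]) (auto simp: g GL2_def)
    moreover have "ll (x / y - z) \<in> Iw v n \<inter> SL2" using w by (auto simp: Iw_iff)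
    ultimately show ?thesis using e g by metis
  qed
qed

text \<open>A fixed function is a function on the finite set of orbits. The indicators
  \<open>\<delta>\<close> form a basis, evaluation at the \<open>orep\<close> being the dual
  basis.\<close>

lemma dim_ind_fixed:
  assumes "n \<ge> 1"
  shows "has_dim fsc (fixed ind_act (Iw v n \<inter> SL2) (ind_sp v :: ('f mat2 \<Rightarrow> 'r::field) set)) (2 * q ^ (n div 2))"
proof -
  interpret I: vs fsc "ind_sp v :: ('f mat2 \<Rightarrow> 'r) set" by (rule vs_ind)
  define k where "k = int (n div 2)"
  have k: "k \<ge> 0" by (simp add: k_def)
  let ?J = "Iw v n \<inter> SL2"
  define N where "N = card (orbs k)"
  have N: "N = 2 * q ^ (n div 2)" using card_orbs[OF k] by (simp add: N_def k_def)
  obtain e where e: "bij_betw e {..<N} (orbs k)"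
    using ex_bij_betw_nat_finite[OF finite_orbs[OF k]] by (auto simp: N_def atLeast0LessThan)
  define \<delta> :: "'f + 'f \<Rightarrow> 'f mat2 \<Rightarrow> 'r" where "\<delta> i g = (if g \<in> GL2 \<and> near k g i then 1 else 0)" for i g
  have eI: "e i \<in> orbs k" if "i < N" for i using e that by (auto simp: bij_betw_def)
  have \<delta>Iw: "\<delta> i (mmul g \<kappa>) = \<delta> i g" if h: "i \<in> orbs k" "g \<in> GL2" "\<kappa> \<in> Iw v n" for i g \<kappa>
  proof -
    have \<kappa>: "\<kappa> \<in> GL2" using that by (auto simp: Iw_def)
    have "near k (mmul g \<kappa>) i \<longleftrightarrow> near k g i"
    \<comment> \<open>Only stability of neighbourhoods is known. For the converse implication, g
      lies near some j; then so does its translate, and uniqueness gives j = i.\<close>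
    proof
      assume 1: "near k (mmul g \<kappa>) i"
      obtain j where j: "j \<in> orbs k" "near k g j" using near_ex[OF h(2) k] by blast
      have "near k (mmul g \<kappa>) j" using near_Iw[of j n g \<kappa>] j that assms by (simp add: k_def)
      then show "near k g i" using near_unique[OF that(1) 1 j(1) _ k] j by simp
    qed (use near_Iw[of i n g \<kappa>] that assms in \<open>simp add: k_def\<close>)
    then show ?thesis using that \<kappa> by (simp add: \<delta>_def)
  qed
  have \<delta>B: "\<delta> i (mmul B g) = \<delta> i g" if "B \<in> Borel" "g \<in> GL2" for B g i
  proof -
    obtain p r t where B: "B = (p, r, 0, t)" "p \<noteq> 0" "t \<noteq> 0"
      using \<open>B \<in> Borel\<close> by (auto simp: Borel_def)
    have "B \<in> GL2" using B by (simp add: GL2_def)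
    moreover have "near k (mmul B g) i \<longleftrightarrow> near k g i" using B by (cases g; cases i) auto
    ultimately show ?thesis using that by (simp add: \<delta>_def)
  qed
  have KcIw: "Kc v (Suc n) \<subseteq> Iw v n"
  proof
    fix \<kappa> :: "'f mat2" assume K: "\<kappa> \<in> Kc v (Suc n)"
    obtain a b c d where \<kappa>: "\<kappa> = (a, b, c, d)" by (cases \<kappa>)
    have "x \<in> P m" if "x \<in> P (int (Suc n))" "m \<le> int (Suc n)" for x m using P_mono that by blast
    then show "\<kappa> \<in> Iw v n" using K by (simp add: \<kappa> Iw_iff Kc_def)
  qed
  have \<delta>ind: "\<delta> i \<in> ind_sp v" if "i \<in> orbs k" for i
  proof -
    have "\<forall>\<kappa>\<in>Kc v (Suc n). \<forall>g\<in>GL2. \<delta> i (mmul g \<kappa>) = \<delta> i g" using KcIw \<delta>Iw that by blast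
    then have "\<exists>j\<ge>1. \<forall>\<kappa>\<in>Kc v j. \<forall>g\<in>GL2. \<delta> i (mmul g \<kappa>) = \<delta> i g" by (intro exI[of _ "Suc n"]) simp
    then show ?thesis using \<delta>B by (auto simp: ind_sp_def \<delta>_def)
  qed
  have \<delta>fix: "\<delta> i \<in> fixed ind_act ?J (ind_sp v)" if "i \<in> orbs k" for i
  proof -
    have "ind_act \<kappa> (\<delta> i) = \<delta> i" if \<kappa>: "\<kappa> \<in> ?J" for \<kappa>
    proof
      fix g
      show "ind_act \<kappa> (\<delta> i) g = \<delta> i g"
      proof (cases "g \<in> GL2")
        case True
        then show ?thesis using \<delta>Iw[OF \<open>i \<in> orbs k\<close>] \<kappa> by (simp add: ind_act_def)
      qed (simp add: ind_act_def \<delta>_def)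
    qed
    then show ?thesis using \<delta>ind that by (simp add: fixed_def)
  qed
  have \<delta>orep: "\<delta> i (orep j) = (if i = j then 1 else 0)" if "i \<in> orbs k" "j \<in> orbs k" for i j
    using near_unique[OF that(1) _ that(2) near_orep k] near_orep by (auto simp: \<delta>_def)
  have eval: "(\<Sum>i<N. fsc (c i) (\<delta> (e i))) g = (\<Sum>i<N. c i * \<delta> (e i) g)" for c g
    by (induction N) auto
  have at: "(\<Sum>i<N. c i * \<delta> (e i) (orep (e j))) = c j" if "j < N" for c j
  proof -
    have "(\<Sum>i<N. c i * \<delta> (e i) (orep (e j))) = (\<Sum>i<N. if i = j then c i else 0)"
      using e that eI by (intro sum.cong refl) (auto simp: \<delta>orep bij_betw_def inj_on_def)
    then show ?thesis using that by simp
  qed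
  have "indep_mod fsc {0} N (\<lambda>i. \<delta> (e i))" unfolding indep_mod_def
  proof (intro allI impI)
    fix c :: "nat \<Rightarrow> 'r" and j assume "(\<Sum>i<N. fsc (c i) (\<delta> (e i))) \<in> {0}" and j: "j < N"
    then have "(\<Sum>i<N. fsc (c i) (\<delta> (e i))) (orep (e j)) = 0" by simp
    then show "c j = 0" using eval at j by simp
  qed
  then have "has_dim fsc (spanned fsc N (\<lambda>i. \<delta> (e i))) N"
    using \<delta>ind eI by (intro I.has_dim_if_basis) auto
  moreover have "spanned fsc N (\<lambda>i. \<delta> (e i)) = fixed ind_act ?J (ind_sp v)"
  proof (intro equalityI subsetI)
    fix f assume "f \<in> spanned fsc N (\<lambda>i. \<delta> (e i))"
    then obtain c where f: "f = (\<Sum>i<N. fsc (c i) (\<delta> (e i)))" by (auto simp: spanned_def)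
    have S: "subsp fsc (fixed ind_act ?J (ind_sp v :: ('f mat2 \<Rightarrow> 'r) set))"
      using subsp_fixed[OF linear_on_ind[of ?J] conjunct1[OF I.subV] order_refl order_refl] .
    show "f \<in> fixed ind_act ?J (ind_sp v)" unfolding f using \<delta>fix eI
      by (intro subsp_sum[OF S] subspD(3)[OF S]) simp
  next
    fix f :: "'f mat2 \<Rightarrow> 'r" assume f: "f \<in> fixed ind_act ?J (ind_sp v)"
    then have fi: "f \<in> ind_sp v" by (simp add: fixed_def)
    have "f g = (\<Sum>i<N. fsc (f (orep (e i))) (\<delta> (e i))) g" for g
    proof (cases "g \<in> GL2")
      case False
      have "f g = 0" using fi False unfolding ind_sp_def by blast
      then show ?thesis using False unfolding eval by (simp add: \<delta>_def)
    next
      case True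
      obtain i where i: "i \<in> orbs k" "near k g i" using near_ex[OF True k] by blast
      then obtain j where j: "j < N" "i = e j" using e by (auto simp: bij_betw_def)
      obtain B \<kappa> where B: "B \<in> Borel" "\<kappa> \<in> ?J" "g = mmul B (mmul (orep i) \<kappa>)"
        using near_decomp[of n g i] i True assms by (auto simp: k_def)
      have or: "orep i \<in> GL2" "\<kappa> \<in> GL2" using B by (auto intro: SL2_GL2)
      have "ind_act \<kappa> f = f" using f B by (simp add: fixed_def)
      from fun_cong[OF this, of "orep i"] have "f (orep i) = f (mmul (orep i) \<kappa>)"
        using or by (simp add: ind_act_def del: orep.simps)
      also have "\<dots> = f g"
      proof -
        have "\<forall>b\<in>Borel. \<forall>h\<in>GL2. f (mmul b h) = f h" using fi unfolding ind_sp_def by blast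
        then show ?thesis using B or by simp
      qed
      finally have fg: "f g = f (orep (e j))" using j by simp
      have "\<delta> (e l) g = (if l = j then 1 else 0)" if "l < N" for l
      proof -
        have "near k g (e l) \<longleftrightarrow> l = j"
        proof
          assume "near k g (e l)"
          then have "e l = e j" using near_unique[OF eI[OF that] _ i k] j by simp
          then show "l = j" using e that j unfolding bij_betw_def inj_on_def by simp
        qed (use i j in simp)
        then show ?thesis using True by (simp add: \<delta>_def)
      qed
      then have "(\<Sum>l<N. f (orep (e l)) * \<delta> (e l) g) = (\<Sum>l<N. if l = j then f (orep (e l)) else 0)"
        by (intro sum.cong refl) simp
      then show ?thesis unfolding eval fg using j by simp
    qed
    then have "f = (\<Sum>i<N. fsc (f (orep (e i))) (\<delta> (e i)))" by (rule ext)
    then show "f \<in> spanned fsc N (\<lambda>i. \<delta> (e i))" unfolding spanned_def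
      by (intro CollectI exI[of _ "\<lambda>i. f (orep (e i))"] conjI TrueI)
  qed
  ultimately show ?thesis using N by simp
qed

\<comment> \<open>Uniqueness of deep eigenvectors\<close>
end

context char_field begin

text \<open>A character of \<open>Iw v (2 * n + 1)\<close>: modulo P^(2n+1) the upper right entry of
  a product is the sum of the upper right entries, and \<open>pw (- 2 * int n)\<close> moves
  P^(2n+1) into P^1, where \<psi> is trivial.\<close>

definition chi :: "nat \<Rightarrow> 'f mat2 \<Rightarrow> 'r" where
  "chi n k = (case k of (a, b, c, d) \<Rightarrow> \<psi> (pw (- 2 * int n) * b))"

lemma chi_nontrivial: obtains b where "b \<in> P (2 * int n)" "uu b \<in> Iw v (2 * n + 1)" "\<psi> (pw (- 2 * int n) * b) \<noteq> 1"
proof -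
  obtain b where b: "b \<in> P (2 * int n)" "\<psi> (pw (- 2 * int n) * b) \<noteq> 1"
    using psi_P_nontriv[of "pw (- 2 * int n)" "2 * int n"] by auto
  then have "uu b \<in> Iw v (2 * n + 1)" using P_mono[of b "2 * int n" "int n"] by (simp add: Iw_iff)
  then show ?thesis using that b by blast
qed

text \<open>Only the orbit of \<open>[1:0]\<close> supports a \<open>chi\<close>-eigenfunction, because \<open>chi\<close> is nontrivial
  on the stabiliser of every other point.\<close>
lemma ind_eigenspace:
  "dim_le_one fsc (eigenspace fsc (ind_sp v) ind_act (Iw v (2 * n + 1)) (chi n))"
proof -
  let ?E = "eigenspace fsc (ind_sp v) ind_act (Iw v (2 * n + 1)) (chi n)"
  define t where "t = pw (- 2 * int n)"
  have act: "f (mmul g k) = chi n k * f g" if "f \<in> ?E" "k \<in> Iw v (2 * n + 1)" "g \<in> GL2" for f k g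
  proof -
    have "ind_act k f g = fsc (chi n k) f g" using that by (simp add: eigenspace_def)
    then show ?thesis using that by (simp add: ind_act_def)
  qed
  obtain b0 where b0: "b0 \<in> P (2 * int n)" "uu b0 \<in> Iw v (2 * n + 1)" "\<psi> (t * b0) \<noteq> 1"
    using chi_nontrivial[of n] unfolding t_def by blast
  have main: "f g = 0" if f: "f \<in> ?E" and f0: "f (0, -1, 1, 0) = 0" and gG: "g \<in> GL2" for f g
  proof -
    have fi: "f \<in> ind_sp v" using f by (simp add: eigenspace_def)
    obtain a b x y where g: "g = (a, b, x, y)" by (cases g)
    have det: "a * y - b * x \<noteq> 0" using gG by (simp add: g GL2_def)
    \<comment> \<open>If an upper triangular element of the group fixes the point [x:y], then f
      takes the same value at g before and after the translation, whereas the eigenproperty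
      multiplies it by \<psi>(t b0), which is not 1.\<close>
    have kill: "f g = 0" if k: "(p, b0, 0, 1) \<in> Iw v (2 * n + 1)" "x * b0 + y = p * y" for p
    proof -
      have kG: "(p, b0, 0, 1) \<in> GL2" using k by (simp add: Iw_def)
      have "mmul g (p, b0, 0, 1) = (a * p, a * b0 + b, x * p, x * b0 + y)" by (simp add: g)
      moreover have "mmul g (p, b0, 0, 1) \<in> GL2" using gG kG by (rule GL2_mmul)
      ultimately have "f (mmul g (p, b0, 0, 1)) = f g"
        using gG k unfolding g by (auto intro!: ind_row_invariant[OF fi, where l = p])
      then have "(\<psi> (t * b0) - 1) * f g = 0" using act[OF f k(1) gG] by (simp add: chi_def t_def algebra_simps)
      then show ?thesis using b0 by simp
    qed
    consider "x = 0" | "x \<noteq> 0" "y / x \<in> P (int n)" | "x \<noteq> 0" "y / x \<notin> P (int n)" by blast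
    then show ?thesis
    proof cases
      case 1
      then show ?thesis using kill[of 1] b0 by simp
    next
      case 2
      let ?r = "(0, -1, 1, 0) :: 'f mat2"
      have r: "?r \<in> GL2" by (simp add: GL2_def)
      have "uu (y / x) \<in> Iw v (2 * n + 1)" using 2 by (simp add: Iw_iff)
      then have "f (mmul ?r (uu (y / x))) = 0" using act[OF f _ r] f0 by (simp del: mmul.simps)
      then have "f (0, -1, 1, y / x) = 0" by simp
      moreover have "f (a, b, x, y) = f (0, -1, 1, y / x)"
        using 2 det by (intro ind_row_invariant[OF fi, where l = x]) (auto simp: GL2_def)
      ultimately show ?thesis by (simp add: g)
    next
      case 3
      define z where "z = y / x"
      have z: "z \<noteq> 0" "v z < int n" using 3 by (auto simp: z_def vpow_def)
      \<comment> \<open>Here \<open>b0\<close> in P^(2n) matters: v z is at most n - 1, so b0/z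
        reaches P^(n+1), the level required of diagonal entries.\<close>
      have "b0 \<in> P (int n + 1 + v z)" by (rule P_mono[OF b0(1)]) (use z in simp)
      then have p: "b0 / z \<in> P (int n + 1)" using z by (simp add: P_divide_iff)
      \<comment> \<open>The solution of x b0 + y = p y, which makes (x, y) an eigenrow.\<close>
      define p where "p = 1 + b0 / z"
      have p1: "p - 1 \<in> P (int n + 1)" using p by (simp add: p_def)
      then have "p \<noteq> 0" using one_unit(1)[of p "int n + 1"] by simp
      then have I: "(p, b0, 0, 1) \<in> Iw v (2 * n + 1)"
        using p1 P_mono[OF b0(1), of "int n"] by (simp add: Iw_iff GL2_def add.commute)
      have "x * b0 + y = p * y" using z 3 by (simp add: p_def z_def field_simps)
      then show ?thesis using kill I by blast
    qed
  qed
  have outside: "f g = 0" if "f \<in> ?E" "g \<notin> GL2" for f g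
    using that unfolding eigenspace_def ind_sp_def by blast
  show ?thesis unfolding dim_le_one_def
  proof (intro ballI)
    fix f h assume fh: "f \<in> ?E" "h \<in> ?E"
    define r :: "'f mat2" where "r = (0, -1, 1, 0)"
    interpret I: vs fsc "ind_sp v :: ('f mat2 \<Rightarrow> 'r) set" by (rule vs_ind)
    show "\<exists>c d. (c \<noteq> 0 \<or> d \<noteq> 0) \<and> fsc c f + fsc d h = 0"
    proof (cases "f r = 0")
      case True
      have "f g = 0" for g using main[OF fh(1)] True outside[OF fh(1)]
        by (cases "g \<in> GL2") (simp_all add: r_def)
      then have "fsc 1 f + fsc 0 h = 0" by (simp add: fun_eq_iff)
      then show ?thesis by (intro exI[of _ 1] exI[of _ 0]) simp
    next
      case False
      \<comment> \<open>The combination that vanishes at \<open>r\<close>, and therefore everywhere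
        by \<open>main\<close>.\<close>
      let ?w = "fsc (h r) f + fsc (- f r) h"
      have "?w \<in> ?E"
      proof -
        have "?w \<in> ind_sp v" using fh by (intro I.V_add I.V_sc) (auto simp: eigenspace_def)
        moreover have "ind_act k ?w = fsc (chi n k) ?w" if k: "k \<in> Iw v (2 * n + 1)" for k
        proof
          fix g
          show "ind_act k ?w g = fsc (chi n k) ?w g"
          proof (cases "g \<in> GL2")
            case True
            then show ?thesis using act[OF fh(1) k] act[OF fh(2) k] by (simp add: ind_act_def algebra_simps)
          next
            case False
            then have "f g = 0" "h g = 0" using fh outside by blast+
            then show ?thesis using False by (simp add: ind_act_def)
          qed
        qed
        ultimately show ?thesis by (simp add: eigenspace_def)
      qed
      moreover have "?w (0, -1, 1, 0) = 0" by (simp add: r_def)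
      ultimately have "?w g = 0" for g using main[of ?w g] outside[of ?w g]
        by (cases "g \<in> GL2") blast+
      then have "?w = 0" by (simp add: fun_eq_iff)
      then show ?thesis using False by (intro exI[of _ "h r"] exI[of _ "- f r"]) simp
    qed
  qed
qed

end

locale gl2germ = gl2rep v q \<psi> sc V \<rho>
  for v :: "'f::field \<Rightarrow> int" and q and \<psi> :: "'f \<Rightarrow> 'r::field"
    and sc :: "'r \<Rightarrow> 'v::ab_group_add \<Rightarrow> 'v" and V :: "'v set" and \<rho> +
  fixes a :: int
  assumes germ: "\<exists>N. \<forall>j\<ge>N. virt_eq_on sc V \<rho> v a (Iw v j)"
begin

lemma linear_on_V: "S \<subseteq> GL2 \<Longrightarrow> linear_on sc V \<rho> S"
  unfolding linear_on_def using vs_axioms by (auto simp: rho_add rho_sc subset_iff)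

lemma dim_V_fixed: "\<exists>N. \<forall>n\<ge>N. \<exists>d. has_dim sc (fixed \<rho> (Iw v n \<inter> SL2) V) d \<and> int d = a + 2 * int q ^ (n div 2)"
proof -
  obtain N where N: "\<forall>j\<ge>N. virt_eq_on sc V \<rho> v a (Iw v j)" using germ by blast
  have "\<exists>d. has_dim sc (fixed \<rho> (Iw v n \<inter> SL2) V) d \<and> int d = a + int (2 * q ^ (n div 2))"
    if "n \<ge> max N 1" for n
    using that N by (intro virt_eq_on_fixed[where S = "Iw v n" and v = v] linear_on_V linear_on_ind dim_ind_fixed)
      (auto simp: Iw_def)
  then show ?thesis by (intro exI[of _ "max N 1"]) auto
qed

text \<open>Multiplicity one for deep eigenvectors. Undoing the diagonal conjugation turns them into
  \<open>chi n\<close>-eigenvectors of \<open>Iw v (2 * n + 1)\<close>, a group on which V agrees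
  with the induced representation for large n.\<close>

lemma eigv_dependent:
  "\<exists>N. \<forall>n\<ge>N. \<forall>x y. eigv (int n) x \<longrightarrow> eigv (int n) y \<longrightarrow> (\<exists>c d. (c \<noteq> 0 \<or> d \<noteq> 0) \<and> sc c x + sc d y = 0)"
proof -
  obtain N where N: "\<forall>j\<ge>N. virt_eq_on sc V \<rho> v a (Iw v j)" using germ by blast
  have "\<exists>c d. (c \<noteq> 0 \<or> d \<noteq> 0) \<and> sc c x + sc d y = 0"
    if n: "n \<ge> N" and xy: "eigv (int n) x" "eigv (int n) y" for n x y
  proof -
    let ?S = "Iw v (2 * n + 1)"
    let ?E = "eigenspace sc V \<rho> ?S (chi n)"
    define s where "s = pw (- 2 * int n)"
    have s: "s \<noteq> 0" "v s = - 2 * int n" by (simp_all add: s_def)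
    have lin: "linear_on sc V \<rho> ?S" by (rule linear_on_V) (auto simp: Iw_def)
    obtain b0 where b0: "uu b0 \<in> ?S" "chi n (uu b0) \<noteq> 1" using chi_nontrivial[of n] by (auto simp: chi_def)
    have "virt_eq_on sc V \<rho> v a ?S" using N n by simp
    \<comment> \<open>For nonnegative \<open>a\<close> the induced representation sits inside V,
      otherwise V sits inside it; eigenvectors for a nontrivial character do not see the
      difference.\<close>
    then have E: "dim_le_one sc ?E"
      using ind_eigenspace[of n] iso_triv_plus_eigenspace[where \<chi> = "chi n", OF lin _ b0]
        iso_triv_plus_eigenspace[where \<chi> = "chi n", OF linear_on_ind _ b0]
      unfolding virt_eq_on_def by (auto split: if_splits)
    have inE: "\<rho> (dg (1/s) 1) w \<in> ?E" if w: "eigv (int n) w" for w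
    proof -
      have wV: "w \<in> V" using w by (simp add: eigv_def)
      have "\<rho> k (\<rho> (dg (1/s) 1) w) = sc (chi n k) (\<rho> (dg (1/s) 1) w)" if k: "k \<in> ?S" for k
      proof -
        obtain p b c d where kk: "k = (p, b, c, d)" by (cases k)
        have I: "p - 1 \<in> P (int n + 1)" "d - 1 \<in> P (int n + 1)" "b \<in> P (int n)" "c \<in> P (int n + 1)" "k \<in> GL2"
          using k by (auto simp: kk Iw_iff add.commute)
        have g: "(p, s * b, c / s, d) \<in> GL2" using I(5) s by (simp add: kk GL2_def)
        have "\<rho> (p, s * b, c / s, d) w = sc (\<psi> (s * b)) w"
          using w I s unfolding eigv_def by (auto simp: P_mult_iff P_divide_iff)
        moreover have "mmul k (dg (1/s) 1) = mmul (dg (1/s) 1) (p, s * b, c / s, d)"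
          using s by (simp add: kk)
        ultimately show ?thesis using I(5) g s wV rho_rho[of k "dg (1/s) 1" w] rho_rho[of "dg (1/s) 1" "(p, s * b, c / s, d)" w]
          by (simp add: rho_sc chi_def kk s_def)
      qed
      then show ?thesis using wV s by (simp add: eigenspace_def)
    qed
    obtain c d where cd: "c \<noteq> 0 \<or> d \<noteq> 0" "sc c (\<rho> (dg (1/s) 1) x) + sc d (\<rho> (dg (1/s) 1) y) = 0"
      using E inE[OF xy(1)] inE[OF xy(2)] unfolding dim_le_one_def by blast
    have V: "x \<in> V" "y \<in> V" using xy by (auto simp: eigv_def)
    have "\<rho> (dg (1/s) 1) (sc c x + sc d y) = 0" using cd V s by (simp add: rho_add rho_sc)
    then have "sc c x + sc d y = 0" using rho_eq_0[of "dg (1/s) 1" "sc c x + sc d y"] V s by simp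
    then show ?thesis using cd by blast
  qed
  then show ?thesis by blast
qed

end

section \<open>The two halves of the restriction\<close>

context local_field begin

lemma P_mult_iff_right: "t \<noteq> 0 \<Longrightarrow> x * t \<in> P n \<longleftrightarrow> x \<in> P (n - v t)"
  using P_mult_iff[of t x n] by (simp add: mult.commute)

text \<open>A scalar contributes a square and \<open>K0\<close> a unit to the determinant.
  Conversely, dividing by a scalar of half the valuation leaves a unit determinant e/p^2, which a
  diagonal matrix in \<open>K0\<close> absorbs.\<close>

lemma Hgrp_iff: "g \<in> Hgrp v \<longleftrightarrow> g \<in> GL2 \<and> even (v (mdet g))"
proof
  assume "g \<in> Hgrp v"
  then obtain z k s where g: "z \<in> centre" "k \<in> K0 v" "s \<in> SL2" "g = mmul (mmul z k) s"
    by (auto simp: Hgrp_def)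
  obtain a where z: "a \<noteq> 0" "mdet z = a * a" using g by (auto simp: centre_def)
  have k: "mdet k \<noteq> 0" "v (mdet k) = 0" using g by (cases k; auto simp: K0_def)+
  have "mdet g = a * a * mdet k" using g z by (simp add: mdet_mmul SL2_def)
  then show "g \<in> GL2 \<and> even (v (mdet g))" using z k by (simp add: GL2_def v_mult)
next
  assume g: "g \<in> GL2 \<and> even (v (mdet g))"
  define e where "e = mdet g"
  have e: "e \<noteq> 0" using g by (simp add: e_def GL2_def)
  obtain l where l: "v e = 2 * l" using g by (auto simp: e_def)
  define p where "p = pw l"
  have p: "p \<noteq> 0" "v p = l" by (auto simp: p_def)
  define h where "h = mmul (p, 0, 0, p) (dg (e / (p * p)) 1)"
  have det: "mdet h = e" using p by (simp add: h_def)
  then have h: "h \<in> GL2" using e by (simp add: GL2_def)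
  have "mmul (minv h) g \<in> SL2" using h e det by (simp add: SL2_def mdet_mmul mdet_minv e_def)
  moreover have "(p, 0, 0, p) \<in> centre" using p by (auto simp: centre_def)
  moreover have "dg (e / (p * p)) 1 \<in> K0 v" using p e l by (simp add: K0_def P_v v_divide v_mult)
  moreover have "g = mmul h (mmul (minv h) g)" using h by (simp add: mmul_assoc[symmetric] del: mmul.simps)
  ultimately show "g \<in> Hgrp v" unfolding Hgrp_def h_def by blast
qed

lemma Hgrp_GL2 [simp]: "g \<in> Hgrp v \<Longrightarrow> g \<in> GL2" by (simp add: Hgrp_iff)

lemma SL2_Hgrp [simp]: "g \<in> SL2 \<Longrightarrow> g \<in> Hgrp v" by (simp add: Hgrp_iff) (simp add: SL2_def)

lemma v_mdet_mmul: "g \<in> GL2 \<Longrightarrow> h \<in> GL2 \<Longrightarrow> v (mdet (mmul g h)) = v (mdet g) + v (mdet h)"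
  by (simp add: mdet_mmul v_mult GL2_def)

lemma v_mdet_minv: "g \<in> GL2 \<Longrightarrow> v (mdet (minv g)) = - v (mdet g)"
  by (simp add: mdet_minv v_inverse GL2_def)

lemma Hgrp_conj [simp]: "g \<in> GL2 \<Longrightarrow> h \<in> Hgrp v \<Longrightarrow> mmul (mmul (minv g) h) g \<in> Hgrp v"
  using v_mdet_mmul[of "mmul (minv g) h" g] v_mdet_mmul[of "minv g" h] v_mdet_minv[of g]
  by (auto simp: Hgrp_iff simp del: mmul.simps minv.simps mdet.simps)

lemma Hgrp_odd_mmul: "g \<in> GL2 \<Longrightarrow> odd (v (mdet g)) \<Longrightarrow> h \<in> GL2 \<Longrightarrow> odd (v (mdet h)) \<Longrightarrow> mmul g h \<in> Hgrp v"
  by (simp add: Hgrp_iff v_mdet_mmul)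

lemma Hgrp_odd_minv_mmul:
  "g \<in> GL2 \<Longrightarrow> odd (v (mdet g)) \<Longrightarrow> h \<in> GL2 \<Longrightarrow> h \<notin> Hgrp v \<Longrightarrow> mmul (minv g) h \<in> Hgrp v"
  by (simp add: Hgrp_iff v_mdet_mmul v_mdet_minv)

end

section \<open>Stable subspaces and their translates\<close>

context gl2rep begin

definition uinv :: "'v set \<Rightarrow> bool" where "uinv A \<longleftrightarrow> sub A \<and> (\<forall>x. \<forall>w\<in>A. \<rho> (uu x) w \<in> A)"
definition stable :: "'f mat2 set \<Rightarrow> 'v set \<Rightarrow> bool" where "stable S A \<longleftrightarrow> sub A \<and> invariant \<rho> S A"

lemma stableD: "stable S A \<Longrightarrow> sub A" "stable S A \<Longrightarrow> g \<in> S \<Longrightarrow> w \<in> A \<Longrightarrow> \<rho> g w \<in> A"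
  by (auto simp: stable_def invariant_def)

lemma stable_subsp: "stable S A \<Longrightarrow> subsp sc A" using stableD(1) by simp

lemma stable_V: "stable A B \<Longrightarrow> x \<in> B \<Longrightarrow> x \<in> V" by (auto simp: stable_def)

lemma stable_SL2_uinv: "stable SL2 A \<Longrightarrow> uinv A"
  using stableD uu_SL2 unfolding uinv_def by blast

lemma stable_Hgrp_SL2: "stable (Hgrp v) A \<Longrightarrow> stable SL2 A"
  by (auto simp: stable_def invariant_def)

lemma stable_zero: "S \<subseteq> GL2 \<Longrightarrow> stable S {0}"
  using sub_zero by (auto simp: stable_def invariant_def)

lemma stable_Int: "stable S A \<Longrightarrow> stable S B \<Longrightarrow> stable S (A \<inter> B)"
  using sub_Int by (auto simp: stable_def invariant_def)

lemma stable_ssum: "S \<subseteq> GL2 \<Longrightarrow> stable S A \<Longrightarrow> stable S B \<Longrightarrow> stable S (ssum A B)"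
  unfolding stable_def invariant_def
proof (intro conjI ballI)
  assume S: "S \<subseteq> GL2" and A: "sub A \<and> (\<forall>g\<in>S. \<forall>w\<in>A. \<rho> g w \<in> A)" and B: "sub B \<and> (\<forall>g\<in>S. \<forall>w\<in>B. \<rho> g w \<in> B)"
  have "sub (ssum A B)" using sub_ssum A B by blast
  then show "subsp sc (ssum A B)" "ssum A B \<subseteq> V" by auto
  fix g w assume g: "g \<in> S" and "w \<in> ssum A B"
  then obtain x y where xy: "x \<in> A" "y \<in> B" "w = x + y" by (auto elim: ssumE)
  then have "\<rho> g w = \<rho> g x + \<rho> g y" using A B S g by (auto intro!: rho_add)
  then show "\<rho> g w \<in> ssum A B" using A B g xy by (auto intro: ssumI)
qed

definition tr :: "'f mat2 \<Rightarrow> 'v set \<Rightarrow> 'v set" where "tr g A = \<rho> g ` A"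

lemma tr_iff: "g \<in> GL2 \<Longrightarrow> A \<subseteq> V \<Longrightarrow> w \<in> tr g A \<longleftrightarrow> w \<in> V \<and> \<rho> (minv g) w \<in> A"
  unfolding tr_def by (auto simp: image_iff subset_iff intro!: bexI[of _ "\<rho> (minv g) w"])

lemma sub_tr: "g \<in> GL2 \<Longrightarrow> sub A \<Longrightarrow> sub (tr g A)"
proof -
  assume g: "g \<in> GL2" and A: "sub A"
  note D = subspD[OF conjunct1[OF A]]
  have "subsp sc (tr g A)" unfolding subsp_def using g A D
    by (auto simp: tr_iff rho_add rho_sc)
  then show "sub (tr g A)" using g A by (auto simp: tr_iff)
qed

lemma tr_tr: "g \<in> GL2 \<Longrightarrow> h \<in> GL2 \<Longrightarrow> A \<subseteq> V \<Longrightarrow> tr g (tr h A) = tr (mmul g h) A"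
  unfolding tr_def image_image by (intro image_cong refl) (auto simp: rho_rho)

lemma tr_minv [simp]: "g \<in> GL2 \<Longrightarrow> A \<subseteq> V \<Longrightarrow> tr (minv g) (tr g A) = A" "g \<in> GL2 \<Longrightarrow> A \<subseteq> V \<Longrightarrow> tr g (tr (minv g) A) = A"
  unfolding tr_def image_image by (auto simp: subset_iff image_iff)

lemma stable_tr:
  assumes "stable S A" "g \<in> GL2" "S \<subseteq> GL2" "\<And>s. s \<in> S \<Longrightarrow> mmul (mmul (minv g) s) g \<in> S"
  shows "stable S (tr g A)"
  unfolding stable_def invariant_def
proof (intro conjI ballI)
  have "sub (tr g A)" using sub_tr assms stableD by blast
  then show "subsp sc (tr g A)" "tr g A \<subseteq> V" by auto
  fix s w assume s: "s \<in> S" and "w \<in> tr g A"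
  then obtain x where x: "x \<in> A" "w = \<rho> g x" by (auto simp: tr_def)
  have V: "x \<in> V" using x assms stable_V by blast
  have sG: "s \<in> GL2" using s assms by auto
  have "\<rho> s w = \<rho> (mmul s g) x" using x V sG assms by (simp add: rho_rho)
  also have "mmul s g = mmul g (mmul (mmul (minv g) s) g)"
    using assms by (simp add: mmul_assoc[symmetric])
  also have "\<rho> \<dots> x = \<rho> g (\<rho> (mmul (mmul (minv g) s) g) x)"
    using V sG assms by (simp add: rho_rho)
  finally show "\<rho> s w \<in> tr g A" using stableD(2)[OF assms(1) assms(4)[OF s] x(1)] by (simp add: tr_def)
qed

lemma stable_SL2_tr: "stable SL2 A \<Longrightarrow> g \<in> GL2 \<Longrightarrow> stable SL2 (tr g A)"
  by (rule stable_tr) auto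

lemma stable_Hgrp_tr: "stable (Hgrp v) A \<Longrightarrow> g \<in> GL2 \<Longrightarrow> stable (Hgrp v) (tr g A)"
  by (rule stable_tr) auto

lemma tr_stable: "stable S A \<Longrightarrow> S \<subseteq> GL2 \<Longrightarrow> g \<in> S \<Longrightarrow> minv g \<in> S \<Longrightarrow> tr g A = A"
proof -
  assume A: "stable S A" and g: "S \<subseteq> GL2" "g \<in> S" "minv g \<in> S"
  have "w \<in> tr g A" if "w \<in> A" for w
    using stableD(2)[OF A g(3) that] stable_V[OF A that] g tr_iff[of g A w] stableD(1)[OF A] by auto
  moreover have "w \<in> A" if "w \<in> tr g A" for w
    using that stableD(2)[OF A g(2)] by (auto simp: tr_def)
  ultimately show "tr g A = A" by blast
qed

lemma tr_Int: "g \<in> GL2 \<Longrightarrow> A \<subseteq> V \<Longrightarrow> B \<subseteq> V \<Longrightarrow> tr g (A \<inter> B) = tr g A \<inter> tr g B"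
  by (auto simp: tr_iff le_infI1)

lemma tr_zero [simp]: "g \<in> GL2 \<Longrightarrow> tr g {0} = {0}" by (simp add: tr_def)

lemma tr_mono: "A \<subseteq> B \<Longrightarrow> tr g A \<subseteq> tr g B" by (auto simp: tr_def)

text \<open>H has index two, so H and one element of odd determinant valuation cover everything: any
  other h is g times an element of H.\<close>

lemma stable_GL2:
  assumes "stable (Hgrp v) A" "g \<in> GL2" "odd (v (mdet g))" "\<And>w. w \<in> A \<Longrightarrow> \<rho> g w \<in> A"
  shows "stable GL2 A"
  unfolding stable_def invariant_def
proof (intro conjI ballI)
  show "subsp sc A" "A \<subseteq> V" using stableD(1)[OF assms(1)] by auto
  fix h :: "'f mat2" and w assume h: "h \<in> GL2" and w: "w \<in> A"
  show "\<rho> h w \<in> A"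
  proof (cases "h \<in> Hgrp v")
    case True
    then show ?thesis using stableD(2)[OF assms(1)] w by blast
  next
    case False
    have "\<rho> h w = \<rho> g (\<rho> (mmul (minv g) h) w)"
      using w h assms stable_V by (simp add: rho_rho mmul_assoc[symmetric] del: mmul.simps)
    moreover have "\<rho> (mmul (minv g) h) w \<in> A"
      using stableD(2)[OF assms(1) Hgrp_odd_minv_mmul[OF assms(2,3) h False] w] .
    ultimately show ?thesis using assms(4) by simp
  qed
qed

lemma fixed_ssum:
  assumes "sub A" "sub B" "A \<inter> B = {0}" "J \<subseteq> GL2" "invariant \<rho> J A" "invariant \<rho> J B"
  shows "fixed \<rho> J (ssum A B) = ssum (fixed \<rho> J A) (fixed \<rho> J B)"
proof (intro equalityI subsetI)
  fix w assume w: "w \<in> fixed \<rho> J (ssum A B)"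
  then obtain x y where xy: "x \<in> A" "y \<in> B" "w = x + y" by (auto simp: fixed_def elim: ssumE)
  have V: "x \<in> V" "y \<in> V" using xy assms by auto
  have "\<rho> k x = x \<and> \<rho> k y = y" if k: "k \<in> J" for k
  proof -
    have e: "\<rho> k x + \<rho> k y = x + y" using w k xy V assms rho_add[of k x y] by (auto simp: fixed_def)
    then have "\<rho> k x - x = y - \<rho> k y" by (simp add: algebra_simps)
    moreover have "\<rho> k x - x \<in> A" using sub_diff[OF assms(1)] assms(5) k xy by (auto simp: invariant_def)
    moreover have "y - \<rho> k y \<in> B" using sub_diff[OF assms(2)] assms(6) k xy by (auto simp: invariant_def)
    ultimately have "\<rho> k x - x \<in> A \<inter> B" by simp
    then have "\<rho> k x = x" using assms(3) by simp
    then show ?thesis using e by simp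
  qed
  then show "w \<in> ssum (fixed \<rho> J A) (fixed \<rho> J B)" using xy by (auto simp: fixed_def intro: ssumI)
next
  fix w assume "w \<in> ssum (fixed \<rho> J A) (fixed \<rho> J B)"
  then obtain x y where "x \<in> A" "y \<in> B" "w = x + y" "\<forall>k\<in>J. \<rho> k x = x" "\<forall>k\<in>J. \<rho> k y = y"
    by (auto simp: fixed_def elim!: ssumE)
  then show "w \<in> fixed \<rho> J (ssum A B)"
    using assms rho_add by (auto simp: fixed_def subset_iff intro!: ssumI)
qed

lemma sub_fixed: "sub A \<Longrightarrow> J \<subseteq> GL2 \<Longrightarrow> sub (fixed \<rho> J A)"
proof -
  assume A: "sub A" and J: "J \<subseteq> GL2"
  note D = subspD[OF conjunct1[OF A]]
  have "subsp sc (fixed \<rho> J A)" unfolding subsp_def fixed_def using A J D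
    by (auto simp: rho_add rho_sc subset_iff)
  then show "sub (fixed \<rho> J A)" using A by (auto simp: fixed_def)
qed

text \<open>The last two hypotheses say that \<open>g\<close> normalises \<open>J\<close>.\<close>

lemma fixed_tr:
  assumes "A \<subseteq> V" "g \<in> GL2" "J \<subseteq> GL2"
    "\<And>k. k \<in> J \<Longrightarrow> mmul (mmul (minv g) k) g \<in> J" "\<And>k. k \<in> J \<Longrightarrow> mmul (mmul g k) (minv g) \<in> J"
  shows "fixed \<rho> J (tr g A) = tr g (fixed \<rho> J A)"
proof (intro equalityI subsetI)
  fix w assume w: "w \<in> fixed \<rho> J (tr g A)"
  then obtain x where x: "x \<in> A" "w = \<rho> g x" by (auto simp: fixed_def tr_def)
  have "\<rho> k x = x" if k: "k \<in> J" for k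
  proof -
    have kG: "k \<in> GL2" and xV: "x \<in> V" using k x assms by auto
    have "\<rho> g (\<rho> k x) = \<rho> (mmul (mmul g k) (minv g)) w"
      using kG xV assms(2) by (simp add: x rho_rho mmul_assoc del: mmul.simps)
    also have "\<dots> = \<rho> g x" using w assms(5)[OF k] x by (simp add: fixed_def)
    finally have "\<rho> (minv g) (\<rho> g (\<rho> k x)) = \<rho> (minv g) (\<rho> g x)" by simp
    then show ?thesis using kG xV assms(2) by simp
  qed
  then show "w \<in> tr g (fixed \<rho> J A)" using x by (auto simp: fixed_def tr_def)
next
  fix w assume "w \<in> tr g (fixed \<rho> J A)"
  then obtain x where x: "x \<in> A" "w = \<rho> g x" "\<forall>k\<in>J. \<rho> k x = x" by (auto simp: fixed_def tr_def)
  have "\<rho> k w = w" if k: "k \<in> J" for k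
  proof -
    have kG: "k \<in> GL2" and xV: "x \<in> V" using k x assms by auto
    have "\<rho> k w = \<rho> g (\<rho> (mmul (mmul (minv g) k) g) x)"
      using kG xV assms(2) by (simp add: x rho_rho mmul_assoc[symmetric] del: mmul.simps)
    then show ?thesis using x(2,3) assms(4)[OF k] by simp
  qed
  then show "w \<in> fixed \<rho> J (tr g A)" using x by (auto simp: fixed_def tr_def)
qed

lemma has_dim_tr: "g \<in> GL2 \<Longrightarrow> sub A \<Longrightarrow> has_dim sc (tr g A) n \<longleftrightarrow> has_dim sc A n"
proof -
  assume g: "g \<in> GL2" and A: "sub A"
  have AV: "\<And>x. x \<in> A \<Longrightarrow> x \<in> V" using A by auto
  have "bij_betw (\<rho> g) A (tr g A)" unfolding bij_betw_def tr_def inj_on_def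
    using g AV by (metis rho_inv(1))
  then have "has_dim sc A n \<longleftrightarrow> has_dim sc (tr g A) n"
    using A g AV by (intro has_dim_transfer[OF vs_axioms]) (auto simp: rho_add rho_sc)
  then show ?thesis by simp
qed

lemma Kc'_iff: "j \<ge> 1 \<Longrightarrow> (x, b, c, d) \<in> Kc' v j \<longleftrightarrow> x - 1 \<in> P (int j) \<and> b \<in> P (int j) \<and> c \<in> P (int j) \<and>
   d - 1 \<in> P (int j) \<and> (x, b, c, d) \<in> SL2"
  by (auto simp: Kc'_def Kc_def)

text \<open>The form in which a Whittaker model is used: genuine vectors, one for every large level,
  instead of nonzero coinvariants.\<close>

definition generic :: "'v set \<Rightarrow> bool" where
  "generic A \<longleftrightarrow> uinv A \<and> (\<exists>N. \<forall>n\<ge>N. \<exists>x\<in>A. x \<noteq> 0 \<and> eigv n x)"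

text \<open>A vector nonzero in the coinvariants has nonzero averages for t = 1: if such an average
  vanished, a power of q times the vector would be a sum of vectors that die in the
  coinvariants.\<close>

lemma whittaker_generic:
  assumes A: "uinv A" and W: "whittaker sc \<rho> \<psi> A"
  shows "generic A"
proof -
  let ?X = "{\<rho> (uu x) w - sc (\<psi> x) w | x w. w \<in> A}"
  have AV: "\<And>x. x \<in> A \<Longrightarrow> x \<in> V" and sA: "sub A" and inv: "\<And>x w. w \<in> A \<Longrightarrow> \<rho> (uu x) w \<in> A"
    using A by (auto simp: uinv_def)
  have "?X \<subseteq> A" using sub_diff[OF sA] inv subspD(3)[OF conjunct1[OF sA]] by auto
  then have "rspan sc ?X \<subseteq> A" using sA unfolding rspan_def by blast
  then obtain w where w: "w \<in> A" "w \<notin> rspan sc ?X" using W unfolding whittaker_def by blast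
  \<comment> \<open>\<open>S\<close> is a subspace containing all the differences while missing
    \<open>w\<close>; it replaces the span in the rest of the argument.\<close>
  then obtain S where S: "subsp sc S" "?X \<subseteq> S" "w \<notin> S" unfolding rspan_def by blast
  have wV: "w \<in> V" using w AV by blast
  obtain i where i: "i \<ge> 1" "Kfix i w" using Kfix_ex[OF wV] by blast
  have nz: "avg n i 1 w \<noteq> 0" if n: "- n \<le> i" for n
  proof
    assume 0: "avg n i 1 w = 0"
    let ?Q = "of_nat (q ^ nat (i + n)) :: 'r"
    have gen: "w - sc (\<psi> (- x)) (\<rho> (uu x) w) \<in> S" for x
    proof -
      have "sc (- \<psi> (- x)) (\<rho> (uu x) w - sc (\<psi> x) w) \<in> S"
        using S w by (intro subspD(3)[OF S(1)]) auto
      also have "sc (- \<psi> (- x)) (\<rho> (uu x) w - sc (\<psi> x) w) = w - sc (\<psi> (- x)) (\<rho> (uu x) w)"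
        using wV psi_minus by (simp add: sc_diff sc_sc sc_minus)
      finally show ?thesis .
    qed
    have "(\<Sum>x\<in>Rp (-n) i. w - sc (\<psi> (- x)) (\<rho> (uu x) w)) = (\<Sum>x\<in>Rp (-n) i. sc 1 w) - avg n i 1 w"
      using wV by (simp add: sum_subtractf avg_def)
    also have "\<dots> = sc (\<Sum>x\<in>Rp (-n) i. 1) w" using 0 wV by (simp only: sum_sc diff_zero)
    also have "\<dots> = sc ?Q w" using Rp(2)[OF n] by simp
    finally have e: "(\<Sum>x\<in>Rp (-n) i. w - sc (\<psi> (- x)) (\<rho> (uu x) w)) = sc ?Q w" .
    have "(\<Sum>x\<in>Rp (-n) i. w - sc (\<psi> (- x)) (\<rho> (uu x) w)) \<in> S" by (rule subsp_sum[OF S(1) gen])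
    then have "sc ?Q w \<in> S" unfolding e .
    then have "sc (inverse ?Q) (sc ?Q w) \<in> S" by (rule subspD(3)[OF S(1)])
    then have "w \<in> S" using wV q_power_nonzero by (simp add: sc_sc del: of_nat_power)
    then show False using S by simp
  qed
  have "\<exists>x\<in>A. x \<noteq> 0 \<and> eigv n x" if n: "n \<ge> i" for n
  proof -
    have "1 \<in> P (1 - i)" using i by (simp add: P_v)
    then have "eigv (n - v 1) (\<rho> (dg 1 1) (avg n i 1 w))"
      using n i wV by (intro eigv_avg) auto
    moreover have "\<rho> (dg 1 1) (avg n i 1 w) = avg n i 1 w" using wV rho_mone by (simp add: mone_def)
    ultimately have "eigv n (avg n i 1 w)" by simp
    moreover have "avg n i 1 w \<in> A" using avg_in[OF sA inv w(1)] by simp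
    ultimately show ?thesis using nz[of n] n i by auto
  qed
  then show ?thesis unfolding generic_def using A by blast
qed

\<comment> \<open>Levels at which unipotent invariance can change\<close>
end

context gl2germ begin

lemma eigv_disjoint:
  "\<exists>N. \<forall>n\<ge>N. \<forall>A C x y. sub A \<longrightarrow> sub C \<longrightarrow> A \<inter> C = {0} \<longrightarrow> x \<in> A \<longrightarrow> y \<in> C \<longrightarrow> eigv n x \<longrightarrow> eigv n y \<longrightarrow> x = 0 \<or> y = 0"
proof -
  obtain N where N: "\<And>n x y. n \<ge> N \<Longrightarrow> eigv (int n) x \<Longrightarrow> eigv (int n) y \<Longrightarrow>
      \<exists>c d. (c \<noteq> 0 \<or> d \<noteq> 0) \<and> sc c x + sc d y = 0" using eigv_dependent by blast
  have "x = 0 \<or> y = 0"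
    if n: "n \<ge> int N" and AC: "sub A" "sub C" "A \<inter> C = {0}" and xy: "x \<in> A" "y \<in> C" "eigv n x" "eigv n y" for n A C x y
  proof -
    obtain c d where cd: "c \<noteq> 0 \<or> d \<noteq> 0" "sc c x + sc d y = 0"
    proof -
      have "N \<le> nat n" "int (nat n) = n" using n by linarith+
      then show thesis using that N[of "nat n" x y] xy by metis
    qed
    have V: "x \<in> V" "y \<in> V" using xy AC by auto
    have A: "sc c x \<in> A" and C: "sc d y \<in> C" using xy AC subspD(3) by blast+
    have "sc c x = - sc d y" using cd by (simp add: eq_neg_iff_add_eq_0)
    then have "sc c x \<in> A \<inter> C" using A sub_minus[OF AC(2) C] by simp
    then have "sc c x = 0" using AC by simp
    moreover from this have "sc d y = 0" using cd by simp
    ultimately show ?thesis using cd(1) V sc_cancel by blast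
  qed
  then show ?thesis by blast
qed

text \<open>The pair n, t is found from \<open>w\<close> alone and then serves all disjoint pairs of
  subspaces at once. This permits comparing \<open>w\<close> with its components or with its image
  under a homomorphism.\<close>

lemma separating_average:
  assumes w: "w \<in> V" "Kfix i w" "i \<ge> 1" "Ufix m w" "m \<le> i" "\<not> Ufix n0 w"
  shows "\<exists>n t. t \<noteq> 0 \<and> 1 - m \<le> v t \<and> v t \<le> - n0 \<and> n - v t \<ge> N \<and> avg n i t w \<noteq> 0
     \<and> eigv (n - v t) (\<rho> (dg t 1) (avg n i t w))
     \<and> (\<forall>A C x y. uinv A \<longrightarrow> uinv C \<longrightarrow> A \<inter> C = {0} \<longrightarrow> x \<in> A \<longrightarrow> y \<in> C \<longrightarrow> Kfix i x \<longrightarrow> Kfix i y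
          \<longrightarrow> avg n i t x = 0 \<or> avg n i t y = 0)"
proof -
  obtain M where M: "\<forall>n\<ge>M. \<forall>A C x y. sub A \<longrightarrow> sub C \<longrightarrow> A \<inter> C = {0} \<longrightarrow> x \<in> A \<longrightarrow> y \<in> C \<longrightarrow>
      eigv n x \<longrightarrow> eigv n y \<longrightarrow> x = 0 \<or> y = 0" using eigv_disjoint by blast
  \<comment> \<open>Large enough for every inequality of \<open>eigv_avg\<close> and for both
    prescribed depths; 2 |n0| covers n + 1 - 2 v t, since v t is at most -n0.\<close>
  define n where "n = i + 2 * \<bar>n0\<bar> + \<bar>N\<bar> + \<bar>M\<bar>"
  obtain t where t: "t \<noteq> 0" "1 - m \<le> v t" "v t \<le> - n0" "avg n i t w \<noteq> 0"
  proof -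
    have "- n \<le> n0" using w(3) unfolding n_def by linarith
    then show thesis using that nonzero_avg_exists[OF w(1,4,6) _ w(5), of n] by blast
  qed
  have b: "n \<ge> 0" "n - v t \<ge> 0" "n - v t + 1 \<ge> i" "n + 1 - 2 * v t \<ge> i" "- n \<le> i" "n - v t \<ge> N" "n - v t \<ge> M"
    using t w(3) unfolding n_def by linarith+
  have tP: "t \<in> P (1 - i)" using t w(5) by (simp add: P_v)
  have eig: "eigv (n - v t) (\<rho> (dg t 1) (avg n i t x))" if "x \<in> V" "Kfix i x" for x
    using that t tP w(3) b by (intro eigv_avg) auto
  have "avg n i t x = 0 \<or> avg n i t y = 0"
    if AC: "uinv A" "uinv C" "A \<inter> C = {0}" and xy: "x \<in> A" "y \<in> C" "Kfix i x" "Kfix i y" for A C x y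
  proof -
    have s: "sub A" "sub C" and V: "x \<in> V" "y \<in> V" using AC xy by (auto simp: uinv_def)
    have a: "avg n i t x \<in> A" "avg n i t y \<in> C"
    proof -
      have "\<And>z u. u \<in> A \<Longrightarrow> \<rho> (uu z) u \<in> A" "\<And>z u. u \<in> C \<Longrightarrow> \<rho> (uu z) u \<in> C"
        using AC by (simp_all add: uinv_def)
      then show "avg n i t x \<in> A" "avg n i t y \<in> C" using avg_in[OF s(1) _ xy(1)] avg_in[OF s(2) _ xy(2)] by blast+
    qed
    have g: "dg t 1 \<in> GL2" using t by simp
    have "tr (dg t 1) A \<inter> tr (dg t 1) C = {0}" using tr_Int[OF g, of A C] s AC(3) g by simp
    moreover have "sub (tr (dg t 1) A)" "sub (tr (dg t 1) C)" using sub_tr[OF g] s by blast+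
    moreover have "\<rho> (dg t 1) (avg n i t x) \<in> tr (dg t 1) A" "\<rho> (dg t 1) (avg n i t y) \<in> tr (dg t 1) C"
      using a by (auto simp: tr_def)
    ultimately have "\<rho> (dg t 1) (avg n i t x) = 0 \<or> \<rho> (dg t 1) (avg n i t y) = 0"
      using M[rule_format, OF b(7), of "tr (dg t 1) A" "tr (dg t 1) C"] eig[OF V(1) xy(3)] eig[OF V(2) xy(4)] by simp
    then show ?thesis using rho_eq_0[OF g] V by simp
  qed
  then show ?thesis using t b eig[OF w(1,2)] by blast
qed

text \<open>Taking m = j + 1 and n0 = j forces v t = -j. For even j the matrix \<open>dg t 1\<close>
  lies in H and keeps \<open>C\<close>, so \<open>C\<close> acquires a deep eigenvector, which it
  cannot share with the generic \<open>A\<close>.\<close>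

lemma no_even_jump:
  assumes A: "generic A" and C: "stable (Hgrp v) C" and AC: "A \<inter> C = {0}"
    and w: "w \<in> C" "Ufix (j + 1) w" and j: "even j"
  shows "Ufix j w"
proof (rule ccontr)
  assume no: "\<not> Ufix j w"
  have sA: "sub A" using A by (simp add: generic_def uinv_def)
  have sC: "sub C" using stableD(1)[OF C] .
  obtain M where M: "\<forall>n\<ge>M. \<forall>A C x y. sub A \<longrightarrow> sub C \<longrightarrow> A \<inter> C = {0} \<longrightarrow> x \<in> A \<longrightarrow> y \<in> C \<longrightarrow>
      eigv n x \<longrightarrow> eigv n y \<longrightarrow> x = 0 \<or> y = 0" using eigv_disjoint by blast
  obtain N where N: "\<forall>n\<ge>N. \<exists>x\<in>A. x \<noteq> 0 \<and> eigv n x" using A by (auto simp: generic_def)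
  have wV: "w \<in> V" using w sC by auto
  obtain i0 where i0: "i0 \<ge> 1" "Kfix i0 w" using Kfix_ex[OF wV] by blast
  define i where "i = max i0 (j + 1)"
  have i: "Kfix i w" "i \<ge> 1" "j + 1 \<le> i" using i0 Kfix_mono[OF i0(2), of i] by (auto simp: i_def)
  obtain n t where t: "t \<noteq> 0" "1 - (j + 1) \<le> v t" "v t \<le> - j" "n - v t \<ge> max M N" "avg n i t w \<noteq> 0"
    "eigv (n - v t) (\<rho> (dg t 1) (avg n i t w))"
    using separating_average[OF wV i(1,2) w(2) i(3) no, of "max M N"] by blast
  have "v t = - j" using t by simp
  then have "dg t 1 \<in> Hgrp v" using t(1) j by (simp add: Hgrp_iff)
  moreover have "avg n i t w \<in> C"
  proof (rule avg_in[OF sC _ w(1)])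
    show "\<rho> (uu x) u \<in> C" if "u \<in> C" for x u using stableD(2)[OF C SL2_Hgrp[OF uu_SL2] that] .
  qed
  ultimately have "\<rho> (dg t 1) (avg n i t w) \<in> C" using stableD(2)[OF C] by blast
  moreover have "\<rho> (dg t 1) (avg n i t w) \<noteq> 0" using rho_eq_0[of "dg t 1"] t wV by simp
  moreover obtain x where "x \<in> A" "x \<noteq> 0" "eigv (n - v t) x" using N t by fastforce
  ultimately show False using M t sA sC AC by (metis max.bounded_iff)
qed

end

section \<open>Fixed vectors in the two halves\<close>

locale gl2split = gl2germ v q \<psi> sc V \<rho> a
  for v :: "'f::field \<Rightarrow> int" and q and \<psi> :: "'f \<Rightarrow> 'r::field"
    and sc :: "'r \<Rightarrow> 'v::ab_group_add \<Rightarrow> 'v" and V :: "'v set" and \<rho> and a +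
  fixes Wp Wm :: "'v set"
  assumes irr: "irred_on sc \<rho> GL2 V"
    and Wp: "irred_on sc \<rho> (Hgrp v) Wp" and Wm: "irred_on sc \<rho> (Hgrp v) Wm"
    and Wsum: "Wp \<inter> Wm = {0}" "{x + y | x y. x \<in> Wp \<and> y \<in> Wm} = V"
    and Wwhit: "whittaker sc \<rho> \<psi> Wp" and infdim: "infinite_dim sc V"
begin

lemma ssum_Wp_Wm: "ssum Wp Wm = V" using Wsum(2) by (simp add: ssum_def)

lemma stable_Wp: "stable (Hgrp v) Wp" and stable_Wm: "stable (Hgrp v) Wm"
proof -
  have s: "subsp sc Wp" "subsp sc Wm" using Wp Wm by (auto simp: irred_on_def)
  have "x \<in> V" if "x \<in> Wp" for x
    using ssumI[OF that subspD(1)[OF s(2)]] ssum_Wp_Wm by simp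
  moreover have "x \<in> V" if "x \<in> Wm" for x
    using ssumI[OF subspD(1)[OF s(1)] that] ssum_Wp_Wm by simp
  ultimately show "stable (Hgrp v) Wp" "stable (Hgrp v) Wm" using Wp Wm by (auto simp: irred_on_def stable_def)
qed

lemma V_irreducible: "stable GL2 A \<Longrightarrow> A = {0} \<or> A = V"
  using irr by (auto simp: irred_on_def stable_def)

lemma Wp_irreducible: "stable (Hgrp v) A \<Longrightarrow> A \<subseteq> Wp \<Longrightarrow> A = {0} \<or> A = Wp"
  using Wp by (auto simp: irred_on_def stable_def)

lemma Wm_irreducible: "stable (Hgrp v) A \<Longrightarrow> A \<subseteq> Wm \<Longrightarrow> A = {0} \<or> A = Wm"
  using Wm by (auto simp: irred_on_def stable_def)

lemma nonzero: "V \<noteq> {0}" "Wp \<noteq> {0}" "Wm \<noteq> {0}"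
  using irr Wp Wm by (auto simp: irred_on_def)

lemma sub_W: "sub Wp" "sub Wm" using stable_Wp stable_Wm stableD(1) by blast+

text \<open>If Wp met its translate nontrivially, irreducibility under H would give Wp inside the
  translate; as g^2 lies in H, Wp would be stable under GL2 and equal V, leaving nothing for
  Wm.\<close>

lemma tr_Wp:
  assumes g: "g \<in> GL2" "odd (v (mdet g))"
  shows "Wp \<inter> tr g Wp = {0}" and "ssum Wp (tr g Wp) = V" and "stable (Hgrp v) (tr g Wp)"
proof -
  have WV: "Wp \<subseteq> V" using sub_W by simp
  show st: "stable (Hgrp v) (tr g Wp)" using stable_Hgrp_tr[OF stable_Wp g(1)] .
  have gg: "mmul g g \<in> Hgrp v" "minv (mmul g g) \<in> Hgrp v"
    using g by (auto intro!: Hgrp_odd_mmul simp: Hgrp_iff v_mdet_minv v_mdet_mmul)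
  have ggW: "\<rho> g (\<rho> g w) \<in> Wp" if "w \<in> Wp" for w
    using stableD(2)[OF stable_Wp gg(1) that] that WV g by (auto simp: rho_rho)
  show int: "Wp \<inter> tr g Wp = {0}"
  proof (rule ccontr)
    assume "Wp \<inter> tr g Wp \<noteq> {0}"
    then have "Wp \<inter> tr g Wp = Wp" using Wp_irreducible[OF stable_Int[OF stable_Wp st]] by blast
    then have "Wp \<subseteq> tr g Wp" by blast
    have "\<rho> g w \<in> Wp" if "w \<in> Wp" for w
    proof -
      have "w \<in> tr g Wp" using that \<open>Wp \<subseteq> tr g Wp\<close> by blast
      then obtain x where "x \<in> Wp" "w = \<rho> g x" by (auto simp: tr_def)
      then show ?thesis using ggW by simp
    qed
    then have "stable GL2 Wp" using stable_GL2[OF stable_Wp g] by blast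
    then have "Wp = V" using V_irreducible nonzero by blast
    then have "Wm = {0}" using Wsum(1) sub_W(2) by blast
    then show False using nonzero by simp
  qed
  have "stable GL2 (ssum Wp (tr g Wp))"
  proof (rule stable_GL2[OF _ g])
    show "stable (Hgrp v) (ssum Wp (tr g Wp))" using stable_ssum[OF _ stable_Wp st] Hgrp_GL2 by blast
    fix w assume "w \<in> ssum Wp (tr g Wp)"
    then obtain x y where xy: "x \<in> Wp" "y \<in> Wp" "w = x + \<rho> g y" by (auto simp: tr_def elim!: ssumE)
    then have "\<rho> g w = \<rho> g (\<rho> g y) + \<rho> g x" using WV g by (auto simp: rho_add add.commute subset_iff)
    then show "\<rho> g w \<in> ssum Wp (tr g Wp)" using xy ggW by (auto simp: tr_def intro!: ssumI)
  qed
  moreover have "Wp \<subseteq> ssum Wp (tr g Wp)"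
    using ssumI[of _ Wp 0 "tr g Wp"] subspD(1)[OF stable_subsp[OF st]] by fastforce
  ultimately show "ssum Wp (tr g Wp) = V" using V_irreducible nonzero subspD(1)[OF conjunct1[OF sub_W(1)]] by blast
qed

lemma generic_Wp: "generic Wp"
  using whittaker_generic[OF stable_SL2_uinv[OF stable_Hgrp_SL2[OF stable_Wp]] Wwhit] .

lemma Wm_no_even_jump: "w \<in> Wm \<Longrightarrow> Ufix (j + 1) w \<Longrightarrow> even j \<Longrightarrow> Ufix j w"
  using no_even_jump[OF generic_Wp stable_Wm Wsum(1)] .

text \<open>Conjugation by diag(p, 1) raises unipotent levels by one and carries Wp to a complement
  of Wp, where the even case applies.\<close>

lemma Wp_no_odd_jump:
  assumes "w \<in> Wp" "Ufix (j + 1) w" "odd j" shows "Ufix j w"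
proof -
  define p where "p = pw 1"
  have p: "p \<noteq> 0" "v p = 1" by (auto simp: p_def)
  let ?g = "dg p 1"
  have g: "?g \<in> GL2" "odd (v (mdet ?g))" using p by auto
  have wV: "w \<in> V" using assms sub_W by auto
  have conj: "\<rho> (uu x) (\<rho> ?g w) = \<rho> ?g (\<rho> (uu (x / p)) w)" for x
    using p wV by (simp add: rho_rho)
  have "Ufix (j + 1 + 1) (\<rho> ?g w)" unfolding Ufix_def
  proof
    fix x assume "x \<in> P (j + 1 + 1)"
    then have "x / p \<in> P (j + 1)" using p by (simp add: P_divide_iff)
    then show "\<rho> (uu x) (\<rho> ?g w) = \<rho> ?g w" using assms(2) conj by (simp add: Ufix_def)
  qed
  moreover have "\<rho> ?g w \<in> tr ?g Wp" using assms by (auto simp: tr_def)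
  ultimately have U: "Ufix (j + 1) (\<rho> ?g w)"
    using no_even_jump[OF generic_Wp tr_Wp(3)[OF g] tr_Wp(1)[OF g]] assms(3) by simp
  show ?thesis unfolding Ufix_def
  proof
    fix x assume "x \<in> P j"
    then have "p * x \<in> P (j + 1)" using p by (simp add: P_mult_iff)
    then have "\<rho> (uu (p * x)) (\<rho> ?g w) = \<rho> ?g w" using U by (simp add: Ufix_def)
    then have "\<rho> (minv ?g) (\<rho> ?g (\<rho> (uu x) w)) = \<rho> (minv ?g) (\<rho> ?g w)" using conj[of "p * x"] p by simp
    then show "\<rho> (uu x) w = w" using g(1) wV by (simp del: minv.simps)
  qed
qed

abbreviation J :: "nat \<Rightarrow> 'f mat2 set" where "J n \<equiv> Iw v n \<inter> SL2"

lemma J_GL2: "J n \<subseteq> GL2" by (auto simp: Iw_def)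

text \<open>J (2 j - 1) differs from K'_j only in allowing the upper right entry in P^(j-1), and
  splitting off the factor \<open>uu (b / d)\<close> isolates this entry.\<close>

lemma fixed_Kc'_lower:
  assumes C: "stable SL2 C" and jump: "\<And>w. w \<in> C \<Longrightarrow> Ufix (int j) w \<Longrightarrow> Ufix (int j - 1) w" and j: "j \<ge> 1"
  shows "fixed \<rho> (Kc' v j) C = fixed \<rho> (J (2 * j - 1)) C"
proof -
  have n: "(2 * j - 1 + 1) div 2 = j" "(2 * j - 1) div 2 = j - 1" using j by auto
  have ij: "int (j - 1) = int j - 1" using j by simp
  have Jiff: "(x, b, c, d) \<in> J (2 * j - 1) \<longleftrightarrow> x - 1 \<in> P (int j) \<and> d - 1 \<in> P (int j) \<and>
      b \<in> P (int j - 1) \<and> c \<in> P (int j) \<and> (x, b, c, d) \<in> SL2" for x b c d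
    using n ij by (auto simp: Iw_iff)
  have sub: "Kc' v j \<subseteq> J (2 * j - 1)"
  proof
    fix k assume K: "k \<in> Kc' v j"
    obtain x b c d where k: "k = (x, b, c, d)" by (cases k)
    show "k \<in> J (2 * j - 1)" using K P_mono[of b "int j" "int j - 1"] unfolding k Kc'_iff[OF j] Jiff by auto
  qed
  have "\<rho> k w = w" if w: "w \<in> C" "\<forall>k\<in>Kc' v j. \<rho> k w = w" and k: "k \<in> J (2 * j - 1)" for w k
  proof -
    obtain x b c d where kk: "k = (x, b, c, d)" by (cases k)
    have I: "x - 1 \<in> P (int j)" "d - 1 \<in> P (int j)" "b \<in> P (int j - 1)" "c \<in> P (int j)" "x * d - b * c = 1"
      using k unfolding kk Jiff by (auto simp: SL2_def)
    note ud = one_unit[OF I(2)]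
    have d: "d \<noteq> 0" "v d = 0" using ud j by auto
    have wV: "w \<in> V" using w C stable_V by blast
    have "Ufix (int j) w" unfolding Ufix_def using w(2) j by (auto simp: Kc'_iff)
    then have U: "Ufix (int j - 1) w" using jump w by blast
    have "(1 / d, 0, c, d) \<in> Kc' v j"
      using I d one_unit_inverse[OF I(2)] j by (simp add: Kc'_iff SL2_def inverse_eq_divide)
    then have 1: "\<rho> (1 / d, 0, c, d) w = w" using w by blast
    have "b / d \<in> P (int j - 1)" using I d by (simp add: P_divide_iff)
    then have 2: "\<rho> (uu (b / d)) w = w" using U by (simp add: Ufix_def)
    have "mmul (uu (b / d)) (1 / d, 0, c, d) = k"
      using d I(5) by (simp add: kk field_simps)
    moreover have "(1 / d, 0, c, d) \<in> GL2" using d by (simp add: GL2_def)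
    ultimately show ?thesis using 1 2 rho_rho[of "uu (b / d)" "(1 / d, 0, c, d)" w] wV by simp
  qed
  then show ?thesis using sub by (auto simp: fixed_def)
qed

text \<open>Here the lower left entry is relaxed. The Weyl element \<open>s\<close> exchanges lower
  and upper unipotents and preserves \<open>C\<close>, so the hypothesis on the upper ones
  applies.\<close>

lemma fixed_Kc'_upper:
  assumes C: "stable SL2 C" and jump: "\<And>w. w \<in> C \<Longrightarrow> Ufix (int j + 1) w \<Longrightarrow> Ufix (int j) w" and j: "j \<ge> 1"
  shows "fixed \<rho> (Kc' v j) C = fixed \<rho> (J (2 * j)) C"
proof -
  have Jiff: "(x, b, c, d) \<in> J (2 * j) \<longleftrightarrow> x - 1 \<in> P (int j) \<and> d - 1 \<in> P (int j) \<and>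
      b \<in> P (int j) \<and> c \<in> P (int j + 1) \<and> (x, b, c, d) \<in> SL2" for x b c d
    by (auto simp: Iw_iff)
  have sub: "J (2 * j) \<subseteq> Kc' v j"
  proof
    fix k assume K: "k \<in> J (2 * j)"
    obtain x b c d where k: "k = (x, b, c, d)" by (cases k)
    show "k \<in> Kc' v j" using K P_mono[of c "int j + 1" "int j"] unfolding k Kc'_iff[OF j] Jiff by auto
  qed
  define s :: "'f mat2" where "s = (0, 1, -1, 0)"
  have s: "s \<in> SL2" by (simp add: s_def SL2_def)
  have "\<rho> k w = w" if w: "w \<in> C" "\<forall>k\<in>J (2 * j). \<rho> k w = w" and k: "k \<in> Kc' v j" for w k
  proof -
    obtain x b c d where kk: "k = (x, b, c, d)" by (cases k)
    have I: "x - 1 \<in> P (int j)" "d - 1 \<in> P (int j)" "b \<in> P (int j)" "c \<in> P (int j)" "x * d - b * c = 1"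
      using k unfolding kk Kc'_iff[OF j] by (auto simp: SL2_def)
    note ux = one_unit[OF I(1)]
    have x: "x \<noteq> 0" "v x = 0" using ux j by auto
    have wV: "w \<in> V" using w C stable_V by blast
    have conj: "\<rho> (uu y) (\<rho> s w) = \<rho> s (\<rho> (ll (- y)) w)" for y
      using wV s by (simp add: rho_rho) (simp add: s_def)
    have "Ufix (int j + 1) (\<rho> s w)" unfolding Ufix_def
    proof
      fix y assume "y \<in> P (int j + 1)"
      then have "ll (- y) \<in> J (2 * j)" by (subst Jiff) simp
      then show "\<rho> (uu y) (\<rho> s w) = \<rho> s w" using conj w by simp
    qed
    then have U: "Ufix (int j) (\<rho> s w)" using jump stableD(2)[OF C s w(1)] by blast
    have L: "\<rho> (ll y) w = w" if y: "y \<in> P (int j)" for y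
    proof -
      have "\<rho> (minv s) (\<rho> s (\<rho> (ll y) w)) = \<rho> (minv s) (\<rho> s w)"
        using U conj[of "- y"] y by (simp add: Ufix_def)
      then show ?thesis using s wV by simp
    qed
    have "(x, b, 0, 1 / x) \<in> J (2 * j)"
      using I x one_unit_inverse[OF I(1)] j by (subst Jiff) (simp add: SL2_def inverse_eq_divide)
    then have 1: "\<rho> (x, b, 0, 1 / x) w = w" using w by blast
    have "c / x \<in> P (int j)" using I x by (simp add: P_divide_iff)
    then have 2: "\<rho> (ll (c / x)) w = w" using L by blast
    have "mmul (ll (c / x)) (x, b, 0, 1 / x) = k"
      using x I(5) by (simp add: kk field_simps)
    moreover have "(x, b, 0, 1 / x) \<in> GL2" using x by (simp add: GL2_def)
    ultimately show ?thesis using 1 2 rho_rho[of "ll (c / x)" "(x, b, 0, 1 / x)" w] wV by simp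
  qed
  then show ?thesis using sub by (auto simp: fixed_def)
qed

lemma invariant_J: "stable (Hgrp v) A \<Longrightarrow> invariant \<rho> (J n) A"
  using stableD(2) unfolding invariant_def by (meson IntD2 SL2_Hgrp)

lemma dim_fixed_J:
  "\<exists>N. \<forall>n\<ge>N. \<exists>d. has_dim sc (fixed \<rho> (J n) Wp) d \<and> has_dim sc (fixed \<rho> (J n) Wm) d
     \<and> 2 * int d = a + 2 * int q ^ (n div 2)"
proof -
  obtain N where N: "\<forall>n\<ge>N. \<exists>d. has_dim sc (fixed \<rho> (J n) V) d \<and> int d = a + 2 * int q ^ (n div 2)"
    using dim_V_fixed by blast
  have "\<exists>d. has_dim sc (fixed \<rho> (J n) Wp) d \<and> has_dim sc (fixed \<rho> (J n) Wm) d
     \<and> 2 * int d = a + 2 * int q ^ (n div 2)" if n: "n \<ge> N" for n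
  proof -
    obtain D where D: "has_dim sc (fixed \<rho> (J n) V) D" "int D = a + 2 * int q ^ (n div 2)" using N n by blast
    have sV: "sub (fixed \<rho> (J n) V)" using sub_fixed[OF subV J_GL2] .
    obtain d where d: "has_dim sc (fixed \<rho> (J n) Wp) d"
    proof (rule has_dim_subspace[OF D(1) sV])
      show "fixed \<rho> (J n) Wp \<subseteq> fixed \<rho> (J n) V" using sub_W unfolding fixed_def by blast
    qed
    obtain d' where d': "has_dim sc (fixed \<rho> (J n) Wm) d'"
    proof (rule has_dim_subspace[OF D(1) sV])
      show "fixed \<rho> (J n) Wm \<subseteq> fixed \<rho> (J n) V" using sub_W unfolding fixed_def by blast
    qed
    have sum: "D = e + e'" if "A \<inter> B = {0}" "ssum A B = V" "stable (Hgrp v) A" "stable (Hgrp v) B"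
      "has_dim sc (fixed \<rho> (J n) A) e" "has_dim sc (fixed \<rho> (J n) B) e'" for A B e e'
    proof -
      have s: "sub A" "sub B" using stableD(1)[OF that(3)] stableD(1)[OF that(4)] by simp_all
      have "fixed \<rho> (J n) V = ssum (fixed \<rho> (J n) A) (fixed \<rho> (J n) B)"
        using fixed_ssum[OF s that(1) J_GL2 invariant_J[OF that(3)] invariant_J[OF that(4)]] that(2) by simp
      moreover have "fixed \<rho> (J n) A \<inter> fixed \<rho> (J n) B = {0}"
      proof -
        have "0 \<in> fixed \<rho> (J n) A" "0 \<in> fixed \<rho> (J n) B"
          using sub_fixed[OF s(1) J_GL2] sub_fixed[OF s(2) J_GL2] subspD(1) by blast+
        moreover have "fixed \<rho> (J n) A \<subseteq> A" "fixed \<rho> (J n) B \<subseteq> B" by (auto simp: fixed_def)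
        ultimately show ?thesis using that(1) by blast
      qed
      ultimately have "has_dim sc (fixed \<rho> (J n) V) (e + e')"
        using has_dim_ssum[OF that(5,6) sub_fixed[OF s(1) J_GL2] sub_fixed[OF s(2) J_GL2]] by simp
      then show ?thesis using has_dim_unique[OF D(1)] sV by blast
    qed
    define p where "p = pw 1"
    have p: "p \<noteq> 0" "v p = 1" by (auto simp: p_def)
    \<comment> \<open>The normaliser of the Iwahori filtration outside H: its determinant -p has odd
      valuation.\<close>
    define g :: "'f mat2" where "g = (0, 1, p, 0)"
    have g: "g \<in> GL2" "odd (v (mdet g))" using p by (auto simp: g_def GL2_def)
    have gi: "minv g = (0, 1 / p, 1, 0)" using p by (simp add: g_def)
    have n1: "mmul (mmul (minv g) k) g \<in> J n" if k: "k \<in> J n" for k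
    proof -
      have "mmul (mmul (minv g) k) g \<in> SL2" using k g by (intro SL2_conj) auto
      then show ?thesis using k p SL2_GL2 unfolding gi by (cases k) (auto simp: g_def Iw_iff P_mult_iff P_mult_iff_right P_divide_iff)
    qed
    have n2: "mmul (mmul g k) (minv g) \<in> J n" if k: "k \<in> J n" for k
    proof -
      have "mmul (mmul g k) (minv g) \<in> SL2" using k g by (auto simp: SL2_def mdet_mmul mdet_minv GL2_def)
      then show ?thesis using k p SL2_GL2 unfolding gi by (cases k) (auto simp: g_def Iw_iff P_mult_iff P_mult_iff_right P_divide_iff)
    qed
    have "has_dim sc (fixed \<rho> (J n) (tr g Wp)) d"
      using fixed_tr[OF _ g(1) J_GL2 n1 n2, of Wp] has_dim_tr[OF g(1) sub_fixed[OF sub_W(1) J_GL2]] d sub_W by simp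
    \<comment> \<open>Wm and the translate of Wp are both complements of Wp. They need not be
      identified: each has fixed vectors of dimension D - d, and for the translate this number is
      d.\<close>
    then have "D = d + d" using sum[OF tr_Wp(1,2)[OF g] stable_Wp tr_Wp(3)[OF g] d] by simp
    moreover have "D = d + d'" using sum[OF Wsum(1) ssum_Wp_Wm stable_Wp stable_Wm d d'] .
    ultimately show ?thesis using d d' D(2) by (intro exI[of _ d]) auto
  qed
  then show ?thesis by blast
qed

text \<open>For odd j, Wp has no change at level j and Wm none at level j - 1, so their fixed
  vectors are those of J (2 j) and J (2 j - 1). For even j the two halves exchange roles.\<close>

lemma dim_fixed_Kc':
  "\<exists>N. \<forall>j\<ge>N. (\<exists>d. has_dim sc (fixed \<rho> (Kc' v j) Wp) d \<and> 2 * int d = a + 2 * int q ^ (if odd j then j else j - 1))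
     \<and> (\<exists>d. has_dim sc (fixed \<rho> (Kc' v j) Wm) d \<and> 2 * int d = a + 2 * int q ^ (if even j then j else j - 1))"
proof -
  obtain N where N: "\<And>n. n \<ge> N \<Longrightarrow> \<exists>d. has_dim sc (fixed \<rho> (J n) Wp) d \<and> has_dim sc (fixed \<rho> (J n) Wm) d
     \<and> 2 * int d = a + 2 * int q ^ (n div 2)" using dim_fixed_J by blast
  note S = stable_Hgrp_SL2[OF stable_Wp] stable_Hgrp_SL2[OF stable_Wm]
  show ?thesis
  proof (intro exI[of _ "Suc N"] allI impI)
    fix j assume j: "Suc N \<le> j"
    have up: "\<exists>d. has_dim sc (fixed \<rho> (J (2 * j)) Wp) d \<and> has_dim sc (fixed \<rho> (J (2 * j)) Wm) d
       \<and> 2 * int d = a + 2 * int q ^ j" using N[of "2 * j"] j by simp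
    have "(2 * j - 1) div 2 = j - 1" using j by auto
    then have lo: "\<exists>d. has_dim sc (fixed \<rho> (J (2 * j - 1)) Wp) d \<and> has_dim sc (fixed \<rho> (J (2 * j - 1)) Wm) d
       \<and> 2 * int d = a + 2 * int q ^ (j - 1)" using N[of "2 * j - 1"] j by simp
    show "(\<exists>d. has_dim sc (fixed \<rho> (Kc' v j) Wp) d \<and> 2 * int d = a + 2 * int q ^ (if odd j then j else j - 1))
     \<and> (\<exists>d. has_dim sc (fixed \<rho> (Kc' v j) Wm) d \<and> 2 * int d = a + 2 * int q ^ (if even j then j else j - 1))"
    proof (cases "odd j")
      case True
      have "fixed \<rho> (Kc' v j) Wp = fixed \<rho> (J (2 * j)) Wp"
        by (rule fixed_Kc'_upper[OF S(1) Wp_no_odd_jump]) (use True j in auto)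
      moreover have "fixed \<rho> (Kc' v j) Wm = fixed \<rho> (J (2 * j - 1)) Wm"
        by (rule fixed_Kc'_lower[OF S(2) Wm_no_even_jump]) (use True j in auto)
      ultimately show ?thesis using True up lo by auto
    next
      case False
      have "fixed \<rho> (Kc' v j) Wm = fixed \<rho> (J (2 * j)) Wm"
        by (rule fixed_Kc'_upper[OF S(2) Wm_no_even_jump]) (use False j in auto)
      moreover have "fixed \<rho> (Kc' v j) Wp = fixed \<rho> (J (2 * j - 1)) Wp"
        by (rule fixed_Kc'_lower[OF S(1) Wp_no_odd_jump]) (use False j in auto)
      ultimately show ?thesis using False up lo by auto
    qed
  qed
qed

end

section \<open>Averaging over congruence subgroups\<close>

text \<open>Applied to a union of subspaces this is their algebraic sum, also for infinite
  families.\<close>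

definition fsum :: "'v::ab_group_add set \<Rightarrow> 'v set" where
  "fsum X = {sum_list xs | xs. set xs \<subseteq> X}"

lemma sum_list_nonzero: "sum_list xs \<noteq> (0::'v::ab_group_add) \<Longrightarrow> \<exists>x\<in>set xs. x \<noteq> 0"
  by (induction xs) auto

lemma subset_fsum: "X \<subseteq> fsum X"
proof
  fix x assume "x \<in> X"
  then have "x = sum_list [x] \<and> set [x] \<subseteq> X" by simp
  then show "x \<in> fsum X" unfolding fsum_def by blast
qed

lemma fsum_subset: "subsp sc S \<Longrightarrow> X \<subseteq> S \<Longrightarrow> fsum X \<subseteq> S"
  unfolding fsum_def by (auto intro: subsp_sum_list)

lemma fsum_mono: "X \<subseteq> Y \<Longrightarrow> fsum X \<subseteq> fsum Y"
  unfolding fsum_def by blast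

context gl2rep begin

lemma sum_list_V: "set xs \<subseteq> V \<Longrightarrow> sum_list xs \<in> V"
  by (induction xs) auto

lemma sub_fsum: assumes "X \<subseteq> V" "\<And>x c. x \<in> X \<Longrightarrow> sc c x \<in> X" shows "sub (fsum X)"
proof
  show "subsp sc (fsum X)" unfolding subsp_def
  proof (intro conjI ballI allI)
    show "0 \<in> fsum X" unfolding fsum_def by (intro CollectI exI[of _ "[]"]) simp
    fix x y assume "x \<in> fsum X" "y \<in> fsum X"
    then obtain xs ys where "x = sum_list xs" "set xs \<subseteq> X" "y = sum_list ys" "set ys \<subseteq> X" by (auto simp: fsum_def)
    then show "x + y \<in> fsum X" unfolding fsum_def by (intro CollectI exI[of _ "xs @ ys"]) simp
  next
    fix c x assume "x \<in> fsum X"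
    then obtain xs where xs: "x = sum_list xs" "set xs \<subseteq> X" by (auto simp: fsum_def)
    have "sc c (sum_list xs) = sum_list (map (sc c) xs)" using xs(2)
    proof (induction xs)
      case (Cons y ys)
      then have "y \<in> V" "sum_list ys \<in> V" using assms(1) sum_list_V[of ys] by auto
      then show ?case using Cons by (simp add: sc_add)
    qed simp
    then show "sc c x \<in> fsum X" unfolding fsum_def using xs assms(2)
      by (intro CollectI exI[of _ "map (sc c) xs"]) auto
  qed
  show "fsum X \<subseteq> V" using fsum_subset[OF conjunct1[OF subV] assms(1)] .
qed

lemma rho_sum_list: "g \<in> GL2 \<Longrightarrow> set xs \<subseteq> V \<Longrightarrow> \<rho> g (sum_list xs) = sum_list (map (\<rho> g) xs)"
proof (induction xs)
  case (Cons x xs)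
  then show ?case using sum_list_V[of xs] by (simp add: rho_add)
qed simp

lemma stable_fsum:
  assumes "S \<subseteq> GL2" "\<And>W. W \<in> \<W> \<Longrightarrow> sub W" "\<And>W g. W \<in> \<W> \<Longrightarrow> g \<in> S \<Longrightarrow> \<exists>W'\<in>\<W>. tr g W \<subseteq> W'"
  shows "stable S (fsum (\<Union>\<W>))"
  unfolding stable_def invariant_def
proof (intro conjI ballI)
  have UV: "\<Union>\<W> \<subseteq> V" using assms(2) by blast
  have "sub (fsum (\<Union>\<W>))"
  proof (rule sub_fsum[OF UV])
    show "sc c x \<in> \<Union>\<W>" if "x \<in> \<Union>\<W>" for x c using that assms(2) subspD(3) by blast
  qed
  then show "subsp sc (fsum (\<Union>\<W>))" "fsum (\<Union>\<W>) \<subseteq> V" by auto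
  fix g w assume g: "g \<in> S" and "w \<in> fsum (\<Union>\<W>)"
  then obtain xs where xs: "w = sum_list xs" "set xs \<subseteq> \<Union>\<W>" by (auto simp: fsum_def)
  have "\<rho> g w = sum_list (map (\<rho> g) xs)" using xs UV assms(1) g rho_sum_list[of g xs] by auto
  moreover have "set (map (\<rho> g) xs) \<subseteq> \<Union>\<W>"
  proof
    fix y assume "y \<in> set (map (\<rho> g) xs)"
    then obtain x where x: "x \<in> set xs" "y = \<rho> g x" by auto
    then obtain W where W: "W \<in> \<W>" "x \<in> W" using xs by auto
    then obtain W' where "W' \<in> \<W>" "tr g W \<subseteq> W'" using assms(3)[OF W(1) g] by blast
    then show "y \<in> \<Union>\<W>" using x W by (auto simp: tr_def)
  qed
  ultimately show "\<rho> g w \<in> fsum (\<Union>\<W>)" unfolding fsum_def by blast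
qed

lemma stable_fsum_SL2: "(\<And>W. W \<in> \<W> \<Longrightarrow> stable SL2 W) \<Longrightarrow> stable SL2 (fsum (\<Union>\<W>))"
proof (rule stable_fsum)
  assume st: "\<And>W. W \<in> \<W> \<Longrightarrow> stable SL2 W"
  show "sub W" if "W \<in> \<W>" for W using st[OF that] by (rule stableD(1))
  show "\<exists>W'\<in>\<W>. tr g W \<subseteq> W'" if "W \<in> \<W>" "g \<in> SL2" for W g
    using stableD(2)[OF st[OF that(1)] that(2)] that(1) by (auto simp: tr_def)
qed auto

section \<open>Projection to vectors fixed by a larger congruence subgroup\<close>

lemma Kc'_SL2: "Kc' v j \<subseteq> SL2" by (auto simp: Kc'_def)
lemma Kc'_GL2: "Kc' v j \<subseteq> GL2" using Kc'_SL2 SL2_GL2 by blast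

text \<open>The determinant makes the fourth entries congruent too, so the quotient of the two
  matrices lies in K'_(n+1), which fixes \<open>w\<close>.\<close>

lemma Kc'_congruent:
  assumes k: "(a, b, c, d) \<in> Kc' v n" "(a', b', c', d') \<in> Kc' v n" and n: "n \<ge> 1"
    and cong: "a - a' \<in> P (int n + 1)" "b - b' \<in> P (int n + 1)" "c - c' \<in> P (int n + 1)"
    and w: "w \<in> V" "\<forall>k\<in>Kc' v (Suc n). \<rho> k w = w"
  shows "\<rho> (a, b, c, d) w = \<rho> (a', b', c', d') w"
proof -
  let ?N = "int n + 1"
  have I: "a - 1 \<in> P (int n)" "a' - 1 \<in> P (int n)" "d' - 1 \<in> P (int n)" "b \<in> P (int n)" "b' \<in> P (int n)"
      "c' \<in> P (int n)" "c \<in> P (int n)" "a * d - b * c = 1" "a' * d' - b' * c' = 1"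
    using k n by (auto simp: Kc'_iff SL2_def)
  have n1: "int n \<ge> 1" using n by simp
  note ua = one_unit[OF I(1) n1] and ua' = one_unit[OF I(2) n1] and ud' = one_unit[OF I(3) n1]
  have O: "b \<in> P 0" "b' \<in> P 0" "c' \<in> P 0" using I P_mono[of _ "int n" 0] by auto
  have "a * (d - d') = b * (c - c') + (b - b') * c' - (a - a') * d'"
  proof -
    have "a * d = 1 + b * c" "a' * d' = 1 + b' * c'" using I(8,9) by (simp_all add: algebra_simps)
    then show ?thesis by (simp add: algebra_simps)
  qed
  moreover have "b * (c - c') + (b - b') * c' - (a - a') * d' \<in> P ?N"
    by (rule P_diff[OF P_add[OF P_mult_le[OF O(1) cong(3)] P_mult_le[OF cong(2) O(3)]] P_mult_le[OF cong(1) ud'(3)]]) auto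
  ultimately have "a * (d - d') \<in> P ?N" by simp
  then have dd: "d - d' \<in> P ?N" using ua by (simp add: P_mult_iff)
  let ?m = "mmul (minv (a', b', c', d')) (a, b, c, d)"
  have GL: "(a, b, c, d) \<in> GL2" "(a', b', c', d') \<in> GL2" using k Kc'_GL2 by auto
  have SL: "?m \<in> SL2" using k Kc'_SL2 by (intro SL2_mmul SL2_minv) auto
  have m: "?m = (1 + (d' * (a - a') - b' * (c - c')), d' * (b - b') - b' * (d - d'),
      a' * (c - c') - c' * (a - a'), 1 + (a' * (d - d') - c' * (b - b')))"
  proof -
    have "minv (a', b', c', d') = (d', - b', - c', a')" using I(9) by simp
    then have "?m = (d' * a - b' * c, d' * b - b' * d, a' * c - c' * a, a' * d - c' * b)" by (simp add: algebra_simps)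
    moreover have "a' * d' = 1 + b' * c'" using I(9) by (simp add: algebra_simps)
    ultimately show ?thesis by (simp add: algebra_simps)
  qed
  have "d' * (a - a') - b' * (c - c') \<in> P ?N"
    by (rule P_diff[OF P_mult_le[OF ud'(3) cong(1)] P_mult_le[OF O(2) cong(3)]]) auto
  moreover have "d' * (b - b') - b' * (d - d') \<in> P ?N"
    by (rule P_diff[OF P_mult_le[OF ud'(3) cong(2)] P_mult_le[OF O(2) dd]]) auto
  moreover have "a' * (c - c') - c' * (a - a') \<in> P ?N"
    by (rule P_diff[OF P_mult_le[OF ua'(3) cong(3)] P_mult_le[OF O(3) cong(1)]]) auto
  moreover have "a' * (d - d') - c' * (b - b') \<in> P ?N"
    by (rule P_diff[OF P_mult_le[OF ua'(3) dd] P_mult_le[OF O(3) cong(2)]]) auto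
  ultimately have "?m \<in> Kc' v (Suc n)" using SL unfolding m by (simp add: Kc'_iff add.commute)
  then have mw: "\<rho> ?m w = w" using w by blast
  have "(a, b, c, d) = mmul (a', b', c', d') ?m"
    using GL by (simp only: mmul_assoc[symmetric] mmul_minv mmul_mone)
  then have "\<rho> (a, b, c, d) w = \<rho> (a', b', c', d') (\<rho> ?m w)"
    using rho_rho[OF GL(2) SL2_GL2[OF SL] w(1)] by simp
  then show ?thesis using mw by simp
qed

text \<open>Coordinates on K'_n / K'_(n+1): three entries are free and the last is forced by
  determinant one.\<close>

fun kap :: "'f \<Rightarrow> 'f \<Rightarrow> 'f \<Rightarrow> 'f mat2" where "kap x y z = (1 + x, y, z, (1 + y * z) / (1 + x))"

lemma kap_Kc':
  assumes "n \<ge> 1" "x \<in> P (int n)" "y \<in> P (int n)" "z \<in> P (int n)"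
  shows "kap x y z \<in> Kc' v n"
proof -
  have x1: "(1 + x) - 1 \<in> P (int n)" using assms by simp
  have n1: "int n \<ge> 1" using assms by simp
  note u = one_unit[OF x1 n1]
  have "y * z \<in> P (int n)" by (rule P_mult_le[OF assms(3,4)]) simp
  then have "(1 + y * z) / (1 + x) - 1 \<in> P (int n)" by (intro one_unit_divide[OF _ x1 n1]) simp
  then show ?thesis using assms u by (simp add: Kc'_iff SL2_def)
qed

text \<open>Unnormalised sum over K'_n / K'_(n+1), a group with q^3 elements.\<close>

definition Kavg :: "nat \<Rightarrow> 'v \<Rightarrow> 'v" where
  "Kavg n w = (let R = Rp (int n) (int n + 1) in \<Sum>x\<in>R. \<Sum>y\<in>R. \<Sum>z\<in>R. \<rho> (kap x y z) w)"

lemma kap_GL2: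
  assumes "n \<ge> 1" "x \<in> Rp (int n) (int n + 1)" "y \<in> Rp (int n) (int n + 1)" "z \<in> Rp (int n) (int n + 1)"
  shows "kap x y z \<in> Kc' v n" "kap x y z \<in> SL2" "kap x y z \<in> GL2"
proof -
  have "int n \<le> int n + 1" by simp
  from RpD(2)[OF this] show K: "kap x y z \<in> Kc' v n" using assms by (intro kap_Kc') simp_all
  then show "kap x y z \<in> SL2" "kap x y z \<in> GL2" using Kc'_SL2 Kc'_GL2 by blast+
qed

lemma Kavg_in:
  assumes "stable SL2 W" "w \<in> W" "n \<ge> 1" shows "Kavg n w \<in> W"
proof -
  have W: "subsp sc W" using stableD(1)[OF assms(1)] by simp
  show ?thesis unfolding Kavg_def Let_def
    by (intro subsp_sum[OF W] stableD(2)[OF assms(1) _ assms(2)] kap_GL2[OF assms(3)])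
qed

lemma Kavg_V: "w \<in> V \<Longrightarrow> n \<ge> 1 \<Longrightarrow> Kavg n w \<in> V"
  unfolding Kavg_def Let_def by (intro V_sum rho_V kap_GL2)

lemma Kavg_add: "w \<in> V \<Longrightarrow> w' \<in> V \<Longrightarrow> n \<ge> 1 \<Longrightarrow> Kavg n (w + w') = Kavg n w + Kavg n w'"
  unfolding Kavg_def Let_def sum.distrib[symmetric]
  by (intro sum.cong refl rho_add kap_GL2)

lemma Kavg_zero: "n \<ge> 1 \<Longrightarrow> Kavg n 0 = 0"
  unfolding Kavg_def Let_def by (intro sum.neutral ballI rho_0 kap_GL2)

lemma Kavg_fixed:
  assumes "w \<in> V" "\<forall>k\<in>Kc' v n. \<rho> k w = w" "n \<ge> 1"
  shows "Kavg n w = sc (of_nat (q * q * q)) w"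
proof -
  let ?R = "Rp (int n) (int n + 1)"
  have "Kavg n w = (\<Sum>x\<in>?R. \<Sum>y\<in>?R. \<Sum>z\<in>?R. sc 1 w)"
    unfolding Kavg_def Let_def using assms kap_GL2(1) by (intro sum.cong refl) (simp del: kap.simps)
  also have "\<dots> = sc (\<Sum>x\<in>?R. \<Sum>y\<in>?R. \<Sum>z\<in>?R. 1) w"
    using assms(1) by (simp only: sum_sc)
  also have "(\<Sum>x\<in>?R. \<Sum>y\<in>?R. \<Sum>z\<in>?R. 1) = (of_nat (q * q * q) :: 'r)"
    using Rp(2)[of "int n" "int n + 1"] by simp
  finally show ?thesis .
qed

text \<open>Left multiplication by k translates the three coordinates additively modulo P^(n+1), and
  sums over P^n / P^(n+1) are invariant under translation.\<close>

lemma Kavg_invariant: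
  assumes w: "w \<in> V" "\<forall>k\<in>Kc' v (Suc n). \<rho> k w = w" and n: "n \<ge> 1" and k: "k \<in> Kc' v n"
  shows "\<rho> k (Kavg n w) = Kavg n w"
proof -
  let ?R = "Rp (int n) (int n + 1)"
  let ?F = "\<lambda>x y z. \<rho> (kap x y z) w"
  have le: "int n \<le> int n + 1" by simp
  obtain a b c d where kk: "k = (a, b, c, d)" by (cases k)
  have I: "a - 1 \<in> P (int n)" "b \<in> P (int n)" "c \<in> P (int n)" "d - 1 \<in> P (int n)"
    using k n by (auto simp: kk Kc'_iff)
  have kG: "k \<in> GL2" using k Kc'_GL2 by auto
  have RP: "\<And>x. x \<in> ?R \<Longrightarrow> x \<in> P (int n)" using RpD(2)[OF le] .
  have per: "?F x y z = ?F x' y' z'"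
    if "x \<in> P (int n)" "y \<in> P (int n)" "z \<in> P (int n)" "x' \<in> P (int n)" "y' \<in> P (int n)" "z' \<in> P (int n)"
      "x - x' \<in> P (int n + 1)" "y - y' \<in> P (int n + 1)" "z - z' \<in> P (int n + 1)" for x y z x' y' z'
  proof -
    have 1: "kap x y z \<in> Kc' v n" "kap x' y' z' \<in> Kc' v n" using kap_Kc'[OF n] that by blast+
    show ?thesis unfolding kap.simps
      by (rule Kc'_congruent[OF 1[unfolded kap.simps] n _ that(8,9) w]) (use that(7) in simp)
  qed
  have step: "\<rho> k (?F x y z) = ?F ((a - 1) + x) (b + y) (c + z)"
    if R: "x \<in> ?R" "y \<in> ?R" "z \<in> ?R" for x y z
  proof -
    have xyz: "x \<in> P (int n)" "y \<in> P (int n)" "z \<in> P (int n)" using R RP by auto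
    have K1: "kap x y z \<in> Kc' v n" using kap_Kc'[OF n xyz] .
    have K2: "kap ((a - 1) + x) (b + y) (c + z) \<in> Kc' v n"
      by (rule kap_Kc'[OF n P_add[OF I(1) xyz(1)] P_add[OF I(2) xyz(2)] P_add[OF I(3) xyz(3)]])
    have K12: "mmul k (kap x y z) \<in> Kc' v n"
    proof -
      obtain e where e: "kap x y z = (1 + x, y, z, e)" "e - 1 \<in> P (int n)" using K1 n by (auto simp: Kc'_iff)
      have S: "mmul k (kap x y z) \<in> SL2" using k K1 Kc'_SL2 by (intro SL2_mmul) auto
      have n0: "int n \<le> int n + int n" by simp
      have a0: "a \<in> P 0" "d \<in> P 0" "1 + x \<in> P 0" "e \<in> P 0"
        using one_unit(3)[OF I(1)] one_unit(3)[OF I(4)] one_unit(3)[of "1 + x" "int n"] one_unit(3)[OF e(2)] n xyz by auto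
      have "(a * (1 + x) - 1) + b * z \<in> P (int n)"
        using one_unit_mult[of a "int n" "1 + x"] I xyz by (intro P_add P_mult_le[OF I(2) xyz(3) n0]) auto
      moreover have "a * y + b * e \<in> P (int n)"
        by (rule P_add[OF P_mult_le[OF a0(1) xyz(2)] P_mult_le[OF I(2) a0(4)]]) auto
      moreover have "c * (1 + x) + d * z \<in> P (int n)"
        by (rule P_add[OF P_mult_le[OF I(3) a0(3)] P_mult_le[OF a0(2) xyz(3)]]) auto
      moreover have "c * y + (d * e - 1) \<in> P (int n)"
        using one_unit_mult[of d "int n" e] I e by (intro P_add P_mult_le[OF I(3) xyz(2) n0]) auto
      ultimately show ?thesis using S n unfolding kk e(1) by (simp add: Kc'_iff algebra_simps)
    qed
    obtain e where e: "mmul k (kap x y z) = (a * (1 + x) + b * z, a * y + b * ((1 + y * z) / (1 + x)), c * (1 + x) + d * z, e)"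
      by (simp add: kk)
    define e' where "e' = (1 + y * z) / (1 + x)"
    have e'1: "e' - 1 \<in> P (int n)" using K1 n by (simp add: Kc'_iff e'_def)
    \<comment> \<open>Every error term is a product of two elements of P^n, so n \<ge> 1 puts it
      into P^(n+1).\<close>
    have N: "int n + 1 \<le> int n + int n" using n by simp
    have "\<rho> k (?F x y z) = \<rho> (mmul k (kap x y z)) w"
      using kG K1 Kc'_GL2 w(1) by (intro rho_rho) auto
    also have "\<dots> = ?F ((a - 1) + x) (b + y) (c + z)"
      unfolding e unfolding kap.simps
    proof (rule Kc'_congruent[OF K12[unfolded e] K2[unfolded kap.simps] n _ _ _ w])
      have "(a - 1) * x + b * z \<in> P (int n + 1)"
        by (rule P_add[OF P_mult_le[OF I(1) xyz(1) N] P_mult_le[OF I(2) xyz(3) N]])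
      then show "a * (1 + x) + b * z - (1 + (a - 1 + x)) \<in> P (int n + 1)" by (simp add: algebra_simps)
      have "(a - 1) * y + b * (e' - 1) \<in> P (int n + 1)"
        by (rule P_add[OF P_mult_le[OF I(1) xyz(2) N] P_mult_le[OF I(2) e'1 N]])
      then show "a * y + b * ((1 + y * z) / (1 + x)) - (b + y) \<in> P (int n + 1)"
        unfolding e'_def[symmetric] by (simp add: algebra_simps)
      have "c * x + (d - 1) * z \<in> P (int n + 1)"
        by (rule P_add[OF P_mult_le[OF I(3) xyz(1) N] P_mult_le[OF I(4) xyz(3) N]])
      then show "c * (1 + x) + d * z - (c + z) \<in> P (int n + 1)" by (simp add: algebra_simps)
    qed
    finally show ?thesis .
  qed
  have "\<rho> k (Kavg n w) = (\<Sum>x\<in>?R. \<Sum>y\<in>?R. \<Sum>z\<in>?R. \<rho> k (?F x y z))"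
    unfolding Kavg_def Let_def using kG w(1) n by (simp add: rho_sum kap_GL2 del: kap.simps)
  also have "\<dots> = (\<Sum>x\<in>?R. \<Sum>y\<in>?R. \<Sum>z\<in>?R. ?F ((a - 1) + x) (b + y) (c + z))"
    using step by (intro sum.cong refl) simp
  also have "\<dots> = (\<Sum>x\<in>?R. \<Sum>y\<in>?R. \<Sum>z\<in>?R. ?F ((a - 1) + x) (b + y) z)"
    by (intro sum.cong refl sum_Rp_shift[OF le I(3)] per) (use I RP P_add in auto)
  also have "\<dots> = (\<Sum>x\<in>?R. \<Sum>y\<in>?R. \<Sum>z\<in>?R. ?F ((a - 1) + x) y z)"
    by (intro sum.cong[OF refl] sum_Rp_shift[where f = "\<lambda>y. \<Sum>z\<in>?R. ?F (_ + _) y z", OF le I(2)] sum.cong[OF refl] per)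
      (use I RP P_add in auto)
  also have "\<dots> = (\<Sum>x\<in>?R. \<Sum>y\<in>?R. \<Sum>z\<in>?R. ?F x y z)"
    by (intro sum_Rp_shift[where f = "\<lambda>x. \<Sum>y\<in>?R. \<Sum>z\<in>?R. ?F x y z", OF le I(1)] sum.cong[OF refl] per)
      (use I RP P_add in auto)
  finally show ?thesis unfolding Kavg_def Let_def .
qed

lemma Kc'_mono: "1 \<le> i \<Longrightarrow> i \<le> j \<Longrightarrow> Kc' v j \<subseteq> Kc' v i"
  using Kc_mono by (auto simp: Kc'_def)

text \<open>Averaging one congruence level at a time keeps each summand in its own subspace and
  multiplies the fixed total by q^3, which is nonzero. At level j the total is still nonzero, so
  some summand is.\<close>

lemma sum_fixed_component:
  assumes "j \<ge> 1" "j \<le> N" "\<And>W. W \<in> \<W> \<Longrightarrow> stable SL2 W" "set xs \<subseteq> \<Union>\<W>"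
    "\<And>x. x \<in> set xs \<Longrightarrow> x \<in> fixed \<rho> (Kc' v N) V"
    "sum_list xs \<in> fixed \<rho> (Kc' v j) V" "sum_list xs \<noteq> 0"
  shows "\<exists>W\<in>\<W>. \<exists>x\<in>W. x \<noteq> 0 \<and> x \<in> fixed \<rho> (Kc' v j) V"
  using assms(2,4-)
proof (induction N arbitrary: xs rule: dec_induct)
  case base
  obtain x where x: "x \<in> set xs" "x \<noteq> 0" using sum_list_nonzero[OF base(4)] by blast
  then obtain W where "W \<in> \<W>" "x \<in> W" using base(1) by auto
  then show ?case using base(2)[OF x(1)] x(2) by blast
next
  case (step N)
  have N: "N \<ge> 1" using step assms(1) by simp
  have xsV: "set xs \<subseteq> V" using step.prems(2) by (auto simp: fixed_def)
  have lin: "Kavg N (sum_list ys) = sum_list (map (Kavg N) ys)" if "set ys \<subseteq> V" for ys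
    using that
  proof (induction ys)
    case (Cons y ys)
    then show ?case using sum_list_V[of ys] N by (simp add: Kavg_add)
  qed (simp add: Kavg_zero[OF N])
  have sV: "sum_list xs \<in> V" using sum_list_V[OF xsV] .
  have "\<forall>k\<in>Kc' v N. \<rho> k (sum_list xs) = sum_list xs"
    using step.prems(3) Kc'_mono[OF assms(1), of N] step.hyps(1) by (auto simp: fixed_def)
  then have e: "sum_list (map (Kavg N) xs) = sc (of_nat (q * q * q)) (sum_list xs)"
    using lin[OF xsV] Kavg_fixed[OF sV _ N] by simp
  show ?case
  proof (rule step.IH[of "map (Kavg N) xs"])
    show "set (map (Kavg N) xs) \<subseteq> \<Union>\<W>"
    proof
      fix y assume "y \<in> set (map (Kavg N) xs)"
      then obtain x where x: "x \<in> set xs" "y = Kavg N x" by auto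
      then obtain W where W: "W \<in> \<W>" "x \<in> W" using step.prems(1) by auto
      then show "y \<in> \<Union>\<W>" using Kavg_in[OF assms(3)[OF W(1)] W(2) N] x by auto
    qed
    show "x \<in> fixed \<rho> (Kc' v N) V" if hx: "x \<in> set (map (Kavg N) xs)" for x
    proof -
      obtain y where y: "y \<in> set xs" "x = Kavg N y" using hx by auto
      have "y \<in> V" "\<forall>k\<in>Kc' v (Suc N). \<rho> k y = y" using step.prems(2)[OF y(1)] by (auto simp: fixed_def)
      then show ?thesis using y N Kavg_invariant Kavg_V by (auto simp: fixed_def)
    qed
    have F: "sub (fixed \<rho> (Kc' v j) V)" using sub_fixed[OF subV Kc'_GL2] .
    show "sum_list (map (Kavg N) xs) \<in> fixed \<rho> (Kc' v j) V"
      unfolding e by (rule subspD(3)[OF conjunct1[OF F] step.prems(3)])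
    show "sum_list (map (Kavg N) xs) \<noteq> 0"
      unfolding e using sc_cancel[OF sV, of "of_nat (q * q * q)"] q_unit step.prems(4) by simp
  qed
qed

lemma fsum_fixed_component:
  assumes "j \<ge> 1" "\<And>W. W \<in> \<W> \<Longrightarrow> stable SL2 W" "f \<in> fsum (\<Union>\<W>)" "f \<noteq> 0" "f \<in> fixed \<rho> (Kc' v j) V"
  shows "\<exists>W\<in>\<W>. \<exists>x\<in>W. x \<noteq> 0 \<and> x \<in> fixed \<rho> (Kc' v j) V"
proof -
  obtain xs where xs: "f = sum_list xs" "set xs \<subseteq> \<Union>\<W>" using assms(3) by (auto simp: fsum_def)
  have V: "set xs \<subseteq> V" using xs(2) assms(2) stableD(1) by blast
  have "\<exists>N\<ge>j. \<forall>x\<in>set xs. x \<in> fixed \<rho> (Kc' v N) V" using V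
  proof (induction xs)
    case (Cons y ys)
    then obtain N where N: "N \<ge> j" "\<forall>x\<in>set ys. x \<in> fixed \<rho> (Kc' v N) V" by auto
    obtain i where i: "i \<ge> 1" "\<forall>k\<in>Kc v i. \<rho> k y = y" using Cons.prems smooth_ex[of y] by auto
    let ?M = "max N i"
    have "Kc' v ?M \<subseteq> Kc v i" using Kc_mono[OF i(1), of ?M] by (auto simp: Kc'_def)
    then have "y \<in> fixed \<rho> (Kc' v ?M) V" using i Cons.prems by (auto simp: fixed_def)
    moreover have "x \<in> fixed \<rho> (Kc' v ?M) V" if "x \<in> set ys" for x
      using N(2) that Kc'_mono[of N ?M] N(1) assms(1) by (auto simp: fixed_def)
    ultimately show ?case using N(1) by (intro exI[of _ ?M]) auto
  qed auto
  then obtain N where "N \<ge> j" "\<forall>x\<in>set xs. x \<in> fixed \<rho> (Kc' v N) V" by blast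
  then show ?thesis using sum_fixed_component[of j N \<W> xs] assms xs by blast
qed

end

section \<open>Irreducible constituents\<close>

lemma SL2_subset_GL2: "SL2 \<subseteq> GL2" using SL2_GL2 by blast

section \<open>Irreducible subrepresentations and their translates\<close>

context gl2rep begin

definition Irr :: "'v set set" where "Irr = {M. irred_on sc \<rho> SL2 M \<and> M \<subseteq> V}"

lemma Irr_iff: "M \<in> Irr \<longleftrightarrow> stable SL2 M \<and> M \<noteq> {0} \<and> (\<forall>A. stable SL2 A \<longrightarrow> A \<subseteq> M \<longrightarrow> A = {0} \<or> A = M)"
  unfolding Irr_def irred_on_def stable_def by blast

lemma IrrD:
  assumes "M \<in> Irr"
  shows "stable SL2 M" "M \<noteq> {0}" "stable SL2 A \<Longrightarrow> M \<inter> A = {0} \<or> M \<subseteq> A"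
  using assms stable_Int[of SL2 M A] unfolding Irr_iff by blast+

lemma Irr_disjoint: "M \<in> Irr \<Longrightarrow> M' \<in> Irr \<Longrightarrow> M \<noteq> M' \<Longrightarrow> M \<inter> M' = {0}"
  using IrrD(3)[of M M'] IrrD(3)[of M' M] IrrD(1) by blast

lemma stable_contains_0: "stable S A \<Longrightarrow> 0 \<in> A"
  using stableD(1) subspD(1) by blast

lemma tr_nonzero: "g \<in> GL2 \<Longrightarrow> sub A \<Longrightarrow> tr g A = {0} \<longleftrightarrow> A = {0}"
  by (metis tr_minv(1) tr_zero GL2_minv)

lemma Irr_tr:
  assumes M: "M \<in> Irr" and g: "g \<in> GL2" shows "tr g M \<in> Irr"
  unfolding Irr_iff
proof (intro conjI allI impI)
  have sM: "stable SL2 M" "sub M" using IrrD(1)[OF M] stableD(1) by blast+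
  show "stable SL2 (tr g M)" using stable_SL2_tr[OF sM(1) g] .
  show "tr g M \<noteq> {0}" using tr_nonzero[OF g sM(2)] IrrD(2)[OF M] by simp
  fix A assume A: "stable SL2 A" "A \<subseteq> tr g M"
  have sA: "sub A" using stableD(1)[OF A(1)] .
  have "tr (minv g) A \<subseteq> M" using tr_mono[OF A(2), of "minv g"] g sM by simp
  then have "tr (minv g) A = {0} \<or> tr (minv g) A = M"
    using M stable_SL2_tr[OF A(1) GL2_minv[OF g]] unfolding Irr_iff by blast
  then show "A = {0} \<or> A = tr g M"
    using tr_nonzero[OF GL2_minv[OF g] sA] tr_minv(2)[OF g, of A] sA by auto
qed

lemma orbit_stable:
  assumes "S = GL2 \<or> S = Hgrp v" "stable SL2 M"
  shows "stable S (fsum (\<Union>{tr g M | g. g \<in> S}))"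
proof -
  have S: "S \<subseteq> GL2" and mult: "\<And>g h. g \<in> S \<Longrightarrow> h \<in> S \<Longrightarrow> mmul g h \<in> S"
    using assms(1) by (auto simp: Hgrp_iff v_mdet_mmul simp del: mmul.simps)
  have sM: "sub M" using stableD(1)[OF assms(2)] .
  show ?thesis
  proof (rule stable_fsum[OF S])
    show "sub W" if "W \<in> {tr g M | g. g \<in> S}" for W using that S sub_tr[OF _ sM] by blast
    show "\<exists>W'\<in>{tr g M | g. g \<in> S}. tr h W \<subseteq> W'" if W: "W \<in> {tr g M | g. g \<in> S}" and h: "h \<in> S" for W h
    proof -
      obtain g where g: "g \<in> S" "W = tr g M" using W by blast
      have "h \<in> GL2" "g \<in> GL2" using g h S by auto
      then have "tr h W = tr (mmul h g) M" using tr_tr[of h g M] g sM by simp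
      then show ?thesis using mult[OF h g(1)] by blast
    qed
  qed
qed

lemma tr_mone: "A \<subseteq> V \<Longrightarrow> tr mone A = A"
  by (auto simp: tr_def image_iff subset_iff)

lemma orbit_contains:
  assumes "S = GL2 \<or> S = Hgrp v" "stable SL2 M"
  shows "M \<subseteq> fsum (\<Union>{tr g M | g. g \<in> S})"
proof -
  have "mone \<in> S" using assms(1) by (auto simp: Hgrp_iff)
  moreover have "tr mone M = M" using tr_mone stableD(1)[OF assms(2)] by blast
  ultimately have "M \<subseteq> \<Union>{tr g M | g. g \<in> S}" by blast
  then show ?thesis using subset_fsum by blast
qed

text \<open>Modulo SL2, which preserves \<open>M\<close>, \<open>g\<close> is a diagonal matrix
  whose entries have a ratio of valuation 0 or 1. Conjugation by it costs at most one level, a loss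
  independent of \<open>g\<close>.\<close>

lemma fixed_Kc'_tr_SL2:
  assumes M: "stable SL2 M" and g: "g \<in> GL2" and j: "j \<ge> 1"
    and x: "x \<in> tr g M" "x \<noteq> 0" "x \<in> fixed \<rho> (Kc' v j) V"
  shows "\<exists>y\<in>M. y \<noteq> 0 \<and> y \<in> fixed \<rho> (Kc' v (Suc j)) V"
proof -
  define e where "e = mdet g"
  have e: "e \<noteq> 0" using g by (simp add: e_def GL2_def)
  \<comment> \<open>Halving the valuation of the determinant balances the two diagonal entries;
    \<open>r\<close> is their ratio.\<close>
  define l where "l = v e div 2"
  define p where "p = pw l"
  have p: "p \<noteq> 0" "v p = l" by (auto simp: p_def)
  define r where "r = e / p / p"
  have "v r = v e - l - l" using e p by (simp add: r_def v_divide del: divide_divide_eq_left)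
  then have r: "r \<noteq> 0" "v r = v e mod 2" using e p by (auto simp: r_def l_def minus_mult_div_eq_mod)
  have rv: "0 \<le> v r" "v r \<le> 1" using r(2) by auto
  define h where "h = dg (e / p) p"
  have h: "h \<in> GL2" "mdet h = e" using e p by (auto simp: h_def)
  define s where "s = mmul (minv h) g"
  have s: "s \<in> SL2" using h g e by (simp add: s_def SL2_def mdet_mmul mdet_minv e_def)
  have gs: "g = mmul h s" using h by (simp add: s_def mmul_assoc[symmetric] del: mmul.simps)
  have sM: "sub M" using stableD(1)[OF M] .
  have "tr g M = tr h (tr s M)" using tr_tr[OF h(1) SL2_GL2[OF s], of M] gs sM by simp
  moreover have "tr s M = M" using tr_stable[OF M SL2_subset_GL2 s SL2_minv[OF s]] .
  ultimately obtain y where y: "y \<in> M" "x = \<rho> h y" using x(1) by (auto simp: tr_def)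
  have yV: "y \<in> V" using y sM by auto
  have "\<rho> k y = y" if k: "k \<in> Kc' v (Suc j)" for k
  proof -
    obtain a b c d where kk: "k = (a, b, c, d)" by (cases k)
    have I: "a - 1 \<in> P (int j + 1)" "b \<in> P (int j + 1)" "c \<in> P (int j + 1)" "d - 1 \<in> P (int j + 1)" "k \<in> SL2"
      using k by (auto simp: kk Kc'_iff add.commute)
    define k' where "k' = (a, b * r, c / r, d)"
    have "b * r \<in> P (int j)" using P_mono[OF I(2), of "int j - v r"] r rv by (simp add: P_mult_iff_right)
    moreover have "c / r \<in> P (int j)" using P_mono[OF I(3), of "int j + v r"] r rv by (simp add: P_divide_iff)
    moreover have "k' \<in> SL2" using I(5) r by (simp add: k'_def kk SL2_def)
    ultimately have k': "k' \<in> Kc' v j" using P_mono[OF I(1), of "int j"] P_mono[OF I(4), of "int j"] j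
      by (simp add: k'_def Kc'_iff)
    have "mmul h k = mmul k' h" using e p by (simp add: h_def k'_def kk r_def)
    then have "\<rho> h (\<rho> k y) = \<rho> k' (\<rho> h y)"
      using h(1) I(5) k' Kc'_GL2[of j] yV by (auto simp: rho_rho simp del: mmul.simps)
    also have "\<dots> = \<rho> h y" using x(3) k' y by (simp add: fixed_def)
    finally have "\<rho> (minv h) (\<rho> h (\<rho> k y)) = \<rho> (minv h) (\<rho> h y)" by simp
    then show ?thesis using h(1) I(5) yV by simp
  qed
  moreover have "y \<noteq> 0" using x(2) y h by auto
  ultimately show ?thesis using y yV by (auto simp: fixed_def)
qed

end

section \<open>Multiplicity freeness\<close>

context gl2germ begin

text \<open>This fails for general modules, as three lines in a plane show. Here one average is
  nonzero on w = x + y in \<open>C\<close>; as \<open>C\<close> shares no deep eigenvector with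
  \<open>A\<close> or \<open>B\<close>, the same average kills x and y.\<close>

lemma disjoint_ssum:
  assumes A: "stable SL2 A" and B: "stable SL2 B" and C: "stable SL2 C"
    and AC: "A \<inter> C = {0}" and BC: "B \<inter> C = {0}"
    and nontriv: "\<And>M. stable SL2 M \<Longrightarrow> M \<noteq> {0} \<Longrightarrow> \<exists>w\<in>M. \<exists>n. \<not> Ufix n w"
  shows "ssum A B \<inter> C = {0}"
proof (rule ccontr)
  assume "ssum A B \<inter> C \<noteq> {0}"
  moreover have "stable SL2 (ssum A B \<inter> C)" using A B C by (intro stable_Int stable_ssum) auto
  ultimately obtain w n0 where w: "w \<in> ssum A B" "w \<in> C" "\<not> Ufix n0 w" using nontriv by blast
  obtain x y where xy: "x \<in> A" "y \<in> B" "w = x + y" using w(1) by (auto elim: ssumE)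
  have V: "x \<in> V" "y \<in> V" "w \<in> V" using xy w stable_V[OF A] stable_V[OF B] stable_V[OF C] by auto
  obtain i1 where i1: "i1 \<ge> 1" "Kfix i1 x" using Kfix_ex[OF V(1)] by blast
  obtain i2 where i2: "i2 \<ge> 1" "Kfix i2 y" using Kfix_ex[OF V(2)] by blast
  obtain i3 where i3: "i3 \<ge> 1" "Kfix i3 w" using Kfix_ex[OF V(3)] by blast
  define i where "i = max i1 (max i2 i3)"
  have i: "i \<ge> 1" "Kfix i x" "Kfix i y" "Kfix i w"
    using i1 Kfix_mono[OF i1(2)] Kfix_mono[OF i2(2)] Kfix_mono[OF i3(2)] by (auto simp: i_def)
  note U = stable_SL2_uinv[OF A] stable_SL2_uinv[OF B] stable_SL2_uinv[OF C]
  obtain n t where nt: "avg n i t w \<noteq> 0" "\<forall>A C x y. uinv A \<longrightarrow> uinv C \<longrightarrow> A \<inter> C = {0} \<longrightarrow> x \<in> A \<longrightarrow> y \<in> C \<longrightarrow>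
      Kfix i x \<longrightarrow> Kfix i y \<longrightarrow> avg n i t x = 0 \<or> avg n i t y = 0"
    using separating_average[OF V(3) i(4,1) Kfix_Ufix[OF i(4)] order_refl w(3), of 0] by metis
  have "avg n i t x = 0" using nt(2)[rule_format, OF U(1,3) AC xy(1) w(2) i(2,4)] nt(1) by blast
  moreover have "avg n i t y = 0" using nt(2)[rule_format, OF U(2,3) BC xy(2) w(2) i(3,4)] nt(1) by blast
  ultimately show False using nt(1) V xy(3) by (simp add: avg_add)
qed

text \<open>An equivariant injection commutes with averaging, so \<open>A\<close> and its image in
  \<open>C\<close> would carry the same deep character.\<close>

lemma isomorphic_not_disjoint:
  assumes A: "stable SL2 A" and C: "stable SL2 C" and A0: "A \<noteq> {0}"
    and f: "\<And>x. x \<in> A \<Longrightarrow> f x \<in> C" "\<And>x y. x \<in> A \<Longrightarrow> y \<in> A \<Longrightarrow> f (x + y) = f x + f y"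
      "\<And>c x. x \<in> A \<Longrightarrow> f (sc c x) = sc c (f x)" "\<And>g x. g \<in> SL2 \<Longrightarrow> x \<in> A \<Longrightarrow> f (\<rho> g x) = \<rho> g (f x)"
      "\<And>x. x \<in> A \<Longrightarrow> f x = 0 \<Longrightarrow> x = 0"
    and nontriv: "\<And>M. stable SL2 M \<Longrightarrow> M \<noteq> {0} \<Longrightarrow> \<exists>w\<in>M. \<exists>n. \<not> Ufix n w"
  shows "A \<inter> C \<noteq> {0}"
proof
  assume AC: "A \<inter> C = {0}"
  obtain w n0 where w: "w \<in> A" "\<not> Ufix n0 w" using nontriv[OF A A0] by blast
  have V: "w \<in> V" "f w \<in> V" using w f(1) stable_V[OF A] stable_V[OF C] by auto
  obtain i1 where i1: "i1 \<ge> 1" "Kfix i1 w" using Kfix_ex[OF V(1)] by blast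
  obtain i2 where i2: "i2 \<ge> 1" "Kfix i2 (f w)" using Kfix_ex[OF V(2)] by blast
  define i where "i = max i1 i2"
  have i: "i \<ge> 1" "Kfix i w" "Kfix i (f w)"
    using i1 Kfix_mono[OF i1(2)] Kfix_mono[OF i2(2)] by (auto simp: i_def)
  note U = stable_SL2_uinv[OF A] stable_SL2_uinv[OF C]
  obtain n t where nt: "avg n i t w \<noteq> 0" "\<forall>A C x y. uinv A \<longrightarrow> uinv C \<longrightarrow> A \<inter> C = {0} \<longrightarrow> x \<in> A \<longrightarrow> y \<in> C \<longrightarrow>
      Kfix i x \<longrightarrow> Kfix i y \<longrightarrow> avg n i t x = 0 \<or> avg n i t y = 0"
    using separating_average[OF V(1) i(2,1) Kfix_Ufix[OF i(2)] order_refl w(2), of 0] by metis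
  have sA: "subsp sc A" using stableD(1)[OF A] by simp
  have f0: "f 0 = 0" using f(2)[of 0 0] subspD(1)[OF sA] by simp
  have uA: "\<rho> (uu x) w \<in> A" for x using stableD(2)[OF A uu_SL2 w(1)] .
  have fsum: "f (\<Sum>x\<in>I. h x) = (\<Sum>x\<in>I. f (h x))" if "\<And>x. x \<in> I \<Longrightarrow> h x \<in> A" for h and I :: "'f set"
    using that
  proof (induction I rule: infinite_finite_induct)
    case (insert x I)
    have "sum h I \<in> A" by (rule subsp_sum[OF sA]) (simp add: insert.prems)
    then show ?case using insert by (simp add: f(2))
  qed (use f0 in auto)
  have "f (avg n i t w) = avg n i t (f w)"
    unfolding avg_def using uA w(1) subspD(3)[OF sA] by (subst fsum) (auto simp: f(3,4))
  moreover have "avg n i t w \<in> A"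
    using avg_in[OF stableD(1)[OF A] _ w(1)] stableD(2)[OF A uu_SL2] by blast
  ultimately have "avg n i t (f w) \<noteq> 0" using f(5) nt(1) by metis
  then show False using nt(2)[rule_format, OF U AC w(1) f(1)[OF w(1)] i(2,3)] nt(1) by blast
qed

text \<open>Admissibility: K'_j contains a deep Iwahori subgroup, whose fixed vectors have a known
  finite dimension.\<close>

lemma dim_fixed_Kc'_V: assumes "j \<ge> 1" shows "\<exists>D. has_dim sc (fixed \<rho> (Kc' v j) V) D"
proof -
  obtain N where N: "\<forall>n\<ge>N. \<exists>d. has_dim sc (fixed \<rho> (Iw v n \<inter> SL2) V) d \<and> int d = a + 2 * int q ^ (n div 2)"
    using dim_V_fixed by blast
  define n where "n = 2 * (N + j)"
  have "n \<ge> N" by (simp add: n_def)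
  then obtain d where d: "has_dim sc (fixed \<rho> (Iw v n \<inter> SL2) V) d" using N by blast
  have "Iw v n \<inter> SL2 \<subseteq> Kc' v j"
  proof
    fix k assume k: "k \<in> Iw v n \<inter> SL2"
    obtain x b c e where kk: "k = (x, b, c, e)" by (cases k)
    have n2: "(n + 1) div 2 = N + j" "n div 2 = N + j" by (auto simp: n_def)
    have "y \<in> P (int j)" if "y \<in> P m" "m \<ge> int (N + j)" for y m using P_mono[OF that(1), of "int j"] that(2) by simp
    then show "k \<in> Kc' v j" using k unfolding kk Kc'_iff[OF assms] Int_iff Iw_iff n2 by auto
  qed
  then have "fixed \<rho> (Kc' v j) V \<subseteq> fixed \<rho> (Iw v n \<inter> SL2) V" by (auto simp: fixed_def)
  moreover have "sub (fixed \<rho> (Iw v n \<inter> SL2) V)" by (rule sub_fixed[OF subV]) auto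
  ultimately show ?thesis using has_dim_subspace[OF d] by blast
qed

end

section \<open>Existence and finiteness of irreducible subrepresentations\<close>

context gl2split begin

text \<open>Otherwise a nonzero vector is fixed by \<open>SL2\<close>, so \<open>SL2\<close> acts trivially on \<open>V\<close>, which is then
  its own space of fixed vectors and hence finite dimensional.\<close>
lemma not_U_fixed:
  assumes M: "stable SL2 M" "M \<noteq> {0}"
  shows "\<exists>w\<in>M. \<exists>n. \<not> Ufix n w"
proof (rule ccontr)
  assume no: "\<not> (\<exists>w\<in>M. \<exists>n. \<not> Ufix n w)"
  have U: "\<rho> (uu x) w = w" if "w \<in> M" for x w
  proof -
    have "Ufix (v x) w" using no that by blast
    then show ?thesis unfolding Ufix_def by (simp add: vpow_def)
  qed
  define s :: "'f mat2" where "s = (0, 1, -1, 0)"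
  have s: "s \<in> SL2" by (simp add: s_def SL2_def)
  have L: "\<rho> (ll x) w = w" if w: "w \<in> M" for x w
  proof -
    have wV: "w \<in> V" using stable_V[OF M(1) w] .
    have "\<rho> (uu (- x)) (\<rho> s w) = \<rho> s (\<rho> (ll x) w)"
      using wV s by (simp add: rho_rho) (simp add: s_def)
    then have "\<rho> (minv s) (\<rho> s (\<rho> (ll x) w)) = \<rho> (minv s) (\<rho> s w)"
      using U[OF stableD(2)[OF M(1) s w]] by simp
    then show ?thesis using s wV by simp
  qed
  have fix1: "\<rho> (a', b, c, d) w = w" if w: "w \<in> M" and c: "c \<noteq> 0" and g: "(a', b, c, d) \<in> SL2" for a' b c d w
  proof -
    have wV: "w \<in> V" using stable_V[OF M(1) w] .
    have det: "a' * d - b * c = 1" using g by (simp add: SL2_def)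
    \<comment> \<open>Matrices with nonzero lower left entry are products of upper, lower and upper
      unipotents.\<close>
    have "mmul (uu ((a' - 1) / c)) (mmul (ll c) (uu ((d - 1) / c))) = (a', b, c, d)"
      using c det by (simp add: field_simps)
    moreover have "\<rho> (uu ((a' - 1) / c)) (\<rho> (ll c) (\<rho> (uu ((d - 1) / c)) w)) = w" using U L w by simp
    ultimately show ?thesis using wV by (simp only: rho_rho uu_GL2 ll_GL2 GL2_mmul rho_V)
  qed
  have all: "\<rho> g w = w" if w: "w \<in> M" and g: "g \<in> SL2" for g w
  proof -
    obtain a' b c d where gg: "g = (a', b, c, d)" by (cases g)
    show ?thesis
    proof (cases "c = 0")
      case False
      then show ?thesis using fix1 w g gg by blast
    next
      case True
      have wV: "w \<in> V" using stable_V[OF M(1) w] .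
      have d: "d \<noteq> 0" using g True by (auto simp: gg SL2_def)
      \<comment> \<open>Multiplying by \<open>ll 1\<close> makes the lower left entry equal to d,
        which is nonzero, and so reduces to \<open>fix1\<close>.\<close>
      have "mmul g (ll 1) = (a' + b, b, d, d)" by (simp add: gg True)
      moreover have "(a' + b, b, d, d) \<in> SL2" using g True by (simp add: gg SL2_def algebra_simps)
      ultimately have "\<rho> (mmul g (ll 1)) w = w" using fix1[OF w d] by simp
      then have "\<rho> g (\<rho> (ll 1) w) = w" using wV g by (simp add: rho_rho del: mmul.simps)
      then show ?thesis using L[OF w] by simp
    qed
  qed
  define X where "X = fixed \<rho> SL2 V"
  have sX: "sub X" unfolding X_def by (rule sub_fixed[OF subV]) auto
  have "stable GL2 X" unfolding stable_def invariant_def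
  proof (intro conjI ballI)
    show "subsp sc X" "X \<subseteq> V" using sX by auto
    fix g :: "'f mat2" and w assume g: "g \<in> GL2" and w: "w \<in> X"
    have wV: "w \<in> V" using w sX by auto
    have "\<rho> k (\<rho> g w) = \<rho> g w" if k: "k \<in> SL2" for k
    proof -
      have "\<rho> k (\<rho> g w) = \<rho> g (\<rho> (mmul (mmul (minv g) k) g) w)"
        using wV g k by (simp add: rho_rho mmul_assoc[symmetric] del: mmul.simps)
      also have "\<rho> (mmul (mmul (minv g) k) g) w = w" using w SL2_conj[OF g k] by (simp add: X_def fixed_def)
      finally show ?thesis .
    qed
    then show "\<rho> g w \<in> X" using wV g by (simp add: X_def fixed_def)
  qed
  moreover have "M \<subseteq> X" using all stable_V[OF M(1)] by (auto simp: X_def fixed_def)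
  ultimately have "X = V" using V_irreducible[of X] M stable_contains_0[OF M(1)] by blast
  then have "fixed \<rho> (Kc' v 1) V = V" using Kc'_SL2[of 1] by (auto simp: X_def fixed_def)
  then obtain D where D: "has_dim sc V D" using dim_fixed_Kc'_V[of 1] by auto
  obtain x where "\<forall>i<Suc D. x i \<in> V" "indep_mod sc {0} (Suc D) x"
    using infdim unfolding infinite_dim_def by blast
  then show False using D unfolding has_dim_def has_qdim_def by blast
qed

lemmas ssum_disjoint = disjoint_ssum[OF _ _ _ _ _ not_U_fixed]

text \<open>A given vector involves finitely many summands, which are added one at a time while
  disjointness from \<open>C\<close> persists.\<close>

lemma fsum_disjoint:
  assumes W: "\<And>W. W \<in> \<W> \<Longrightarrow> stable SL2 W \<and> W \<inter> C = {0}" and C: "stable SL2 C"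
  shows "fsum (\<Union>\<W>) \<inter> C = {0}"
proof -
  have "\<exists>A. stable SL2 A \<and> A \<inter> C = {0} \<and> sum_list xs \<in> A" if "set xs \<subseteq> \<Union>\<W>" for xs
    using that
  proof (induction xs)
    case Nil
    have "stable SL2 {0}" by (rule stable_zero) auto
    then show ?case using stable_contains_0[OF C] by (intro exI[of _ "{0}"]) auto
  next
    case (Cons x xs)
    then obtain A where A: "stable SL2 A" "A \<inter> C = {0}" "sum_list xs \<in> A" by auto
    obtain W where W': "W \<in> \<W>" "x \<in> W" using Cons.prems by auto
    have "ssum W A \<inter> C = {0}" using ssum_disjoint[of W A C] A C W[OF W'(1)] by blast
    moreover have "stable SL2 (ssum W A)" using W[OF W'(1)] A by (intro stable_ssum) auto
    ultimately show ?case using ssumI[OF W'(2) A(3)] by auto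
  qed
  then have "fsum (\<Union>\<W>) \<inter> C \<subseteq> {0}" unfolding fsum_def by blast
  moreover have "0 \<in> fsum (\<Union>\<W>)" using stable_contains_0 stable_fsum_SL2 W by blast
  ultimately show ?thesis using stable_contains_0[OF C] by blast
qed

lemma GL2_orbit_spans:
  assumes "stable SL2 M" "M \<noteq> {0}" shows "fsum (\<Union>{tr g M | g. g \<in> GL2}) = V"
proof -
  have "stable GL2 (fsum (\<Union>{tr g M | g. g \<in> GL2}))" using orbit_stable[OF _ assms(1)] by blast
  moreover have "M \<subseteq> fsum (\<Union>{tr g M | g. g \<in> GL2})" using orbit_contains[OF _ assms(1)] by blast
  ultimately show ?thesis using V_irreducible assms stable_contains_0[OF assms(1)] by blast
qed

text \<open>One level serves all subrepresentations. The translates of \<open>M\<close> span V, so a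
  fixed nonzero vector of level j yields one in some translate, and pulling it back to
  \<open>M\<close> costs one level.\<close>

lemma Kc'_fixed_vectors:
  "\<exists>j\<ge>1. \<forall>M. stable SL2 M \<longrightarrow> M \<noteq> {0} \<longrightarrow> (\<exists>x\<in>M. x \<noteq> 0 \<and> x \<in> fixed \<rho> (Kc' v j) V)"
proof -
  obtain f where f: "f \<in> V" "f \<noteq> 0" using nonzero(1) V0 by blast
  obtain j where j: "j \<ge> 1" "\<forall>k\<in>Kc v j. \<rho> k f = f" using smooth_ex[OF f(1)] by blast
  have ff: "f \<in> fixed \<rho> (Kc' v j) V" using f j by (auto simp: fixed_def Kc'_def)
  have "\<exists>y\<in>M. y \<noteq> 0 \<and> y \<in> fixed \<rho> (Kc' v (Suc j)) V" if M: "stable SL2 M" "M \<noteq> {0}" for M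
  proof -
    define \<O> where "\<O> = {tr g M | g. g \<in> GL2}"
    have st: "stable SL2 W" if "W \<in> \<O>" for W
      using that stable_SL2_tr[OF M(1)] unfolding \<O>_def by blast
    have "f \<in> fsum (\<Union>\<O>)" using GL2_orbit_spans[OF M] f by (simp add: \<O>_def)
    from fsum_fixed_component[OF j(1) st this f(2) ff]
    obtain W x where W: "W \<in> \<O>" "x \<in> W" "x \<noteq> 0" "x \<in> fixed \<rho> (Kc' v j) V" by blast
    then obtain g where "g \<in> GL2" "W = tr g M" unfolding \<O>_def by blast
    then show ?thesis using fixed_Kc'_tr_SL2[OF M(1) _ j(1) _ W(3,4), of g] W(2) by simp
  qed
  then show ?thesis by (intro exI[of _ "Suc j"]) auto
qed

text \<open>Among the nonzero subrepresentations of \<open>M\<close> take one with the fewest fixed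
  vectors at the common level, and in it the part generated by one nonzero fixed vector. A smaller
  nonzero part has equally many fixed vectors, hence contains the generator.\<close>

lemma Irr_exists:
  assumes M: "stable SL2 M" "M \<noteq> {0}" shows "\<exists>N\<in>Irr. N \<subseteq> M"
proof -
  obtain j where j: "j \<ge> 1" "\<And>M. stable SL2 M \<Longrightarrow> M \<noteq> {0} \<Longrightarrow> \<exists>x\<in>M. x \<noteq> 0 \<and> x \<in> fixed \<rho> (Kc' v j) V"
    using Kc'_fixed_vectors by blast
  let ?F = "fixed \<rho> (Kc' v j) V"
  obtain D where D: "has_dim sc ?F D" using dim_fixed_Kc'_V[OF j(1)] by blast
  have sF: "sub ?F" using sub_fixed[OF subV Kc'_GL2] .
  have dim: "\<exists>d. has_dim sc (A \<inter> ?F) d" for A using has_dim_subspace[OF D sF, of "A \<inter> ?F"] by blast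
  define Q where "Q d \<longleftrightarrow> (\<exists>A. stable SL2 A \<and> A \<noteq> {0} \<and> A \<subseteq> M \<and> has_dim sc (A \<inter> ?F) d)" for d
  have "\<exists>d. Q d" using dim[of M] M unfolding Q_def by blast
  define d where "d = (LEAST d. Q d)"
  have "Q d" unfolding d_def using LeastI_ex[OF \<open>\<exists>d. Q d\<close>] .
  then obtain A where A: "stable SL2 A" "A \<noteq> {0}" "A \<subseteq> M" "has_dim sc (A \<inter> ?F) d" unfolding Q_def by blast
  obtain x where x: "x \<in> A" "x \<noteq> 0" "x \<in> ?F" using j(2)[OF A(1,2)] by blast
  define N where "N = \<Inter>{B. stable SL2 B \<and> x \<in> B}"
  have AN: "N \<subseteq> A" using A(1) x unfolding N_def by blast
  have xN: "x \<in> N" unfolding N_def by blast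
  have sN: "stable SL2 N" unfolding stable_def invariant_def
  proof (intro conjI ballI)
    have "subsp sc B" if "stable SL2 B" for B using stableD(1)[OF that] by simp
    then show "subsp sc N" using xN unfolding subsp_def[of sc N] N_def by (simp add: subsp_def)
    show "N \<subseteq> V" using AN stableD(1)[OF A(1)] by blast
    show "\<rho> g w \<in> N" if "g \<in> SL2" "w \<in> N" for g w using that stableD(2) unfolding N_def by blast
  qed
  have "N \<in> Irr" unfolding Irr_iff
  proof (intro conjI allI impI)
    show "stable SL2 N" by fact
    show "N \<noteq> {0}" using xN x by blast
    fix B assume B: "stable SL2 B" "B \<subseteq> N"
    show "B = {0} \<or> B = N"
    proof (cases "B = {0}")
      case B0: False
      obtain e where e: "has_dim sc (B \<inter> ?F) e" using dim by blast
      have "Q e" unfolding Q_def using B B0 e AN A(3) by blast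
      then have "d \<le> e" unfolding d_def by (rule Least_le)
      have sA: "sub (A \<inter> ?F)" "sub (B \<inter> ?F)" using sub_Int sF stableD(1)[OF A(1)] stableD(1)[OF B(1)] by blast+
      have BA: "B \<inter> ?F \<subseteq> A \<inter> ?F" using B(2) AN by blast
      obtain e' where "e' \<le> d" "has_dim sc (B \<inter> ?F) e'" using has_dim_subspace[OF A(4) sA(1) BA] by blast
      then have "e = d" using has_dim_unique[OF e, of e'] sA(2) \<open>d \<le> e\<close> by auto
      then have "B \<inter> ?F = A \<inter> ?F" using has_dim_subspace_eq[OF A(4) _ sA BA] e by blast
      then have "x \<in> B" using x by blast
      then have "B = N" using B unfolding N_def by blast
      then show ?thesis ..
    qed simp
  qed
  then show ?thesis using AN A(3) by blast
qed

text \<open>Fixed vectors chosen in distinct irreducible subrepresentations are independent, so the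
  dimension of the fixed vectors bounds their number.\<close>

lemma finite_Irr: "finite Irr"
proof -
  obtain j where j: "j \<ge> 1" "\<And>M. stable SL2 M \<Longrightarrow> M \<noteq> {0} \<Longrightarrow> \<exists>x\<in>M. x \<noteq> 0 \<and> x \<in> fixed \<rho> (Kc' v j) V"
    using Kc'_fixed_vectors by blast
  let ?F = "fixed \<rho> (Kc' v j) V"
  obtain D where D: "has_dim sc ?F D" using dim_fixed_Kc'_V[OF j(1)] by blast
  show ?thesis
  proof (rule ccontr)
    assume "infinite Irr"
    then obtain T where T: "T \<subseteq> Irr" "finite T" "card T = Suc D" using infinite_arbitrarily_large by blast
    obtain e where e: "bij_betw e {..<Suc D} T"
      using ex_bij_betw_nat_finite[OF T(2)] T(3) by (auto simp: atLeast0LessThan)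
    have eI: "e i \<in> Irr" if "i < Suc D" for i using e T(1) that by (auto simp: bij_betw_def)
    have ex: "\<exists>x. x \<in> e i \<and> x \<noteq> 0 \<and> x \<in> ?F" if "i < Suc D" for i
      using j(2)[OF IrrD(1,2)[OF eI[OF that]]] by blast
    define x where "x i = (SOME x. x \<in> e i \<and> x \<noteq> 0 \<and> x \<in> ?F)" for i
    have x: "x i \<in> e i \<and> x i \<noteq> 0 \<and> x i \<in> ?F" if "i < Suc D" for i
      using someI_ex[OF ex[OF that]] unfolding x_def .
    have xV: "x i \<in> V" if "i < Suc D" for i using x[OF that] by (simp add: fixed_def)
    have "indep_mod sc {0} (Suc D) x" unfolding indep_mod_def
    proof (intro allI impI)
      fix c k assume s: "(\<Sum>i<Suc D. sc (c i) (x i)) \<in> {0}" and k: "k < Suc D"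
      let ?\<W> = "e ` ({..<Suc D} - {k})"
      have W: "stable SL2 W \<and> W \<inter> e k = {0}" if hW: "W \<in> ?\<W>" for W
      proof -
        obtain i where i: "i < Suc D" "i \<noteq> k" "W = e i" using hW by auto
        have "e i \<noteq> e k" using e i k unfolding bij_betw_def inj_on_def by auto
        then show ?thesis using i Irr_disjoint[OF eI[OF i(1)] eI[OF k]] IrrD(1)[OF eI[OF i(1)]] by simp
      qed
      have stk: "stable SL2 (e k)" using IrrD(1)[OF eI[OF k]] .
      have stW: "stable SL2 (fsum (\<Union>?\<W>))" using stable_fsum_SL2 W by blast
      have "(\<Sum>i<Suc D. sc (c i) (x i)) = sc (c k) (x k) + (\<Sum>i\<in>{..<Suc D} - {k}. sc (c i) (x i))"
        using k by (intro sum.remove) auto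
      then have e1: "sc (c k) (x k) = - (\<Sum>i\<in>{..<Suc D} - {k}. sc (c i) (x i))"
        using s by (simp add: eq_neg_iff_add_eq_0 del: sum.lessThan_Suc)
      have "(\<Sum>i\<in>{..<Suc D} - {k}. sc (c i) (x i)) \<in> fsum (\<Union>?\<W>)"
      proof (rule subsp_sum[OF stable_subsp[OF stW]])
        fix i assume i: "i \<in> {..<Suc D} - {k}"
        then have "x i \<in> \<Union>?\<W>" using x[of i] by auto
        then have "x i \<in> fsum (\<Union>?\<W>)" using subset_fsum[of "\<Union>?\<W>"] by (rule rev_subsetD)
        then show "sc (c i) (x i) \<in> fsum (\<Union>?\<W>)"
          by (rule subspD(3)[OF stable_subsp[OF stW]])
      qed
      then have "sc (c k) (x k) \<in> fsum (\<Union>?\<W>)" using e1 sub_minus[OF stableD(1)[OF stW]] by simp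
      moreover have "sc (c k) (x k) \<in> e k"
        using subspD(3)[OF stable_subsp[OF stk]] x[OF k] by blast
      ultimately have "sc (c k) (x k) = 0" using fsum_disjoint[of ?\<W> "e k"] W stk by blast
      then show "c k = 0" using sc_cancel[OF xV[OF k]] x[OF k] by blast
    qed
    then show False using D x unfolding has_dim_def has_qdim_def by blast
  qed
qed

text \<open>If \<open>M'\<close> were none of the translates it would be disjoint from each of them,
  hence from their sum.\<close>

lemma orbit_member:
  assumes S: "S \<subseteq> GL2" and M: "M \<in> Irr" "M' \<in> Irr" "M' \<subseteq> fsum (\<Union>{tr g M | g. g \<in> S})"
  shows "\<exists>g\<in>S. M' = tr g M"
proof (rule ccontr)
  assume no: "\<not> (\<exists>g\<in>S. M' = tr g M)"
  have "stable SL2 W \<and> W \<inter> M' = {0}" if W: "W \<in> {tr g M | g. g \<in> S}" for W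
  proof -
    obtain g where g: "g \<in> S" "W = tr g M" using W by blast
    then have "W \<in> Irr" "W \<noteq> M'" using Irr_tr[OF M(1), of g] S no by blast+
    then show ?thesis using Irr_disjoint[OF _ M(2)] IrrD(1) by blast
  qed
  then have "fsum (\<Union>{tr g M | g. g \<in> S}) \<inter> M' = {0}" using fsum_disjoint IrrD(1)[OF M(2)] by blast
  then show False using M(3) IrrD(2)[OF M(2)] by blast
qed

section \<open>Complete reducibility\<close>

lemma fsum_Irr: "fsum (\<Union>Irr) = V"
proof
  have "stable SL2 V" using subV rho_V by (auto simp: stable_def invariant_def)
  then obtain M where M: "M \<in> Irr" using Irr_exists nonzero(1) by blast
  have "{tr g M | g. g \<in> GL2} \<subseteq> Irr" using Irr_tr[OF M] by blast
  then show "V \<subseteq> fsum (\<Union>Irr)"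
    using GL2_orbit_spans[OF IrrD(1,2)[OF M]] fsum_mono[OF Union_mono] by blast
  show "fsum (\<Union>Irr) \<subseteq> V" by (rule fsum_subset[OF conjunct1[OF subV]]) (auto simp: Irr_def)
qed

text \<open>A canonical choice: in the absence of multiplicities the irreducible subrepresentations
  outside \<open>B\<close> already sum to a complement.\<close>

definition complement :: "'v set \<Rightarrow> 'v set" where "complement B = fsum (\<Union>{M\<in>Irr. \<not> M \<subseteq> B})"

lemma complement:
  assumes B: "stable SL2 B"
  shows "stable SL2 (complement B)" "B \<inter> complement B = {0}" "ssum B (complement B) = V"
proof -
  have W: "stable SL2 M \<and> M \<inter> B = {0}" if "M \<in> {M\<in>Irr. \<not> M \<subseteq> B}" for M
    using IrrD(1)[of M] IrrD(3)[OF _ B, of M] that by simp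
  show sc: "stable SL2 (complement B)" unfolding complement_def
    by (rule stable_fsum_SL2) (rule conjunct1[OF W])
  have "fsum (\<Union>{M\<in>Irr. \<not> M \<subseteq> B}) \<inter> B = {0}" by (rule fsum_disjoint[OF W B])
  then show "B \<inter> complement B = {0}" unfolding complement_def by blast
  have ss: "stable SL2 (ssum B (complement B))" using stable_ssum[OF SL2_subset_GL2 B sc] .
  have "M \<subseteq> ssum B (complement B)" if M: "M \<in> Irr" for M
  proof (cases "M \<subseteq> B")
    case True
    then show ?thesis using ssumI[OF _ stable_contains_0[OF sc], of _ B] by fastforce
  next
    case False
    then have "M \<subseteq> \<Union>{M\<in>Irr. \<not> M \<subseteq> B}" using M by blast
    then have "M \<subseteq> complement B" unfolding complement_def using subset_fsum by (rule subset_trans)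
    then show ?thesis using ssumI[OF stable_contains_0[OF B], of _ "complement B"] by fastforce
  qed
  then have "fsum (\<Union>Irr) \<subseteq> ssum B (complement B)"
    using stableD(1)[OF ss] by (intro fsum_subset) auto
  then show "ssum B (complement B) = V" using fsum_Irr stableD(1)[OF ss] by blast
qed

section \<open>Subquotients and the subspaces representing them\<close>

abbreviation IQ :: "('v set \<times> 'v set) set" where "IQ \<equiv> irr_subquot sc \<rho> SL2 V"

text \<open>The copy of the subquotient inside V.\<close>

definition constit :: "'v set \<times> 'v set \<Rightarrow> 'v set" where "constit Q = fst Q \<inter> complement (snd Q)"

lemma IQ_iff: "(A, B) \<in> IQ \<longleftrightarrow> stable SL2 A \<and> stable SL2 B \<and> B \<subset> A \<and>
  (\<forall>C. stable SL2 C \<longrightarrow> B \<subseteq> C \<longrightarrow> C \<subseteq> A \<longrightarrow> C = B \<or> C = A)"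
proof -
  have 1: "(A, B) \<in> IQ \<longleftrightarrow> (subsp sc A \<and> subsp sc B \<and> B \<subset> A \<and> A \<subseteq> V \<and> invariant \<rho> SL2 A \<and> invariant \<rho> SL2 B)
      \<and> (\<forall>C. subsp sc C \<and> invariant \<rho> SL2 C \<and> B \<subseteq> C \<and> C \<subseteq> A \<longrightarrow> C = B \<or> C = A)"
    by (simp add: irr_subquot_def)
  have 2: "(subsp sc A \<and> subsp sc B \<and> B \<subset> A \<and> A \<subseteq> V \<and> invariant \<rho> SL2 A \<and> invariant \<rho> SL2 B)
      \<longleftrightarrow> stable SL2 A \<and> stable SL2 B \<and> B \<subset> A"
    by (auto simp: stable_def)
  have 3: "subsp sc C \<and> invariant \<rho> SL2 C \<and> B \<subseteq> C \<and> C \<subseteq> A \<longleftrightarrow> stable SL2 C \<and> B \<subseteq> C \<and> C \<subseteq> A"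
    if "stable SL2 A" for C using stableD(1)[OF that] by (auto simp: stable_def)
  show ?thesis
  proof (cases "stable SL2 A")
    case True
    show ?thesis unfolding 1 2 3[OF True] by (simp add: imp_conjL)
  next
    case False
    then show ?thesis unfolding 1 2 by simp
  qed
qed

lemma constit:
  assumes "(A, B) \<in> IQ"
  shows "constit (A, B) \<in> Irr" "ssum B (constit (A, B)) = A" "B \<inter> constit (A, B) = {0}"
proof -
  have A: "stable SL2 A" and B: "stable SL2 B" and BA: "B \<subset> A"
    and max: "\<And>C. stable SL2 C \<Longrightarrow> B \<subseteq> C \<Longrightarrow> C \<subseteq> A \<Longrightarrow> C = B \<or> C = A" using assms by (auto simp: IQ_iff)
  define C where "C = A \<inter> complement B"
  have C: "stable SL2 C" unfolding C_def using stable_Int[OF A complement(1)[OF B]] .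
  have sA: "sub A" "sub B" using stableD(1) A B by blast+
  show BC: "B \<inter> constit (A, B) = {0}" using complement(2)[OF B] stable_contains_0[OF A] BA by (auto simp: constit_def)
  show sum: "ssum B (constit (A, B)) = A"
  proof (intro equalityI subsetI)
    fix w assume "w \<in> ssum B (constit (A, B))"
    then show "w \<in> A" using BA subspD(2)[OF conjunct1[OF sA(1)]] by (auto simp: constit_def elim!: ssumE)
  next
    fix w assume w: "w \<in> A"
    then have "w \<in> ssum B (complement B)" using complement(3)[OF B] sA by auto
    then obtain x y where xy: "x \<in> B" "y \<in> complement B" "w = x + y" by (rule ssumE)
    then have "y = w - x" by simp
    then have "y \<in> A" using sub_diff[OF sA(1) w] xy BA by blast
    then show "w \<in> ssum B (constit (A, B))" using xy by (auto simp: constit_def intro: ssumI)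
  qed
  show "constit (A, B) \<in> Irr" unfolding Irr_iff
  proof (intro conjI allI impI)
    show "stable SL2 (constit (A, B))" using C by (simp add: constit_def C_def)
    show "constit (A, B) \<noteq> {0}"
    proof
      assume "constit (A, B) = {0}"
      then have "A = B" using sum by (auto simp: ssum_def)
      then show False using BA by simp
    qed
    fix D assume D: "stable SL2 D" "D \<subseteq> constit (A, B)"
    have sBD: "stable SL2 (ssum B D)" using stable_ssum[OF SL2_subset_GL2 B D(1)] .
    have "ssum B D \<subseteq> A" using D(2) sum unfolding ssum_def by blast
    moreover have "B \<subseteq> ssum B D" using ssumI[OF _ stable_contains_0[OF D(1)], of _ B] by fastforce
    ultimately consider "ssum B D = B" | "ssum B D = A" using max[OF sBD] by blast
    then show "D = {0} \<or> D = constit (A, B)"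
    proof cases
      case 1
      have "D \<subseteq> B" using 1 ssumI[OF stable_contains_0[OF B], of _ D] by fastforce
      then show ?thesis using D(2) BC stable_contains_0[OF D(1)] by blast
    next
      case 2
      have "constit (A, B) \<subseteq> D"
      proof
        fix c assume c: "c \<in> constit (A, B)"
        then have "c \<in> ssum B D" using 2 by (simp add: constit_def)
        then obtain b d where bd: "b \<in> B" "d \<in> D" "c = b + d" by (rule ssumE)
        then have "b = c - d" by simp
        then have "b \<in> constit (A, B)"
          using sub_diff[OF stableD(1)[OF C], of c d] c bd D(2) by (auto simp: C_def constit_def)
        then have "b = 0" using BC bd by blast
        then show "c \<in> D" using bd by simp
      qed
      then show ?thesis using D(2) by blast
    qed
  qed
qed

lemma projection_ex:
  assumes "(A, B) \<in> IQ"
  obtains p where "\<And>x. x \<in> A \<Longrightarrow> p x \<in> constit (A, B)" "\<And>x. x \<in> A \<Longrightarrow> x - p x \<in> B"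
    "\<And>x c. x \<in> A \<Longrightarrow> c \<in> constit (A, B) \<Longrightarrow> x - c \<in> B \<Longrightarrow> p x = c"
proof -
  note c = constit[OF assms]
  have sB: "sub B" using assms stableD(1) by (auto simp: IQ_iff)
  have sC: "sub (constit (A, B))" using stableD(1)[OF IrrD(1)[OF c(1)]] .
  have "\<exists>y. x \<in> A \<longrightarrow> y \<in> constit (A, B) \<and> x - y \<in> B" for x
  proof (cases "x \<in> A")
    case True
    then obtain b y where "b \<in> B" "y \<in> constit (A, B)" "x = b + y" using c(2) by (metis ssumE)
    then show ?thesis by (intro exI[of _ y]) auto
  qed auto
  then obtain p where p: "\<And>x. x \<in> A \<Longrightarrow> p x \<in> constit (A, B) \<and> x - p x \<in> B" by metis
  have "p x = y" if "x \<in> A" "y \<in> constit (A, B)" "x - y \<in> B" for x y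
  proof -
    have "p x - y = (x - y) - (x - p x)" by simp
    then have "p x - y \<in> B" using sub_diff[OF sB that(3)] p[OF that(1)] by metis
    moreover have "p x - y \<in> constit (A, B)" using sub_diff[OF sC] p that by blast
    ultimately have "p x - y = 0" using c(3) by blast
    then show ?thesis by simp
  qed
  then show ?thesis using that p by blast
qed

text \<open>Multiplicity freeness turns isomorphism classes into actual subspaces: disjoint
  irreducible subrepresentations are never isomorphic.\<close>

lemma sq_iso_iff:
  assumes Q: "Q \<in> IQ" and Q': "Q' \<in> IQ"
  shows "sq_iso sc \<rho> SL2 Q Q' \<longleftrightarrow> constit Q = constit Q'"
proof -
  obtain A B where AB: "Q = (A, B)" by (cases Q)
  obtain A' B' where AB': "Q' = (A', B')" by (cases Q')
  have IQ: "(A, B) \<in> IQ" "(A', B') \<in> IQ" using Q Q' AB AB' by auto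
  define C where "C = constit (A, B)"
  define C' where "C' = constit (A', B')"
  note c = constit[OF IQ(1), folded C_def] and c' = constit[OF IQ(2), folded C'_def]
  have st: "stable SL2 A" "stable SL2 B" "stable SL2 A'" "stable SL2 B'" using IQ by (auto simp: IQ_iff)
  have stC: "stable SL2 C" "stable SL2 C'" using c(1) c'(1) IrrD(1) by blast+
  note sA = stableD(1)[OF st(1)] and sB = stableD(1)[OF st(2)] and sA' = stableD(1)[OF st(3)]
    and sB' = stableD(1)[OF st(4)] and sC = stableD(1)[OF stC(1)] and sC' = stableD(1)[OF stC(2)]
  have CA: "C \<subseteq> A" "C' \<subseteq> A'" by (auto simp: C_def C'_def constit_def)
  show ?thesis
  proof
    assume "sq_iso sc \<rho> SL2 Q Q'"
    then obtain f where f: "\<forall>x\<in>A. f x \<in> A'" "\<forall>x\<in>A. f x \<in> B' \<longleftrightarrow> x \<in> B"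
      "\<forall>x\<in>A. \<forall>y\<in>A. f (x + y) - (f x + f y) \<in> B'" "\<forall>k. \<forall>x\<in>A. f (sc k x) - sc k (f x) \<in> B'"
      "\<forall>g\<in>SL2. \<forall>x\<in>A. f (\<rho> g x) - \<rho> g (f x) \<in> B'"
      unfolding sq_iso_def AB AB' by auto
    \<comment> \<open>\<open>f\<close> is linear and equivariant modulo \<open>B'\<close> only;
      following it by the projection along \<open>B'\<close> makes it an honest homomorphism into
      C'.\<close>
    obtain p where p: "\<And>x. x \<in> A' \<Longrightarrow> p x \<in> C'" "\<And>x. x \<in> A' \<Longrightarrow> x - p x \<in> B'"
      "\<And>x c. x \<in> A' \<Longrightarrow> c \<in> C' \<Longrightarrow> x - c \<in> B' \<Longrightarrow> p x = c"
      using projection_ex[OF IQ(2)] unfolding C'_def by blast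
    have fA: "f x \<in> A'" if "x \<in> C" for x using f(1) CA that by blast
    have "C \<inter> C' \<noteq> {0}"
    proof (rule isomorphic_not_disjoint[OF stC IrrD(2)[OF c(1)], where f = "\<lambda>x. p (f x)", OF _ _ _ _ _ not_U_fixed])
      show "p (f x) \<in> C'" if "x \<in> C" for x using p(1) fA that by blast
      show "p (f (x + y)) = p (f x) + p (f y)" if xy: "x \<in> C" "y \<in> C" for x y
      proof (rule p(3))
        show "f (x + y) \<in> A'" using fA subspD(2)[OF conjunct1[OF sC]] xy by blast
        show "p (f x) + p (f y) \<in> C'" using p(1) fA xy subspD(2)[OF conjunct1[OF sC']] by blast
        have "f (x + y) - (f x + f y) \<in> B'" using f(3) xy CA by blast
        moreover have "f x - p (f x) \<in> B'" "f y - p (f y) \<in> B'" using p(2) fA xy by blast+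
        ultimately have "(f (x + y) - (f x + f y)) + ((f x - p (f x)) + (f y - p (f y))) \<in> B'"
          using subspD(2)[OF conjunct1[OF sB']] by blast
        then show "f (x + y) - (p (f x) + p (f y)) \<in> B'" by (simp add: algebra_simps)
      qed
      show "p (f (sc k x)) = sc k (p (f x))" if x: "x \<in> C" for k x
      proof (rule p(3))
        show "f (sc k x) \<in> A'" using fA subspD(3)[OF conjunct1[OF sC]] x by blast
        show "sc k (p (f x)) \<in> C'" using p(1) fA x subspD(3)[OF conjunct1[OF sC']] by blast
        have "f (sc k x) - sc k (f x) \<in> B'" using f(4) x CA by blast
        moreover have "sc k (f x - p (f x)) \<in> B'" using p(2)[OF fA[OF x]] subspD(3)[OF conjunct1[OF sB']] by blast
        ultimately have "(f (sc k x) - sc k (f x)) + sc k (f x - p (f x)) \<in> B'"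
          using subspD(2)[OF conjunct1[OF sB']] by blast
        moreover have "f x \<in> V" "p (f x) \<in> V" using fA[OF x] p(1)[OF fA[OF x]] sA' sC' by auto
        ultimately show "f (sc k x) - sc k (p (f x)) \<in> B'" by (simp add: sc_diff)
      qed
      show "p (f (\<rho> g x)) = \<rho> g (p (f x))" if g: "g \<in> SL2" and x: "x \<in> C" for g x
      proof (rule p(3))
        show "f (\<rho> g x) \<in> A'" using fA stableD(2)[OF stC(1) g x] by blast
        show "\<rho> g (p (f x)) \<in> C'" using p(1)[OF fA[OF x]] stableD(2)[OF stC(2) g] by blast
        have "f (\<rho> g x) - \<rho> g (f x) \<in> B'" using f(5) g x CA by blast
        moreover have "\<rho> g (f x - p (f x)) \<in> B'" using p(2)[OF fA[OF x]] stableD(2)[OF st(4) g] by blast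
        ultimately have "(f (\<rho> g x) - \<rho> g (f x)) + \<rho> g (f x - p (f x)) \<in> B'"
          using subspD(2)[OF conjunct1[OF sB']] by blast
        moreover have "f x \<in> V" "p (f x) \<in> V" using fA[OF x] p(1)[OF fA[OF x]] sA' sC' by auto
        ultimately show "f (\<rho> g x) - \<rho> g (p (f x)) \<in> B'" using g by (simp add: rho_diff)
      qed
      show "x = 0" if x: "x \<in> C" and 0: "p (f x) = 0" for x
      proof -
        have "f x \<in> B'" using p(2)[OF fA[OF x]] 0 by simp
        then have "x \<in> B" using f(2) x CA by blast
        then show ?thesis using c(3) x by blast
      qed
    qed
    then have "C = C'" using Irr_disjoint[OF c(1) c'(1)] by blast
    then show "constit Q = constit Q'" by (simp add: AB AB' C_def C'_def)
  next
    assume "constit Q = constit Q'"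
    then have CC: "C' = C" by (simp add: AB AB' C_def C'_def)
    \<comment> \<open>With equal constituents, the projection of \<open>A\<close> along
      \<open>B\<close> already lands in \<open>A'\<close> and induces the isomorphism.\<close>
    obtain p where p: "\<And>x. x \<in> A \<Longrightarrow> p x \<in> C" "\<And>x. x \<in> A \<Longrightarrow> x - p x \<in> B"
      "\<And>x c. x \<in> A \<Longrightarrow> c \<in> C \<Longrightarrow> x - c \<in> B \<Longrightarrow> p x = c"
      using projection_ex[OF IQ(1)] unfolding C_def by blast
    have B'0: "0 \<in> B'" by (rule stable_contains_0[OF st(4)])
    have pA: "p x \<in> A'" if "x \<in> A" for x using p(1)[OF that] CC CA by blast
    have add: "p (x + y) = p x + p y" if xy: "x \<in> A" "y \<in> A" for x y
    proof (rule p(3))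
      show "x + y \<in> A" "p x + p y \<in> C" using xy p(1) subspD(2)[OF conjunct1[OF sA]] subspD(2)[OF conjunct1[OF sC]] by blast+
      have "(x - p x) + (y - p y) \<in> B" using p(2) xy subspD(2)[OF conjunct1[OF sB]] by blast
      then show "x + y - (p x + p y) \<in> B" by (simp add: algebra_simps)
    qed
    have scl: "p (sc k x) = sc k (p x)" if x: "x \<in> A" for k x
    proof (rule p(3))
      show "sc k x \<in> A" "sc k (p x) \<in> C" using x p(1) subspD(3)[OF conjunct1[OF sA]] subspD(3)[OF conjunct1[OF sC]] by blast+
      have "sc k (x - p x) \<in> B" using p(2)[OF x] subspD(3)[OF conjunct1[OF sB]] by blast
      moreover have "x \<in> V" "p x \<in> V" using x p(1)[OF x] sA sC by auto
      ultimately show "sc k x - sc k (p x) \<in> B" by (simp add: sc_diff)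
    qed
    have eqv: "p (\<rho> g x) = \<rho> g (p x)" if g: "g \<in> SL2" and x: "x \<in> A" for g x
    proof (rule p(3))
      show "\<rho> g x \<in> A" "\<rho> g (p x) \<in> C" using x p(1)[OF x] stableD(2)[OF st(1) g] stableD(2)[OF stC(1) g] by blast+
      have "\<rho> g (x - p x) \<in> B" using p(2)[OF x] stableD(2)[OF st(2) g] by blast
      moreover have "x \<in> V" "p x \<in> V" using x p(1)[OF x] sA sC by auto
      ultimately show "\<rho> g x - \<rho> g (p x) \<in> B" using g by (simp add: rho_diff)
    qed
    have ker: "p x \<in> B' \<longleftrightarrow> x \<in> B" if x: "x \<in> A" for x
    proof
      assume "p x \<in> B'"
      then have "p x = 0" using p(1)[OF x] c'(3) CC by blast
      then show "x \<in> B" using p(2)[OF x] by simp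
    next
      assume "x \<in> B"
      then have "p x = 0" using p(3)[OF x stable_contains_0[OF stC(1)]] by simp
      then show "p x \<in> B'" using B'0 by simp
    qed
    have onto: "\<exists>x\<in>A. p x - y \<in> B'" if y: "y \<in> A'" for y
    proof -
      obtain b k where bk: "b \<in> B'" "k \<in> C'" "y = b + k" using y c'(2) by (metis ssumE)
      have kA: "k \<in> A" "k \<in> C" using bk CC CA by blast+
      have "p k = k" using p(3)[OF kA] stable_contains_0[OF st(2)] by simp
      moreover have "k - y \<in> B'" using bk sub_minus[OF sB' bk(1)] by simp
      ultimately show ?thesis using kA by (intro bexI[of _ k]) auto
    qed
    show "sq_iso sc \<rho> SL2 Q Q'" unfolding sq_iso_def AB AB' prod.case
      using pA ker onto add scl eqv B'0 by (intro exI[of _ p]) simp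
  qed
qed

lemma Irr_IQ: assumes "M \<in> Irr" shows "(M, {0}) \<in> IQ" "constit (M, {0}) = M"
proof -
  have z: "stable SL2 {0}" by (rule stable_zero) auto
  note st = IrrD(1)[OF assms]
  show "(M, {0}) \<in> IQ" unfolding IQ_iff
  proof (intro conjI allI impI)
    show "{0} \<subset> M" using stable_contains_0[OF st] IrrD(2)[OF assms] by blast
    show "C = {0} \<or> C = M" if "stable SL2 C" "{0} \<subseteq> C" "C \<subseteq> M" for C using that assms unfolding Irr_iff by blast
  qed (use st z in auto)
  have "complement {0} = V" using complement(3)[OF z] by (auto simp: ssum_def)
  then show "constit (M, {0}) = M" using stableD(1)[OF st] by (auto simp: constit_def)
qed

lemma card_Lset: "card (Lset sc \<rho> SL2 V) = card Irr"
proof -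
  define cls where "cls M = {Q\<in>IQ. constit Q = M}" for M
  let ?R = "{(Q, Q'). Q \<in> IQ \<and> Q' \<in> IQ \<and> sq_iso sc \<rho> SL2 Q Q'}"
  have cl: "?R `` {Q} = cls (constit Q)" if "Q \<in> IQ" for Q
    using that sq_iso_iff[OF that] unfolding cls_def by auto
  have compIQ: "constit Q \<in> Irr" if "Q \<in> IQ" for Q using constit(1) that by (cases Q) simp
  have "Lset sc \<rho> SL2 V = cls ` Irr"
  proof (intro equalityI subsetI)
    fix X assume "X \<in> Lset sc \<rho> SL2 V"
    then obtain Q where Q: "Q \<in> IQ" "X = ?R `` {Q}" unfolding Lset_def by (rule quotientE)
    have "X = cls (constit Q)" using cl[OF Q(1)] Q(2) by simp
    then show "X \<in> cls ` Irr" using compIQ[OF Q(1)] by blast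
  next
    fix X assume "X \<in> cls ` Irr"
    then obtain M where M: "M \<in> Irr" "X = cls M" by blast
    then have "X = ?R `` {(M, {0})}" using cl[OF Irr_IQ(1)[OF M(1)]] Irr_IQ(2)[OF M(1)] by simp
    then show "X \<in> Lset sc \<rho> SL2 V" unfolding Lset_def using quotientI[OF Irr_IQ(1)[OF M(1)]] by blast
  qed
  moreover have "inj_on cls Irr"
  proof (rule inj_onI)
    fix M M' assume M: "M \<in> Irr" "M' \<in> Irr" "cls M = cls M'"
    have "(M, {0}) \<in> cls M" using Irr_IQ[OF M(1)] by (simp add: cls_def)
    then have "(M, {0}) \<in> cls M'" using M(3) by simp
    then show "M = M'" using Irr_IQ[OF M(1)] by (simp add: cls_def)
  qed
  ultimately show ?thesis by (simp add: card_image)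
qed

lemma occurs_in_iff:
  assumes Q: "Q \<in> IQ" and W: "W \<subseteq> V"
  shows "occurs_in sc \<rho> SL2 Q W \<longleftrightarrow> constit Q \<subseteq> W"
proof
  assume "occurs_in sc \<rho> SL2 Q W"
  then obtain M where M: "irred_on sc \<rho> SL2 M" "M \<subseteq> W" "sq_iso sc \<rho> SL2 Q (M, {0})" unfolding occurs_in_def by blast
  have MI: "M \<in> Irr" using M W by (auto simp: Irr_def)
  have "constit Q = M" using sq_iso_iff[OF Q Irr_IQ(1)[OF MI]] M(3) Irr_IQ(2)[OF MI] by simp
  then show "constit Q \<subseteq> W" using M by simp
next
  assume C: "constit Q \<subseteq> W"
  have CI: "constit Q \<in> Irr" using constit(1) Q by (cases Q) simp
  then have "sq_iso sc \<rho> SL2 Q (constit Q, {0})" using sq_iso_iff[OF Q Irr_IQ(1)[OF CI]] Irr_IQ(2)[OF CI] by simp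
  then show "occurs_in sc \<rho> SL2 Q W" unfolding occurs_in_def using CI C by (auto simp: Irr_def)
qed

text \<open>The projection along \<open>B\<close> is equivariant. For y in its image, k y - y lies
  in both \<open>B\<close> and \<open>C\<close>, so vectors fixed modulo \<open>B\<close> project to
  fixed vectors.\<close>

lemma qdim_qfixed:
  assumes IQ: "(A, B) \<in> IQ"
  shows "has_qdim sc B (qfixed \<rho> (Kc' v j) A B) n \<longleftrightarrow> has_dim sc (fixed \<rho> (Kc' v j) (constit (A, B))) n"
proof -
  define C where "C = constit (A, B)"
  note c = constit[OF IQ, folded C_def]
  have st: "stable SL2 A" "stable SL2 B" using IQ by (auto simp: IQ_iff)
  have stC: "stable SL2 C" using c(1) IrrD(1) by blast
  note sA = stableD(1)[OF st(1)] and sB = stableD(1)[OF st(2)] and sC = stableD(1)[OF stC]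
  note dA = subspD[OF conjunct1[OF sA]] and dB = subspD[OF conjunct1[OF sB]] and dC = subspD[OF conjunct1[OF sC]]
  have CA: "C \<subseteq> A" by (auto simp: C_def constit_def)
  obtain p where p: "\<And>x. x \<in> A \<Longrightarrow> p x \<in> C" "\<And>x. x \<in> A \<Longrightarrow> x - p x \<in> B"
    "\<And>x c. x \<in> A \<Longrightarrow> c \<in> C \<Longrightarrow> x - c \<in> B \<Longrightarrow> p x = c"
    using projection_ex[OF IQ] unfolding C_def by blast
  let ?K = "Kc' v j" and ?X = "qfixed \<rho> (Kc' v j) A B"
  have V: "x \<in> V" if "x \<in> A" for x using sA that by auto
  have XA: "?X \<subseteq> A" by (auto simp: qfixed_def)
  have sX: "subsp sc ?X" unfolding subsp_def
  proof (intro conjI ballI allI)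
    show "0 \<in> ?X" using dA(1) dB(1) Kc'_GL2 rho_0 by (auto simp: qfixed_def subset_iff)
    fix x y assume xy: "x \<in> ?X" "y \<in> ?X"
    have "\<rho> k (x + y) - (x + y) \<in> B" if k: "k \<in> ?K" for k
    proof -
      have "(\<rho> k x - x) + (\<rho> k y - y) \<in> B" using xy k dB(2) by (simp add: qfixed_def)
      moreover have "\<rho> k (x + y) = \<rho> k x + \<rho> k y" using xy k Kc'_GL2 V XA by (intro rho_add) auto
      ultimately show ?thesis by (simp add: algebra_simps)
    qed
    then show "x + y \<in> ?X" using xy dA(2) by (simp add: qfixed_def)
  next
    fix l x assume x: "x \<in> ?X"
    have "\<rho> k (sc l x) - sc l x \<in> B" if k: "k \<in> ?K" for k
    proof -
      have "sc l (\<rho> k x - x) \<in> B" using x k dB(3) by (simp add: qfixed_def)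
      moreover have "x \<in> V" "k \<in> GL2" using x k Kc'_GL2 V XA by auto
      ultimately show ?thesis by (simp add: rho_sc sc_diff)
    qed
    then show "sc l x \<in> ?X" using x dA(3) by (simp add: qfixed_def)
  qed
  have "has_qdim sc B ?X n \<longleftrightarrow> has_dim sc (fixed \<rho> ?K C) n"
  proof (rule has_qdim_transfer[OF vs_axioms sX, where f = p])
    show "?X \<subseteq> V" using XA sA by blast
    show "p (x + y) = p x + p y" if xy: "x \<in> ?X" "y \<in> ?X" for x y
    proof (rule p(3))
      show "x + y \<in> A" "p x + p y \<in> C" using xy XA p(1) dA(2) dC(2) by blast+
      have "(x - p x) + (y - p y) \<in> B" using p(2) xy XA dB(2) by blast
      then show "x + y - (p x + p y) \<in> B" by (simp add: algebra_simps)
    qed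
    show "p (sc k x) = sc k (p x)" if x: "x \<in> ?X" for k x
    proof (rule p(3))
      have xA: "x \<in> A" using x XA by blast
      show "sc k x \<in> A" "sc k (p x) \<in> C" using xA p(1) dA(3) dC(3) by blast+
      have "sc k (x - p x) \<in> B" using p(2)[OF xA] dB(3) by blast
      moreover have "x \<in> V" "p x \<in> V" using xA p(1)[OF xA] CA V by auto
      ultimately show "sc k x - sc k (p x) \<in> B" by (simp add: sc_diff)
    qed
    show "p x = 0 \<longleftrightarrow> x \<in> B" if x: "x \<in> ?X" for x
      using p(2)[of x] p(3)[of x 0] x XA dC(1) by auto
    show "p ` ?X = fixed \<rho> ?K C"
    proof (intro equalityI subsetI)
      fix y assume "y \<in> p ` ?X"
      then obtain x where x: "x \<in> ?X" "y = p x" by blast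
      have xA: "x \<in> A" and yC: "y \<in> C" using x XA p(1) by auto
      have "\<rho> k y = y" if k: "k \<in> ?K" for k
      proof -
        have kS: "k \<in> SL2" using k Kc'_SL2 by blast
        have yV: "y \<in> V" "x \<in> V" using V xA yC CA by auto
        have "\<rho> k (x - y) \<in> B" using p(2)[OF xA] x(2) stableD(2)[OF st(2) kS] by blast
        then have "\<rho> k x - \<rho> k y \<in> B" using yV kS by (simp add: rho_diff)
        moreover have "\<rho> k x - x \<in> B" using x(1) k by (simp add: qfixed_def)
        moreover have "x - y \<in> B" using p(2)[OF xA] x(2) by simp
        ultimately have "((\<rho> k x - x) + (x - y)) - (\<rho> k x - \<rho> k y) \<in> B" using dB(2) sub_diff[OF sB] by blast
        then have "\<rho> k y - y \<in> B" by simp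
        moreover have "\<rho> k y - y \<in> C" using sub_diff[OF sC stableD(2)[OF stC kS yC] yC] .
        ultimately have "\<rho> k y - y = 0" using c(3) by blast
        then show ?thesis by simp
      qed
      then show "y \<in> fixed \<rho> ?K C" using yC by (simp add: fixed_def)
    next
      fix y assume y: "y \<in> fixed \<rho> ?K C"
      then have yC: "y \<in> C" by (simp add: fixed_def)
      have "p y = y" using p(3)[of y y] yC CA dB(1) by auto
      moreover have "y \<in> ?X" using y CA dB(1) by (auto simp: fixed_def qfixed_def)
      ultimately show "y \<in> p ` ?X" by force
    qed
  qed
  then show ?thesis by (simp add: C_def)
qed

end

section \<open>Distribution of the constituents over the two halves\<close>

context gl2split begin

definition part :: "'v set \<Rightarrow> 'v set set" where "part W = {M\<in>Irr. M \<subseteq> W}"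

lemma Irr_part: assumes "M \<in> Irr" shows "M \<in> part Wp \<union> part Wm"
proof (rule ccontr)
  assume "M \<notin> part Wp \<union> part Wm"
  then have "Wp \<inter> M = {0}" "Wm \<inter> M = {0}"
    using IrrD(3)[OF assms stable_Hgrp_SL2[OF stable_Wp]] IrrD(3)[OF assms stable_Hgrp_SL2[OF stable_Wm]] assms
    by (auto simp: part_def)
  then have "ssum Wp Wm \<inter> M = {0}"
    using ssum_disjoint[OF stable_Hgrp_SL2[OF stable_Wp] stable_Hgrp_SL2[OF stable_Wm] IrrD(1)[OF assms]] by blast
  then show False using ssum_Wp_Wm IrrD(2)[OF assms] stableD(1)[OF IrrD(1)[OF assms]] by auto
qed

lemma part_disjoint: "part Wp \<inter> part Wm = {}"
proof (rule ccontr)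
  assume "part Wp \<inter> part Wm \<noteq> {}"
  then obtain M where M: "M \<in> Irr" "M \<subseteq> Wp \<inter> Wm" by (auto simp: part_def)
  then show False using Wsum(1) IrrD(2)[OF M(1)] stable_contains_0[OF IrrD(1)[OF M(1)]] by blast
qed

text \<open>The sum of an H-orbit is H-stable and so fills the irreducible half; an irreducible
  subrepresentation of it must then belong to the orbit.\<close>

lemma orbit_part:
  assumes W: "W = Wp \<or> W = Wm" and M: "M \<in> part W"
  shows "{tr h M | h. h \<in> Hgrp v} = part W" "fsum (\<Union>(part W)) = W"
proof -
  have MI: "M \<in> Irr" "M \<subseteq> W" using M by (auto simp: part_def)
  have st: "stable (Hgrp v) W" using W stable_Wp stable_Wm by blast
  have HG: "Hgrp v \<subseteq> GL2" using Hgrp_GL2 by blast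
  let ?O = "{tr h M | h. h \<in> Hgrp v}"
  have sub1: "?O \<subseteq> part W"
  proof
    fix X assume "X \<in> ?O"
    then obtain h where h: "h \<in> Hgrp v" "X = tr h M" by blast
    have "X \<subseteq> W" using stableD(2)[OF st h(1)] MI(2) by (auto simp: h(2) tr_def)
    then show "X \<in> part W" using Irr_tr[OF MI(1) Hgrp_GL2[OF h(1)]] h(2) by (simp add: part_def)
  qed
  have st': "stable (Hgrp v) (fsum (\<Union>?O))" using orbit_stable[OF _ IrrD(1)[OF MI(1)]] by blast
  have "\<Union>?O \<subseteq> W" using sub1 unfolding part_def by blast
  then have le: "fsum (\<Union>?O) \<subseteq> W" using fsum_subset[of sc W] stableD(1)[OF st] by simp
  have "M \<subseteq> fsum (\<Union>?O)" using orbit_contains[OF _ IrrD(1)[OF MI(1)]] by blast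
  then have "fsum (\<Union>?O) \<noteq> {0}" using IrrD(2)[OF MI(1)] stable_contains_0[OF IrrD(1)[OF MI(1)]] by blast
  then have eq: "fsum (\<Union>?O) = W" using W Wp_irreducible[OF st'] Wm_irreducible[OF st'] le by blast
  show O: "?O = part W"
  proof
    show "part W \<subseteq> ?O"
    proof
      fix X assume X: "X \<in> part W"
      then have "X \<in> Irr" "X \<subseteq> fsum (\<Union>?O)" using eq by (auto simp: part_def)
      then obtain g where "g \<in> Hgrp v" "X = tr g M" using orbit_member[OF HG MI(1)] by blast
      then show "X \<in> ?O" by blast
    qed
  qed (rule sub1)
  show "fsum (\<Union>(part W)) = W" using eq unfolding O .
qed

lemma part_nonempty: "part Wp \<noteq> {}" "part Wm \<noteq> {}"
  using Irr_exists[OF stable_Hgrp_SL2[OF stable_Wp] nonzero(2)] Irr_exists[OF stable_Hgrp_SL2[OF stable_Wm] nonzero(3)]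
  by (auto simp: part_def)

lemma card_part: "card (part Wp) = card (part Wm)"
proof -
  define g where "g = dg (pw 1) 1"
  have g: "g \<in> GL2" "odd (v (mdet g))" by (auto simp: g_def)
  have fin: "finite (part Wp)" "finite (part Wm)" using finite_Irr by (auto simp: part_def)
  have inj: "inj_on (tr g) A" if "A \<subseteq> Irr" for A
  proof (rule inj_onI)
    fix X Y assume XY: "X \<in> A" "Y \<in> A" "tr g X = tr g Y"
    have "X \<subseteq> V" "Y \<subseteq> V" using XY that by (auto simp: Irr_def)
    then have "X = tr (minv g) (tr g X)" "Y = tr (minv g) (tr g Y)" using g by auto
    then show "X = Y" using XY(3) by simp
  qed
  have 1: "tr g ` part Wp \<subseteq> part Wm"
  proof
    fix X assume "X \<in> tr g ` part Wp"
    then obtain M where M: "M \<in> part Wp" "X = tr g M" by blast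
    have MI: "M \<in> Irr" "M \<subseteq> Wp" using M by (auto simp: part_def)
    have X: "X \<in> Irr" using Irr_tr[OF MI(1) g(1)] M by simp
    have "X \<subseteq> tr g Wp" using tr_mono[OF MI(2)] M by simp
    then have "X \<notin> part Wp" using tr_Wp(1)[OF g] IrrD(2)[OF X] stable_contains_0[OF IrrD(1)[OF X]]
      unfolding part_def by blast
    then show "X \<in> part Wm" using Irr_part[OF X] by blast
  qed
  obtain M0 where M0: "M0 \<in> part Wp" using part_nonempty by blast
  have M0I: "M0 \<in> Irr" using M0 by (simp add: part_def)
  have M0V: "M0 \<subseteq> V" using M0I by (simp add: Irr_def)
  \<comment> \<open>Each M in Wm is a translate of \<open>M0\<close> by some h outside H. As g is
    outside H too, g h lies in H and returns to Wp.\<close>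
  have 2: "tr g ` part Wm \<subseteq> part Wp"
  proof
    fix X assume "X \<in> tr g ` part Wm"
    then obtain M where M: "M \<in> part Wm" "X = tr g M" by blast
    have MI: "M \<in> Irr" "M \<subseteq> V" using M by (auto simp: part_def Irr_def)
    have "M \<subseteq> fsum (\<Union>{tr h M0 | h. h \<in> GL2})"
      using GL2_orbit_spans[OF IrrD(1,2)[OF M0I]] MI(2) by simp
    then obtain h where h: "h \<in> GL2" "M = tr h M0" using orbit_member[OF order_refl M0I MI(1)] by blast
    have "h \<notin> Hgrp v"
    proof
      assume "h \<in> Hgrp v"
      then have "M \<in> part Wp" using orbit_part(1)[OF _ M0] h(2) by blast
      then show False using M(1) part_disjoint by blast
    qed
    then have "odd (v (mdet h))" using h(1) by (simp add: Hgrp_iff)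
    then have gh: "mmul g h \<in> Hgrp v" using g h(1) Hgrp_odd_mmul by blast
    have "X = tr (mmul g h) M0" using tr_tr[OF g(1) h(1) M0V] h(2) M(2) by simp
    then show "X \<in> part Wp" using orbit_part(1)[OF _ M0] gh by blast
  qed
  have "card (part Wp) \<le> card (part Wm)"
    using card_inj_on_le[OF inj 1 fin(2)] by (auto simp: part_def)
  moreover have "card (part Wm) \<le> card (part Wp)"
    using card_inj_on_le[OF inj 2 fin(1)] by (auto simp: part_def)
  ultimately show ?thesis by simp
qed

lemma card_Irr: "card Irr = 2 * card (part Wp)" "card (part Wp) > 0"
proof -
  have fin: "finite (part Wp)" "finite (part Wm)" using finite_Irr by (auto simp: part_def)
  have "Irr = part Wp \<union> part Wm" using Irr_part by (auto simp: part_def)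
  then show "card Irr = 2 * card (part Wp)" using card_Un_disjoint[OF fin part_disjoint] card_part by simp
  show "card (part Wp) > 0" using part_nonempty(1) fin(1) by (simp add: card_gt_0_iff)
qed

text \<open>Modulo SL2 an element of H is a diagonal matrix whose entries have a unit ratio, and
  such a matrix normalises K'_j.\<close>

lemma dim_fixed_tr_Hgrp:
  assumes h: "h \<in> Hgrp v" and M: "stable SL2 M" and j: "j \<ge> 1"
  shows "has_dim sc (fixed \<rho> (Kc' v j) (tr h M)) d \<longleftrightarrow> has_dim sc (fixed \<rho> (Kc' v j) M) d"
proof -
  define e where "e = mdet h"
  have e: "e \<noteq> 0" using h by (simp add: e_def Hgrp_iff GL2_def)
  obtain l where l: "v e = l + l" using h by (auto simp: e_def Hgrp_iff elim: evenE)
  define p where "p = pw l"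
  have p: "p \<noteq> 0" "v p = l" by (auto simp: p_def)
  define r where "r = e / p / p"
  have r: "r \<noteq> 0" "v r = 0" using e p l by (auto simp: r_def v_divide simp del: divide_divide_eq_left)
  define g where "g = dg (e / p) p"
  have g: "g \<in> GL2" "mdet g = e" using e p by (auto simp: g_def)
  have gi: "minv g = dg (p / e) (1 / p)" using e p by (simp add: g_def)
  define s where "s = mmul (minv g) h"
  have s: "s \<in> SL2" using h g e by (simp add: s_def SL2_def mdet_mmul mdet_minv e_def)
  have hs: "h = mmul g s" using g by (simp add: s_def mmul_assoc[symmetric] del: mmul.simps)
  have sM: "sub M" using stableD(1)[OF M] .
  have "tr h M = tr g (tr s M)" using tr_tr[OF g(1) SL2_GL2[OF s], of M] hs sM by simp
  also have "tr s M = M" using tr_stable[OF M SL2_subset_GL2 s SL2_minv[OF s]] .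
  finally have hg: "tr h M = tr g M" .
  have n1: "mmul (mmul (minv g) k) g \<in> Kc' v j" if k: "k \<in> Kc' v j" for k
  proof -
    obtain a b c d where kk: "k = (a, b, c, d)" by (cases k)
    have I: "a - 1 \<in> P (int j)" "b \<in> P (int j)" "c \<in> P (int j)" "d - 1 \<in> P (int j)"
      using k j by (auto simp: kk Kc'_iff)
    have S: "mmul (mmul (minv g) k) g \<in> SL2" using k Kc'_SL2 g by (intro SL2_conj) auto
    have "mmul (mmul (minv g) k) g = (a, b / r, c * r, d)" using e p by (simp add: gi kk) (simp add: g_def r_def)
    moreover have "b / r \<in> P (int j)" "c * r \<in> P (int j)" using I r by (simp_all add: P_divide_iff P_mult_iff_right)
    ultimately show ?thesis using I S j by (simp add: Kc'_iff)
  qed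
  have n2: "mmul (mmul g k) (minv g) \<in> Kc' v j" if k: "k \<in> Kc' v j" for k
  proof -
    obtain a b c d where kk: "k = (a, b, c, d)" by (cases k)
    have I: "a - 1 \<in> P (int j)" "b \<in> P (int j)" "c \<in> P (int j)" "d - 1 \<in> P (int j)" "mdet k = 1"
      using k j by (auto simp: kk Kc'_iff SL2_def)
    have S: "mmul (mmul g k) (minv g) \<in> SL2" using I(5) g e by (simp add: SL2_def mdet_mmul mdet_minv)
    have "mmul (mmul g k) (minv g) = (a, b * r, c / r, d)" using e p by (simp add: gi kk) (simp add: g_def r_def)
    moreover have "b * r \<in> P (int j)" "c / r \<in> P (int j)" using I r by (simp_all add: P_divide_iff P_mult_iff_right)
    ultimately show ?thesis using I S j by (simp add: Kc'_iff)
  qed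
  have "fixed \<rho> (Kc' v j) (tr g M) = tr g (fixed \<rho> (Kc' v j) M)"
    using sM by (intro fixed_tr[OF _ g(1) Kc'_GL2 n1 n2]) auto
  then show ?thesis using hg has_dim_tr[OF g(1) sub_fixed[OF sM Kc'_GL2]] by simp
qed

lemma dim_fixed_fsum:
  assumes "finite \<S>" "\<S> \<subseteq> Irr" "\<And>M. M \<in> \<S> \<Longrightarrow> has_dim sc (fixed \<rho> (Kc' v j) M) d"
  shows "has_dim sc (fixed \<rho> (Kc' v j) (fsum (\<Union>\<S>))) (card \<S> * d)"
  using assms
proof (induction \<S> rule: finite_induct)
  case empty
  have "fixed \<rho> (Kc' v j) (fsum (\<Union>{})) = spanned sc 0 (\<lambda>_. 0)"
    using Kc'_GL2 rho_0 by (auto simp: fixed_def fsum_def spanned_def subset_iff)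
  moreover have "has_dim sc (spanned sc 0 (\<lambda>_. 0)) 0"
    by (rule has_dim_if_basis) (auto simp: indep_mod_def)
  ultimately show ?case by simp
next
  case (insert M \<S>)
  let ?F = "fsum (\<Union>\<S>)" and ?K = "Kc' v j"
  have MI: "M \<in> Irr" using insert.prems by blast
  have sM: "stable SL2 M" using IrrD(1)[OF MI] .
  have sS: "stable SL2 ?F" using stable_fsum_SL2[of \<S>] IrrD(1) insert.prems by blast
  have "W \<in> \<S> \<Longrightarrow> stable SL2 W \<and> W \<inter> M = {0}" for W
    using Irr_disjoint[of W M] IrrD(1)[of W] MI insert.prems(1) insert.hyps(2) by auto
  then have int: "?F \<inter> M = {0}" by (rule fsum_disjoint[OF _ sM])
  have eq: "fsum (\<Union>(insert M \<S>)) = ssum M ?F"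
  proof (intro equalityI subsetI)
    have "stable SL2 (ssum M ?F)" using stable_ssum[OF SL2_subset_GL2 sM sS] .
    moreover have "M \<subseteq> ssum M ?F" using ssumI[OF _ stable_contains_0[OF sS], of _ M] by fastforce
    moreover have "?F \<subseteq> ssum M ?F" using ssumI[OF stable_contains_0[OF sM], of _ ?F] by fastforce
    moreover have "\<Union>\<S> \<subseteq> ?F" by (rule subset_fsum)
    ultimately have "fsum (\<Union>(insert M \<S>)) \<subseteq> ssum M ?F"
      using stableD(1)[of SL2 "ssum M ?F"] by (intro fsum_subset) auto
    then show "x \<in> ssum M ?F" if "x \<in> fsum (\<Union>(insert M \<S>))" for x using that by blast
  next
    fix x assume "x \<in> ssum M ?F"
    then obtain y z where yz: "y \<in> M" "z \<in> ?F" "x = y + z" by (rule ssumE)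
    have st: "stable SL2 (fsum (\<Union>(insert M \<S>)))"
      by (rule stable_fsum_SL2) (use IrrD(1) insert.prems in blast)
    have "y \<in> fsum (\<Union>(insert M \<S>))" using subset_fsum[of "\<Union>(insert M \<S>)"] yz(1) by blast
    moreover have "z \<in> fsum (\<Union>(insert M \<S>))" using fsum_mono[of "\<Union>\<S>" "\<Union>(insert M \<S>)"] yz(2) by blast
    ultimately show "x \<in> fsum (\<Union>(insert M \<S>))"
      unfolding yz(3) by (rule subspD(2)[OF stable_subsp[OF st]])
  qed
  have inv: "invariant \<rho> ?K A" if "stable SL2 A" for A
    using stableD(2)[OF that] Kc'_SL2 unfolding invariant_def by blast
  have int': "M \<inter> ?F = {0}" using int by blast
  have "fixed \<rho> ?K (ssum M ?F) = ssum (fixed \<rho> ?K M) (fixed \<rho> ?K ?F)"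
    by (rule fixed_ssum[OF stableD(1)[OF sM] stableD(1)[OF sS] int' Kc'_GL2 inv[OF sM] inv[OF sS]])
  moreover have "has_dim sc (ssum (fixed \<rho> ?K M) (fixed \<rho> ?K ?F)) (d + card \<S> * d)"
  proof (rule has_dim_ssum)
    show "has_dim sc (fixed \<rho> ?K M) d" using insert.prems by blast
    show "has_dim sc (fixed \<rho> ?K ?F) (card \<S> * d)" using insert by blast
    show f: "sub (fixed \<rho> ?K M)" "sub (fixed \<rho> ?K ?F)"
      using sub_fixed[OF stableD(1)[OF sM] Kc'_GL2] sub_fixed[OF stableD(1)[OF sS] Kc'_GL2] by simp_all
    have "0 \<in> fixed \<rho> ?K M" "0 \<in> fixed \<rho> ?K ?F"
      using subspD(1)[OF conjunct1[OF f(1)]] subspD(1)[OF conjunct1[OF f(2)]] by simp_all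
    moreover have "fixed \<rho> ?K M \<subseteq> M" "fixed \<rho> ?K ?F \<subseteq> ?F" by (auto simp: fixed_def)
    ultimately show "fixed \<rho> ?K M \<inter> fixed \<rho> ?K ?F = {0}" using int' by blast
  qed
  ultimately show ?case using insert.hyps unfolding eq by simp
qed

text \<open>The constituents of one half are H-translates of each other, so they share the fixed
  vectors of the half equally.\<close>

lemma dim_constituent:
  assumes W: "W = Wp \<or> W = Wm" and M: "M \<in> part W" and j: "j \<ge> 1" and D: "has_dim sc (fixed \<rho> (Kc' v j) W) D"
  shows "\<exists>d. has_dim sc (fixed \<rho> (Kc' v j) M) d \<and> D = card (part Wp) * d"
proof -
  have sW: "sub W" using W sub_W by blast
  have MI: "M \<in> Irr" "M \<subseteq> W" using M by (auto simp: part_def)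
  have sf: "sub (fixed \<rho> (Kc' v j) W)" using sub_fixed[OF sW Kc'_GL2] .
  have "fixed \<rho> (Kc' v j) M \<subseteq> fixed \<rho> (Kc' v j) W" using MI(2) by (auto simp: fixed_def)
  then obtain d where d: "has_dim sc (fixed \<rho> (Kc' v j) M) d" using has_dim_subspace[OF D sf] by blast
  have all: "has_dim sc (fixed \<rho> (Kc' v j) X) d" if "X \<in> part W" for X
  proof -
    have "X \<in> {tr h M | h. h \<in> Hgrp v}" using that unfolding orbit_part(1)[OF W M] .
    then obtain h where "h \<in> Hgrp v" "X = tr h M" by blast
    then show ?thesis using dim_fixed_tr_Hgrp[OF _ IrrD(1)[OF MI(1)] j] d by simp
  qed
  have "finite (part W)" using finite_Irr by (simp add: part_def)
  moreover have "part W \<subseteq> Irr" by (auto simp: part_def)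
  ultimately have "has_dim sc (fixed \<rho> (Kc' v j) (fsum (\<Union>(part W)))) (card (part W) * d)"
    using all by (rule dim_fixed_fsum)
  then have "D = card (part W) * d" using has_dim_unique[OF D] orbit_part(2)[OF W M] sf by simp
  then show ?thesis using d W card_part by auto
qed

section \<open>The dimension formulas\<close>

lemma dim_subquotient:
  "\<exists>N. \<forall>j\<ge>N. \<forall>Q\<in>IQ. \<exists>n. has_qdim sc (snd Q) (qfixed \<rho> (Kc' v j) (fst Q) (snd Q)) n \<and>
     real n = (if (odd j \<and> occurs_in sc \<rho> SL2 Q Wp) \<or> (even j \<and> occurs_in sc \<rho> SL2 Q Wm)
               then (real_of_int a + 2 * real q ^ j) / real (card (Lset sc \<rho> SL2 V))
               else (real_of_int a + 2 * real q ^ (j - 1)) / real (card (Lset sc \<rho> SL2 V)))"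
proof -
  obtain N where N: "\<And>j. j \<ge> N \<Longrightarrow>
      (\<exists>d. has_dim sc (fixed \<rho> (Kc' v j) Wp) d \<and> 2 * int d = a + 2 * int q ^ (if odd j then j else j - 1))
    \<and> (\<exists>d. has_dim sc (fixed \<rho> (Kc' v j) Wm) d \<and> 2 * int d = a + 2 * int q ^ (if even j then j else j - 1))"
    using dim_fixed_Kc' by blast
  show ?thesis
  proof (rule exI[of _ "Suc N"], intro allI impI ballI)
    fix j and Q assume j: "Suc N \<le> j" and Q: "Q \<in> IQ"
    obtain A B where AB: "Q = (A, B)" by (cases Q)
    define C where "C = constit Q"
    have CI: "C \<in> Irr" using constit(1) Q by (simp add: C_def AB)
    have occ: "occurs_in sc \<rho> SL2 Q Wp \<longleftrightarrow> C \<in> part Wp" "occurs_in sc \<rho> SL2 Q Wm \<longleftrightarrow> C \<in> part Wm"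
      using occurs_in_iff[OF Q] sub_W CI by (auto simp: part_def C_def)
    define e where "e = (if (odd j \<and> C \<in> part Wp) \<or> (even j \<and> C \<in> part Wm) then j else j - 1)"
    have "\<exists>D W. (W = Wp \<or> W = Wm) \<and> C \<in> part W \<and> has_dim sc (fixed \<rho> (Kc' v j) W) D \<and> 2 * int D = a + 2 * int q ^ e"
    proof (cases "C \<in> part Wp")
      case True
      then have "C \<notin> part Wm" using part_disjoint by blast
      then have "e = (if odd j then j else j - 1)" using True by (simp add: e_def)
      then have "\<exists>d. has_dim sc (fixed \<rho> (Kc' v j) Wp) d \<and> 2 * int d = a + 2 * int q ^ e" using N[of j] j by simp
      then show ?thesis using True by blast
    next
      case False
      then have m: "C \<in> part Wm" using Irr_part[OF CI] by blast
      then have "e = (if even j then j else j - 1)" using False by (simp add: e_def)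
      then have "\<exists>d. has_dim sc (fixed \<rho> (Kc' v j) Wm) d \<and> 2 * int d = a + 2 * int q ^ e" using N[of j] j by simp
      then show ?thesis using m by blast
    qed
    then obtain D W where DW: "W = Wp \<or> W = Wm" "C \<in> part W" "has_dim sc (fixed \<rho> (Kc' v j) W) D"
      "2 * int D = a + 2 * int q ^ e" by blast
    obtain d where d: "has_dim sc (fixed \<rho> (Kc' v j) C) d" "D = card (part Wp) * d"
      using dim_constituent[OF DW(1,2) _ DW(3)] j by auto
    have "has_qdim sc B (qfixed \<rho> (Kc' v j) A B) d" using qdim_qfixed[of A B j d] Q d(1) by (simp add: AB C_def)
    moreover have "real d = (real_of_int a + 2 * real q ^ e) / real (card (Lset sc \<rho> SL2 V))"
    proof -
      have "real_of_int (2 * int D) = real_of_int (a + 2 * int q ^ e)" using DW(4) by (rule arg_cong)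
      then have "2 * (real (card (part Wp)) * real d) = real_of_int a + 2 * real q ^ e" by (simp add: d(2))
      \<comment> \<open>The halves have equally many constituents, so |L| is twice that number and
        the factor 2 in 2 D is absorbed.\<close>
      then show ?thesis using card_Lset card_Irr by (simp add: field_simps)
    qed
    ultimately show "\<exists>n. has_qdim sc (snd Q) (qfixed \<rho> (Kc' v j) (fst Q) (snd Q)) n \<and>
     real n = (if (odd j \<and> occurs_in sc \<rho> SL2 Q Wp) \<or> (even j \<and> occurs_in sc \<rho> SL2 Q Wm)
               then (real_of_int a + 2 * real q ^ j) / real (card (Lset sc \<rho> SL2 V))
               else (real_of_int a + 2 * real q ^ (j - 1)) / real (card (Lset sc \<rho> SL2 V)))"
      unfolding occ by (intro exI[of _ d]) (simp add: AB e_def)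
  qed
qed

lemma dim_halves:
  "\<exists>M. \<forall>m\<ge>M.
     (\<forall>j\<in>{2*m+1, 2*m+2}. \<exists>n. has_dim sc (fixed \<rho> (Kc' v j) Wp) n \<and>
          real n = real_of_int a / 2 + real q ^ (2*m+1)) \<and>
     (\<forall>j\<in>{2*m, 2*m+1}. \<exists>n. has_dim sc (fixed \<rho> (Kc' v j) Wm) n \<and>
          real n = real_of_int a / 2 + real q ^ (2*m))"
proof -
  obtain N where N: "\<And>j. j \<ge> N \<Longrightarrow>
      (\<exists>d. has_dim sc (fixed \<rho> (Kc' v j) Wp) d \<and> 2 * int d = a + 2 * int q ^ (if odd j then j else j - 1))
    \<and> (\<exists>d. has_dim sc (fixed \<rho> (Kc' v j) Wm) d \<and> 2 * int d = a + 2 * int q ^ (if even j then j else j - 1))"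
    using dim_fixed_Kc' by blast
  have real: "real d = real_of_int a / 2 + real q ^ e" if "2 * int d = a + 2 * int q ^ e" for d e
  proof -
    have "real_of_int (2 * int d) = real_of_int (a + 2 * int q ^ e)" using that by (rule arg_cong)
    then show ?thesis by simp
  qed
  show ?thesis
  proof (rule exI[of _ N], intro allI impI conjI ballI)
    fix m j assume m: "N \<le> m" and j: "j \<in> {2*m+1, 2*m+2}"
    have "(if odd j then j else j - 1) = 2*m+1" using j by auto
    then show "\<exists>n. has_dim sc (fixed \<rho> (Kc' v j) Wp) n \<and> real n = real_of_int a / 2 + real q ^ (2*m+1)"
      using N[of j] j m real by fastforce
  next
    fix m j assume m: "N \<le> m" and j: "j \<in> {2*m, 2*m+1}"
    have "(if even j then j else j - 1) = 2*m" using j by auto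
    then show "\<exists>n. has_dim sc (fixed \<rho> (Kc' v j) Wm) n \<and> real n = real_of_int a / 2 + real q ^ (2*m)"
      using N[of j] j m real by fastforce
  qed
qed

end

theorem theorem7p10:
  fixes v :: "'f::field \<Rightarrow> int" and q :: nat
    and sc :: "'r::field \<Rightarrow> 'v::ab_group_add \<Rightarrow> 'v" and V :: "'v set"
    and \<rho> :: "'f mat2 \<Rightarrow> 'v \<Rightarrow> 'v"
    and \<psi> :: "'f \<Rightarrow> 'r" and Wp Wm :: "'v set" and a :: int
  assumes F: "nonarch_local_field v q"
    and R: "alg_closed TYPE('r)" and charR: "(of_nat q :: 'r) \<noteq> 0"
    and rep: "smooth_rep v sc V \<rho>" and irr: "irred_on sc \<rho> GL2 V" and infdim: "infinite_dim sc V"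
    and Hred: "\<not> irred_on sc \<rho> (Hgrp v) V"
    and psi_char: "\<forall>x y. \<psi> (x + y) = \<psi> x * \<psi> y" and psi0: "\<psi> 0 = 1"
    and psi_P: "\<forall>x\<in>vpow v 1. \<psi> x = 1" and psi_O: "\<exists>x\<in>vpow v 0. \<psi> x \<noteq> 1"
    and Wp: "irred_on sc \<rho> (Hgrp v) Wp" and Wm: "irred_on sc \<rho> (Hgrp v) Wm"
    and Wsum: "Wp \<inter> Wm = {0}" "{x + y | x y. x \<in> Wp \<and> y \<in> Wm} = V"
    and Wwhit: "whittaker sc \<rho> \<psi> Wp"
    and aPi: "\<exists>N. \<forall>j\<ge>N. virt_eq_on sc V \<rho> v a (Iw v j)"
  shows "(\<exists>M. \<forall>m\<ge>M.
            (\<forall>j\<in>{2*m+1, 2*m+2}. \<exists>n. has_dim sc (fixed \<rho> (Kc' v j) Wp) n \<and>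
                 real n = real_of_int a / 2 + real q ^ (2*m+1)) \<and>
            (\<forall>j\<in>{2*m, 2*m+1}. \<exists>n. has_dim sc (fixed \<rho> (Kc' v j) Wm) n \<and>
                 real n = real_of_int a / 2 + real q ^ (2*m)))
       \<and> (\<exists>N. \<forall>j\<ge>N. \<forall>P\<in>irr_subquot sc \<rho> SL2 V.
            \<exists>n. has_qdim sc (snd P) (qfixed \<rho> (Kc' v j) (fst P) (snd P)) n \<and>
              real n = (if (odd j \<and> occurs_in sc \<rho> SL2 P Wp) \<or> (even j \<and> occurs_in sc \<rho> SL2 P Wm)
                        then (real_of_int a + 2 * real q ^ j) / real (card (Lset sc \<rho> SL2 V))
                        else (real_of_int a + 2 * real q ^ (j - 1)) / real (card (Lset sc \<rho> SL2 V))))"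
proof -
  interpret gl2split v q \<psi> sc V \<rho> a Wp Wm
    using F charR psi_char psi0 psi_P psi_O rep aPi irr Wp Wm Wsum Wwhit infdim
    by unfold_locales (auto simp: smooth_rep_def)
  show ?thesis using dim_halves dim_subquotient by blast
qed

end
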